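(* Let $(A,\sigma)$ be a real involutive algebra, $G_0\le A^\times$ a connected Lie subgroup closed under $\sigma$ with Lie algebra $B$, and $G$ the minimal extension of $G_0$. Assume that $B$ is Hermitian. Then: (1) The cone of squares $B^\sigma_+\subset B^\sigma$, with $G$ acting by $g\cdot b=g\,b\,\sigma(g)$, is a model for the Riemannian symmetric space of $G$. (2) The upper half-space $$\mathfrak U=\{z\in B^\sigma\otimes_{\mathbb R}\mathbb C\mid \mathrm{Im}(z)\in B^\sigma_+\},$$ with $\mathrm{Sp}_2(G,\sigma)$ acting by M\"obius transformations $\begin{pmatrix}a&b\\c&d\end{pmatrix}.z=(az+b)(cz+d)^{-1}$ (computed in $A\otimes_{\mathbb R}\mathbb C$), is a model for the Riemannian symmetric space of $\mathrm{Sp}_2(G,\sigma)$.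
   Context: A space $X$ with a continuous action of a Lie group $H$ is called a model of the Riemannian symmetric space of $H$ if the action is transitive and the stabilizer of a point is a maximal compact subgroup $K$ of $H$, the orbit map inducing an $H$-equivariant homeomorphism $H/K\to X$. A real involutive algebra $(A,\sigma)$ is a unital associative finite-dimensional semisimple $\mathbb R$-algebra $A$ with an $\mathbb R$-linear map $\sigma:A\to A$, $\sigma(ab)=\sigma(b)\sigma(a)$, $\sigma^2=\mathrm{Id}$. $A^\times$ is the Lie group of invertible elements, with Lie algebra $A$, $[x,y]=xy-yx$. Lie subgroups of $A^\times$ are understood to be closed in $A^\times$. For $X\subseteq A$ write $X^\times=X\cap A^\times$. For a Lie subalgebra $B\subseteq A$ with $\sigma(B)=B$ put $B^\sigma=\{b\in B\mid\sigma(b)=b\}$. $B$ is of Jordan type if $xy\in B$ for all $x,y\in B^\sigma$. $B^\sigma_{\ge0}$ is the closed convex cone in $B^\sigma$ generated by squares of elements of $B^\sigma$. $B$ is weakly Hermitian if it is of Jordan type, $1\in B$, $B^\sigma_{\ge0}$ contains no line, and for $b\in B^\sigma$, $b^2=0$ implies $b=0$; then $B^\sigma_+:=(B^\sigma_{\ge0})^\times$. With $x\circ y=\frac{xy+yx}2$, idempotents $c,c'\in B^\sigma$ ($c^2=c$) are orthogonal if $c\circ c'=0$; a nonzero idempotent is primitive if it is not a sum of two nonzero orthogonal idempotents; a Jordan frame is a tuple of pairwise orthogonal primitive idempotents of $B^\sigma$ with sum $1$. For $G_0$ the connected Lie subgroup with Lie algebra $B$, let $\mathrm O(G_0,\sigma)=\{u\in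 G_0\mid\sigma(u)u=1\}$. $B$ is Hermitian if it is weakly Hermitian, $\mathrm O(G_0,\sigma)$ is compact, and $\mathrm O(G_0,\sigma)$ acts transitively by conjugation on the Jordan frames of $B^\sigma$. The minimal extension $G$ of $G_0$ is the subgroup of $A^\times$ generated by $G_0$ and $(B^\sigma)^\times$. $\mathrm{Sp}_2(A,\sigma)$ is the group of $M\in\mathrm{GL}_2(A)$ with $\sigma(M)^t\Omega M=\Omega$, $\Omega=\begin{pmatrix}0&1\\-1&0\end{pmatrix}$. $\mathrm{Sp}_2(G,\sigma)$ is the topological closure in $\mathrm{Sp}_2(A,\sigma)$ of the set of products $\begin{pmatrix}1&0\\ y&1\end{pmatrix}\begin{pmatrix}x&0\\0&\sigma(x)^{-1}\end{pmatrix}\begin{pmatrix}1&z\\0&1\end{pmatrix}$ with $x\in G$, $y,z\in B^\sigma$; it is a Lie group. *)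

theory Defs
  imports
    "HOL-Analysis.Analysis"
    "HOL-Algebra.Group_Action"
    "HOL-Algebra.Generated_Groups"
begin

section \<open>Models of Riemannian symmetric spaces\<close>

definition quotient_topology :: "'a topology \<Rightarrow> ('a \<Rightarrow> 'b) \<Rightarrow> 'b topology" where
  "quotient_topology X f =
     topology (\<lambda>V. V \<subseteq> f ` topspace X \<and> openin X {x \<in> topspace X. f x \<in> V})"

lemma openin_quotient_topology:
  "openin (quotient_topology X f) V \<longleftrightarrow>
     V \<subseteq> f ` topspace X \<and> openin X {x \<in> topspace X. f x \<in> V}"
proof -
  have "istopology (\<lambda>V. V \<subseteq> f ` topspace X \<and> openin X {x \<in> topspace X. f x \<in> V})"
    (is "istopology ?P")
    unfolding istopology_def
  proof (intro conjI allI impI)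
    fix S T assume "?P S" "?P T"
    moreover have "{x \<in> topspace X. f x \<in> S \<inter> T} =
        {x \<in> topspace X. f x \<in> S} \<inter> {x \<in> topspace X. f x \<in> T}" by auto
    ultimately show "S \<inter> T \<subseteq> f ` topspace X" "openin X {x \<in> topspace X. f x \<in> S \<inter> T}"
      by auto
  next
    fix \<K> assume *: "\<forall>K\<in>\<K>. ?P K"
    then show "\<Union>\<K> \<subseteq> f ` topspace X" by blast
    have "{x \<in> topspace X. f x \<in> \<Union>\<K>} = (\<Union>K\<in>\<K>. {x \<in> topspace X. f x \<in> K})" by auto
    then show "openin X {x \<in> topspace X. f x \<in> \<Union>\<K>}" using * by auto
  qed
  then show ?thesis by (simp add: quotient_topology_def)
qed

definition coset_space :: "('g::topological_space) monoid \<Rightarrow> 'g set \<Rightarrow> 'g set topology" where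
  "coset_space H K = quotient_topology (top_of_set (carrier H)) (\<lambda>h. h <#\<^bsub>H\<^esub> K)"

definition maximal_compact_subgroup :: "('g::topological_space) set \<Rightarrow> 'g monoid \<Rightarrow> bool" where
  "maximal_compact_subgroup K H \<longleftrightarrow>
     subgroup K H \<and> compact K \<and>
     (\<forall>K'. subgroup K' H \<and> compact K' \<and> K \<subseteq> K' \<longrightarrow> K' = K)"

text \<open>Every Lie group below is a closed subgroup of the unit group \<open>U\<close> of a finite-dimensional
  real algebra, with the subspace topology.\<close>

definition lie_subgroup :: "('g::topological_space) set \<Rightarrow> 'g monoid \<Rightarrow> bool" where
  "lie_subgroup H U \<longleftrightarrow> subgroup H U \<and> closedin (top_of_set (carrier U)) H"

text \<open>As everywhere in the library theory of group actions, \<open>\<alpha> h\<close> is an extensional function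
  on \<open>X\<close>.\<close>

definition symmetric_space_model ::
  "('g::topological_space) monoid \<Rightarrow> 'g set \<Rightarrow> ('x::topological_space) set \<Rightarrow> ('g \<Rightarrow> 'x \<Rightarrow> 'x) \<Rightarrow> bool"
  where
  "symmetric_space_model U H X \<alpha> \<longleftrightarrow>
     lie_subgroup H U \<and>
     (let L = U\<lparr>carrier := H\<rparr> in
        transitive_action L X \<alpha> \<and>
        continuous_on (H \<times> X) (\<lambda>(h, x). \<alpha> h x) \<and>
        (\<exists>x\<in>X. let K = stabilizer L \<alpha> x in
           maximal_compact_subgroup K L \<and>
           (\<exists>\<phi>. (\<forall>h\<in>H. \<phi> (h <#\<^bsub>L\<^esub> K) = \<alpha> h x) \<and>
                (\<forall>h\<in>H. \<forall>C\<in>topspace (coset_space L K). \<phi> (h <#\<^bsub>L\<^esub> C) = \<alpha> h (\<phi> C)) \<and>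
                homeomorphic_map (coset_space L K) (top_of_set X) \<phi>)))"


section \<open>Real involutive algebras\<close>

text \<open>A nonzero finite-dimensional unital real algebra always carries a complete submultiplicative
  norm with \<open>norm 1 = 1\<close>, and all its norms induce the same topology. The norm provided by the
  type class thus only serves to make topology and exponential function available.\<close>

definition left_ideal :: "('a::real_algebra_1) set \<Rightarrow> bool" where
  "left_ideal I \<longleftrightarrow> subspace I \<and> (\<forall>a. \<forall>x\<in>I. a * x \<in> I)"

definition semisimple_algebra :: "('a::real_algebra_1) itself \<Rightarrow> bool" where
  "semisimple_algebra _ \<longleftrightarrow>
     (\<forall>I::'a set. left_ideal I \<longrightarrow>
        (\<exists>J. left_ideal J \<and> I \<inter> J = {0} \<and> {x + y | x y. x \<in> I \<and> y \<in> J} = UNIV))"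

definition real_involutive_algebra :: "('a::{real_normed_algebra_1,banach} \<Rightarrow> 'a) \<Rightarrow> bool" where
  "real_involutive_algebra \<sigma> \<longleftrightarrow>
     (\<exists>S::'a set. finite S \<and> span S = UNIV) \<and>
     semisimple_algebra TYPE('a) \<and>
     linear \<sigma> \<and> (\<forall>a b. \<sigma> (a * b) = \<sigma> b * \<sigma> a) \<and> (\<forall>a. \<sigma> (\<sigma> a) = a)"

definition alg_units :: "('a::ring_1) monoid" where
  "alg_units = units_of \<lparr>carrier = UNIV, monoid.mult = (*), one = 1\<rparr>"

definition connected_lie_subgroup :: "('a::{real_normed_algebra_1,banach}) set \<Rightarrow> bool" where
  "connected_lie_subgroup G \<longleftrightarrow> lie_subgroup G alg_units \<and> connected G"

definition lie_algebra :: "('a::{real_normed_algebra_1,banach}) set \<Rightarrow> 'a set" where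
  "lie_algebra G = {x. \<forall>t::real. exp (t *\<^sub>R x) \<in> G}"

definition lie_subalgebra :: "('a::real_algebra_1) set \<Rightarrow> bool" where
  "lie_subalgebra B \<longleftrightarrow> subspace B \<and> (\<forall>x\<in>B. \<forall>y\<in>B. x * y - y * x \<in> B)"


section \<open>Hermitian Lie subalgebras\<close>

definition sym_part :: "('a \<Rightarrow> 'a) \<Rightarrow> 'a set \<Rightarrow> 'a set" where
  "sym_part \<sigma> B = {b \<in> B. \<sigma> b = b}"

definition jordan_type :: "('a::real_algebra_1 \<Rightarrow> 'a) \<Rightarrow> 'a set \<Rightarrow> bool" where
  "jordan_type \<sigma> B \<longleftrightarrow>
     lie_subalgebra B \<and> \<sigma> ` B = B \<and> (\<forall>x\<in>sym_part \<sigma> B. \<forall>y\<in>sym_part \<sigma> B. x * y \<in> B)"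

text \<open>If \<open>B\<close> is of Jordan type and \<open>A\<close> is finite-dimensional, then \<open>sym_part \<sigma> B\<close> is a closed
  subspace containing the squares of its elements, so that it makes no difference whether the
  hull is formed in it or in \<open>A\<close>.\<close>

definition nonneg_cone :: "('a::real_normed_algebra_1 \<Rightarrow> 'a) \<Rightarrow> 'a set \<Rightarrow> 'a set" where
  "nonneg_cone \<sigma> B = (\<lambda>C. closed C \<and> convex_cone C) hull {b * b | b. b \<in> sym_part \<sigma> B}"

definition pos_cone :: "('a::real_normed_algebra_1 \<Rightarrow> 'a) \<Rightarrow> 'a set \<Rightarrow> 'a set" where
  "pos_cone \<sigma> B = nonneg_cone \<sigma> B \<inter> carrier alg_units"

definition contains_line :: "('a::real_vector) set \<Rightarrow> bool" where
  "contains_line C \<longleftrightarrow> (\<exists>p v. v \<noteq> 0 \<and> (\<forall>t::real. p + t *\<^sub>R v \<in> C))"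

definition weakly_hermitian :: "('a::real_normed_algebra_1 \<Rightarrow> 'a) \<Rightarrow> 'a set \<Rightarrow> bool" where
  "weakly_hermitian \<sigma> B \<longleftrightarrow>
     jordan_type \<sigma> B \<and> 1 \<in> B \<and> \<not> contains_line (nonneg_cone \<sigma> B) \<and>
     (\<forall>b\<in>sym_part \<sigma> B. b * b = 0 \<longrightarrow> b = 0)"

definition jordan_prod :: "'a::real_algebra_1 \<Rightarrow> 'a \<Rightarrow> 'a" where
  "jordan_prod x y = (1/2) *\<^sub>R (x * y + y * x)"

definition idempotents :: "('a::real_algebra_1 \<Rightarrow> 'a) \<Rightarrow> 'a set \<Rightarrow> 'a set" where
  "idempotents \<sigma> B = {c \<in> sym_part \<sigma> B. c * c = c}"

definition primitive_idempotent :: "('a::real_algebra_1 \<Rightarrow> 'a) \<Rightarrow> 'a set \<Rightarrow> 'a \<Rightarrow> bool" where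
  "primitive_idempotent \<sigma> B c \<longleftrightarrow>
     c \<in> idempotents \<sigma> B \<and> c \<noteq> 0 \<and>
     \<not> (\<exists>d\<in>idempotents \<sigma> B. \<exists>e\<in>idempotents \<sigma> B.
          d \<noteq> 0 \<and> e \<noteq> 0 \<and> jordan_prod d e = 0 \<and> c = d + e)"

text \<open>Jordan frames are tuples, hence ordered.\<close>

definition jordan_frame :: "('a::real_algebra_1 \<Rightarrow> 'a) \<Rightarrow> 'a set \<Rightarrow> 'a list \<Rightarrow> bool" where
  "jordan_frame \<sigma> B cs \<longleftrightarrow>
     (\<forall>c\<in>set cs. primitive_idempotent \<sigma> B c) \<and>
     (\<forall>i<length cs. \<forall>j<length cs. i \<noteq> j \<longrightarrow> jordan_prod (cs ! i) (cs ! j) = 0) \<and>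
     sum_list cs = 1"

definition orthogonal_group :: "('a::real_algebra_1) set \<Rightarrow> ('a \<Rightarrow> 'a) \<Rightarrow> 'a set" where
  "orthogonal_group G \<sigma> = {u \<in> G. \<sigma> u * u = 1}"

text \<open>Here \<open>G\<^sub>0\<close> is meant to be the connected Lie subgroup with Lie algebra \<open>B\<close>.\<close>

definition hermitian ::
  "('a::{real_normed_algebra_1,banach} \<Rightarrow> 'a) \<Rightarrow> 'a set \<Rightarrow> 'a set \<Rightarrow> bool" where
  "hermitian \<sigma> G\<^sub>0 B \<longleftrightarrow>
     weakly_hermitian \<sigma> B \<and>
     compact (orthogonal_group G\<^sub>0 \<sigma>) \<and>
     (\<forall>cs ds. jordan_frame \<sigma> B cs \<and> jordan_frame \<sigma> B ds \<longrightarrow>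
        (\<exists>u\<in>orthogonal_group G\<^sub>0 \<sigma>. map (\<lambda>c. u * c * inv\<^bsub>alg_units\<^esub> u) cs = ds))"

definition minimal_extension :: "('a::real_algebra_1 \<Rightarrow> 'a) \<Rightarrow> 'a set \<Rightarrow> 'a set \<Rightarrow> 'a set" where
  "minimal_extension \<sigma> G\<^sub>0 B =
     generate alg_units (G\<^sub>0 \<union> (sym_part \<sigma> B \<inter> carrier alg_units))"


section \<open>Symplectic groups and the upper half-space\<close>

definition mat2 :: "'a::zero \<Rightarrow> 'a \<Rightarrow> 'a \<Rightarrow> 'a \<Rightarrow> 'a^2^2" where
  "mat2 a b c d = vector [vector [a, b], vector [c, d]]"

definition GL2 :: "(('a::ring_1)^2^2) monoid" where
  "GL2 = units_of \<lparr>carrier = UNIV, monoid.mult = (**), one = mat 1\<rparr>"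

definition Sp2 :: "('a::ring_1 \<Rightarrow> 'a) \<Rightarrow> ('a^2^2) set" where
  "Sp2 \<sigma> = {M \<in> carrier GL2.
     transpose (map_matrix \<sigma> M) ** mat2 0 1 (-1) 0 ** M = mat2 0 1 (-1) 0}"

definition Sp2_group ::
  "('a::real_normed_algebra_1) set \<Rightarrow> 'a set \<Rightarrow> ('a \<Rightarrow> 'a) \<Rightarrow> ('a^2^2) set" where
  "Sp2_group G B \<sigma> = (top_of_set (Sp2 \<sigma>)) closure_of
     {mat2 1 0 y 1 ** mat2 x 0 0 (inv\<^bsub>alg_units\<^esub> (\<sigma> x)) ** mat2 1 z 0 1 | x y z.
        x \<in> G \<and> y \<in> sym_part \<sigma> B \<and> z \<in> sym_part \<sigma> B}"

text \<open>The algebra \<open>A \<otimes>\<^sub>\<real> \<complex>\<close> is realised on \<open>A \<times> A\<close>, the pair \<open>(x, y)\<close> standing for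
  \<open>x \<otimes> 1 + y \<otimes> \<i>\<close>; addition is that of the product type.\<close>

definition complexification :: "(('a::ring_1) \<times> 'a) monoid" where
  "complexification =
     \<lparr>carrier = UNIV,
      monoid.mult = (\<lambda>(x, y) (x', y'). (x * x' - y * y', x * y' + y * x')),
      one = (1, 0)\<rparr>"

definition moebius_num :: "('a::ring_1)^2^2 \<Rightarrow> 'a \<times> 'a \<Rightarrow> 'a \<times> 'a" where
  "moebius_num M z = (M $ 1 $ 1, 0) \<otimes>\<^bsub>complexification\<^esub> z + (M $ 1 $ 2, 0)"

definition moebius_denom :: "('a::ring_1)^2^2 \<Rightarrow> 'a \<times> 'a \<Rightarrow> 'a \<times> 'a" where
  "moebius_denom M z = (M $ 2 $ 1, 0) \<otimes>\<^bsub>complexification\<^esub> z + (M $ 2 $ 2, 0)"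

definition moebius_action :: "('a::ring_1)^2^2 \<Rightarrow> 'a \<times> 'a \<Rightarrow> 'a \<times> 'a" where
  "moebius_action M z =
     moebius_num M z \<otimes>\<^bsub>complexification\<^esub> inv\<^bsub>complexification\<^esub> (moebius_denom M z)"

definition upper_half_space ::
  "('a::real_normed_algebra_1 \<Rightarrow> 'a) \<Rightarrow> 'a set \<Rightarrow> ('a \<times> 'a) set" where
  "upper_half_space \<sigma> B = {z \<in> sym_part \<sigma> B \<times> sym_part \<sigma> B. snd z \<in> pos_cone \<sigma> B}"

end

theory Submission
  imports Defs "HOL-Computational_Algebra.Fundamental_Theorem_Algebra"
begin

text \<open>In both parts the orbit map of the base point has an explicit continuous section. Such a section
makes the orbit map open, and it reduces the maximality of the stabilizer to a statement about single
elements: no element of the section other than the one over the base point lies in a compact subgroup.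
This is the criterion \<open>symmetric_space_modelI\<close>; the work lies in verifying its hypotheses.

For the cone, let \<open>J\<close> be the symmetric part of \<open>B\<close>. A cone of squares
without lines forces \<open>J\<close> to be formally real, so every element of \<open>J\<close> is a real combination of
orthogonal primitive idempotents (\<open>spectral_theorem\<close>). The trace of left multiplication is then a
positive definite associative form on \<open>J\<close>, and a Peirce decomposition shows that squares pair
nonnegatively with squares. Hence the squares form a self-dual closed convex cone
(\<open>psd_eq_squares\<close>). Its invertible elements are the exponentials of elements of \<open>J\<close>; they form a
set that is both open and closed among the units of \<open>J\<close>, which therefore contains \<open>g * \<sigma> g\<close> for all
\<open>g\<close> in the connected group \<open>G\<^sub>0\<close>, which yields the polar decomposition of \<open>G\<^sub>0\<close>: the
positive square root of \<open>g * \<sigma> g\<close> times an element of the orthogonal group. The square root is the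
section. Conjugacy of Jordan frames writes each unit of \<open>J\<close>, up to factors from \<open>G\<^sub>0\<close>, as a
combination of one fixed frame with coefficients 1 and -1. These finitely many elements normalize
\<open>G\<^sub>0\<close>, so \<open>G\<close> is a finite union of translates of \<open>G\<^sub>0\<close> (\<open>G_eq\<close>); it is closed, and its
stabilizer of 1 is a finite union of translates of the compact orthogonal group. An element of the
open cone with bounded powers has all eigenvalues equal to 1, and this gives the maximality of the stabilizer.

The only Lie theory that is used is that a relatively closed subset of \<open>G\<^sub>0\<close> which contains
\<open>exp B\<close> and is closed under products is all of \<open>G\<^sub>0\<close> (\<open>connected_subgroup_eqI\<close>).

For the half-space, the products in the definition of the symplectic group are the matrices of
a big cell, recognizable by their first column and row (\<open>big_cell_criterion\<close>). After an arbitrarily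
small perturbation of the factors, a product of two of them is again in the cell, so that the closure
is a group; in it, the cell consists of all matrices with invertible upper left entry and is thus a
neighbourhood of 1, so that every element is a product of two elements of the cell. It therefore
suffices to see that translations, the diagonal factors and the lower triangular factors preserve the
half-space; for the last ones the reason is that \<open>z \<mapsto> - inverse z\<close> does. The lower triangular
factors alone already act transitively and give the section. The stabilizer of the base point consists
of the unitary matrices with rows \<open>(a, b)\<close> and \<open>(- b, a)\<close>; inside the cell these are bounded by a
direct computation with the spectral theorem, and they are dense in the stabilizer because the section
moves nearby elements of the cell into the stabilizer without leaving the cell.\<close>

section \<open>Finite-dimensional normed algebras and the trace\<close>

text \<open>By induction on \<open>S\<close>: a further vector \<open>s\<close> replaces the set by the image of a compact interval times
the previous set under \<open>(t, v) \<mapsto> t s + v\<close>. This is the source of all compactness in an ambient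
space whose dimension is not encoded in a type.\<close>

lemma compact_box_combination:
  fixes S :: "'a::real_normed_vector set"
  assumes "finite S"
  shows "compact ((\<lambda>u. \<Sum>b\<in>S. u b *\<^sub>R b) ` {u. \<forall>b\<in>S. u b \<in> {l b..h b :: real}})"
  using assms
proof (induction S rule: finite_induct)
  case empty
  then show ?case by (simp add: image_constant_conv)
next
  case (insert s S)
  let ?K = "(\<lambda>u. \<Sum>b\<in>S. u b *\<^sub>R b) ` {u. \<forall>b\<in>S. u b \<in> {l b..h b}}"
  have "(\<lambda>u. \<Sum>b\<in>insert s S. u b *\<^sub>R b) ` {u. \<forall>b\<in>insert s S. u b \<in> {l b..h b}}
      = (\<lambda>(t, v). t *\<^sub>R s + v) ` ({l s..h s} \<times> ?K)" (is "?L = ?R")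
  proof
    show "?L \<subseteq> ?R"
    proof
      fix x assume "x \<in> ?L"
      then obtain u where u: "\<forall>b\<in>insert s S. u b \<in> {l b..h b}"
        and x: "x = (\<Sum>b\<in>insert s S. u b *\<^sub>R b)" by auto
      have "x = (\<lambda>(t, v). t *\<^sub>R s + v) (u s, \<Sum>b\<in>S. u b *\<^sub>R b)"
        using x insert by simp
      then show "x \<in> ?R" using u by blast
    qed
    show "?R \<subseteq> ?L"
    proof
      fix x assume "x \<in> ?R"
      then obtain t u where t: "t \<in> {l s..h s}" and u: "\<forall>b\<in>S. u b \<in> {l b..h b}"
        and x: "x = t *\<^sub>R s + (\<Sum>b\<in>S. u b *\<^sub>R b)" by auto
      have "(\<Sum>b\<in>S. (u(s := t)) b *\<^sub>R b) = (\<Sum>b\<in>S. u b *\<^sub>R b)"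
        using insert by (intro sum.cong) auto
      then have "x = (\<Sum>b\<in>insert s S. (u(s := t)) b *\<^sub>R b)"
        using x insert by simp
      moreover have "\<forall>b\<in>insert s S. (u(s := t)) b \<in> {l b..h b}" using t u by auto
      ultimately show "x \<in> ?L" by blast
    qed
  qed
  moreover have "compact ?R"
    by (intro compact_continuous_image compact_Times insert.IH compact_Icc)
       (auto simp: case_prod_beta' intro!: continuous_intros)
  ultimately show ?case by simp
qed

locale finite_dim =
  fixes E :: "'a::real_normed_vector set"
  assumes fin: "finite E" and indep: "independent E" and spans: "span E = UNIV"
begin

lemma finite_dimensional: "finite_dimensional_vector_space ((*\<^sub>R) :: real \<Rightarrow> 'a \<Rightarrow> 'a) E"
  using fin indep spans unfolding dependent_raw_def span_raw_def
  by unfold_locales (rule scaleR_add_right scaleR_add_left scaleR_scaleR scaleR_one | assumption)+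

lemma finite_if_independent: "independent (C :: 'a set) \<Longrightarrow> finite C"
  unfolding dependent_raw_def
  by (rule finite_dimensional_vector_space.finiteI_independent[OF finite_dimensional])

lemma dim_less_if_psubset:
  fixes V W :: "'a set"
  assumes "subspace V" "subspace W" "V \<subset> W"
  shows "dim V < dim W"
  using finite_dimensional_vector_space.dim_psubset[OF finite_dimensional, of V W]
    assms(3) span_eq_iff[THEN iffD2, OF assms(1)] span_eq_iff[THEN iffD2, OF assms(2)]
  unfolding span_raw_def[symmetric] dim_raw_def[symmetric] by (simp only:)

abbreviation coord :: "'a \<Rightarrow> 'a \<Rightarrow> real" where "coord \<equiv> representation E"

lemma coord_sum: "(\<Sum>b\<in>E. coord x b *\<^sub>R b) = x"
  by (rule sum_representation_eq) (use fin indep spans in auto)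

lemma coord_add: "coord (x + y) b = coord x b + coord y b"
  and coord_scale: "coord (r *\<^sub>R x) b = r * coord x b"
  by (auto simp: real_vector.representation_add real_vector.representation_scale indep spans)

text \<open>The vectors whose largest coordinate is 1 in absolute value form a finite union of compact boxes. By
independence it omits 0, so it has a positive distance \<open>d\<close> from 0, and homogeneity gives the bound
\<open>1/d\<close>.\<close>

lemma coord_bounded: "\<exists>C>0. \<forall>x::'a. \<forall>b\<in>E. \<bar>coord x b\<bar> \<le> C * norm x"
proof -
  \<comment> \<open>the face of the unit box on which coordinate \<open>c\<close> equals \<open>s\<close>\<close>
  define Box where "Box c s = (\<lambda>u. \<Sum>b\<in>E. u b *\<^sub>R b) ` {u. \<forall>b\<in>E. u b \<in>
     {(if b = c then s else -1)..(if b = c then s else 1 :: real)}}" for c s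
  define Sph where "Sph = (\<Union>c\<in>E. \<Union>s\<in>{1,-1}. Box c s)"
  have "compact Sph"
    unfolding Sph_def Box_def by (intro compact_UN compact_box_combination fin) auto
  moreover have "0 \<notin> Sph"
  proof
    assume "0 \<in> Sph"
    then obtain c s u where c: "c \<in> E" "s \<in> {1,-1::real}"
      and u: "\<forall>b\<in>E. u b \<in> {(if b = c then s else -1)..(if b = c then s else 1)}"
      and z: "0 = (\<Sum>b\<in>E. u b *\<^sub>R b)"
      unfolding Sph_def Box_def by (elim UN_E imageE) blast
    have "u c = 0" using independentD[OF indep fin order_refl z[symmetric] c(1)] .
    moreover have "u c = s" using u c(1) by auto
    ultimately show False using c(2) by auto
  qed
  ultimately obtain d where d0: "d > 0" "ball 0 d \<subseteq> - Sph"
    by (metis ComplI compact_imp_closed open_Compl openE)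
  then have d: "d > 0" "\<forall>y\<in>Sph. d \<le> dist 0 y"
    by (auto simp: subset_iff not_less[symmetric])
  have "\<bar>coord x b\<bar> \<le> (1/d) * norm x" if "b \<in> E" for x b
  proof (cases "\<forall>b\<in>E. coord x b = 0")
    case True
    then show ?thesis using d that by simp
  next
    case False
    define m where "m = Max ((\<lambda>b. \<bar>coord x b\<bar>) ` E)"
    have le: "\<bar>coord x b\<bar> \<le> m" if "b \<in> E" for b
      unfolding m_def using fin that by auto
    have "m > 0" using False le by (metis abs_le_zero_iff not_less order_trans)
    have "m \<in> (\<lambda>b. \<bar>coord x b\<bar>) ` E"
      unfolding m_def using fin that by (intro Max_in) auto
    then obtain c where c: "c \<in> E" "\<bar>coord x c\<bar> = m" by auto
    define s where "s = sgn (coord x c)"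
    have s: "s \<in> {1,-1}" "coord x c / m = s"
      using c(2) \<open>m > 0\<close> by (auto simp: s_def sgn_if abs_if split: if_splits)
    have "(\<Sum>b\<in>E. (coord x b / m) *\<^sub>R b) = (1/m) *\<^sub>R (\<Sum>b\<in>E. coord x b *\<^sub>R b)"
      by (simp add: scaleR_sum_right)
    then have "(1/m) *\<^sub>R x = (\<Sum>b\<in>E. (coord x b / m) *\<^sub>R b)"
      by (simp add: coord_sum)
    moreover have "\<forall>b\<in>E. coord x b / m \<in> {(if b = c then s else -1)..(if b = c then s else 1)}"
    proof
      fix b assume "b \<in> E"
      then have "\<bar>coord x b / m\<bar> \<le> 1" using le[of b] \<open>m > 0\<close> by (simp add: field_simps)
      then have "-1 \<le> coord x b / m" "coord x b / m \<le> 1" by linarith+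
      then show "coord x b / m \<in> {(if b = c then s else -1)..(if b = c then s else 1)}"
        using s(2) by auto
    qed
    ultimately have "(1/m) *\<^sub>R x \<in> Box c s" unfolding Box_def by auto
    then have "(1/m) *\<^sub>R x \<in> Sph" using c(1) s(1) unfolding Sph_def by blast
    then have "d \<le> norm ((1/m) *\<^sub>R x)" using d(2) by (metis dist_0_norm)
    then have "d * m \<le> norm x" using \<open>m > 0\<close> by (simp add: field_simps)
    then have "d * \<bar>coord x b\<bar> \<le> norm x"
      using mult_left_mono[OF le[OF that], of d] d(1) by linarith
    then show ?thesis using d(1) by (simp add: field_simps)
  qed
  then show ?thesis using d(1) by (intro exI[of _ "1/d"]) auto
qed

lemma linear_imp_bounded:
  fixes f :: "'a \<Rightarrow> 'b::real_normed_vector"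
  assumes "linear f"
  shows "bounded_linear f"
proof -
  obtain C where C: "C > 0" "\<And>x b. b \<in> E \<Longrightarrow> \<bar>coord x b\<bar> \<le> C * norm x"
    using coord_bounded by blast
  have "norm (f x) \<le> norm x * (C * (\<Sum>b\<in>E. norm (f b)))" for x
  proof -
    have "f x = (\<Sum>b\<in>E. coord x b *\<^sub>R f b)"
      by (subst coord_sum[of x, symmetric]) (simp add: linear_sum[OF assms] linear_scale[OF assms])
    then have "norm (f x) \<le> (\<Sum>b\<in>E. \<bar>coord x b\<bar> * norm (f b))"
      by (simp add: sum_norm_le)
    also have "\<dots> \<le> (\<Sum>b\<in>E. (C * norm x) * norm (f b))"
      using C by (intro sum_mono mult_right_mono) auto
    finally show ?thesis by (simp add: sum_distrib_left mult_ac)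
  qed
  then show ?thesis
    using assms by (intro bounded_linear_intro) (auto simp: linear_add linear_scale)
qed

text \<open>A subspace is the set of fixed points of a linear projection onto it, and linear maps are continuous.\<close>

lemma closed_subspaces:
  fixes V :: "'a set"
  assumes V: "subspace V"
  shows "closed V"
proof -
  obtain g where g: "range g \<subseteq> V" "linear g" "\<forall>v\<in>V. g v = v"
    using real_vector.linear_exists_left_inverse_on[OF linear_ident V inj_on_id2] by auto
  have "v \<in> V" if "g v = v" for v using g(1) that by (metis rangeI subsetD)
  then have "V = {v. g v = v}" using g(3) by auto
  moreover have "continuous_on UNIV g"
    using linear_imp_bounded[OF g(2)] linear_continuous_on by blast
  ultimately show "closed V"
    using closed_Collect_eq[of g "\<lambda>x. x"] by (simp add: continuous_on_id)
qed

lemma closed_bounded_imp_compact: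
  fixes S :: "'a set"
  assumes "closed S" "bounded S"
  shows "compact S"
proof -
  obtain C where C: "C > 0" "\<And>x b. b \<in> E \<Longrightarrow> \<bar>coord x b\<bar> \<le> C * norm x"
    using coord_bounded by blast
  obtain r where r: "\<And>x. x \<in> S \<Longrightarrow> norm x \<le> r" using assms(2) by (auto simp: bounded_iff)
  let ?K = "(\<lambda>u. \<Sum>b\<in>E. u b *\<^sub>R b) ` {u. \<forall>b\<in>E. u b \<in> {-(C*r)..C*r}}"
  have "S \<subseteq> ?K"
  proof
    fix x assume "x \<in> S"
    have "\<bar>coord x b\<bar> \<le> C * r" if "b \<in> E" for b
      using C(2)[OF that, of x] r[OF \<open>x \<in> S\<close>] C(1) by (meson mult_left_mono order_trans less_imp_le)
    then have "\<forall>b\<in>E. coord x b \<in> {-(C*r)..C*r}" by (auto simp: abs_le_iff minus_le_iff)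
    then show "x \<in> ?K" by (intro image_eqI[of _ _ "coord x"]) (auto simp: coord_sum)
  qed
  moreover have "compact ?K" by (rule compact_box_combination[OF fin])
  ultimately have "compact (?K \<inter> S)" "?K \<inter> S = S"
    using assms(1) by (blast intro: compact_Int_closed)+
  then show ?thesis by (simp only:)
qed

end

text \<open>Both sides expand to the same double sum of coordinates. Allowing two different spans gives more than
the cyclicity of the trace: with \<open>g\<close> the inclusion of a subspace and \<open>f\<close> a projection onto it, the
trace of the projection is the dimension of the subspace.\<close>

lemma trace_swap:
  fixes f :: "'a::real_vector \<Rightarrow> 'b::real_vector"
  assumes "finite B" "independent B" "finite C" "independent C"
    and "linear f" "linear g" and fm: "\<And>x. x \<in> span B \<Longrightarrow> f x \<in> span C"
    and gm: "\<And>y. y \<in> span C \<Longrightarrow> g y \<in> span B"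
  shows "(\<Sum>b\<in>B. representation B (g (f b)) b) = (\<Sum>c\<in>C. representation C (f (g c)) c)"
proof -
  have 1: "representation B (g (f b)) b =
      (\<Sum>c\<in>C. representation C (f b) c * representation B (g c) b)" if "b \<in> B" for b
  proof -
    have "f b = (\<Sum>c\<in>C. representation C (f b) c *\<^sub>R c)"
      by (rule real_vector.sum_representation_eq[OF \<open>independent C\<close>
            fm[OF span_base[OF that]] \<open>finite C\<close> order_refl, symmetric])
    from arg_cong[where f = g, OF this]
    have "g (f b) = (\<Sum>c\<in>C. representation C (f b) c *\<^sub>R g c)"
      by (simp only: linear_sum[OF \<open>linear g\<close>] linear_scale[OF \<open>linear g\<close>])
    moreover have "g c \<in> span B" if "c \<in> C" for c using gm that by (simp add: span_base)
    ultimately show ?thesis using \<open>independent B\<close>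
      by (simp add: real_vector.representation_sum real_vector.representation_scale span_scale)
  qed
  have 2: "representation C (f (g c)) c =
      (\<Sum>b\<in>B. representation B (g c) b * representation C (f b) c)" if "c \<in> C" for c
  proof -
    have "g c = (\<Sum>b\<in>B. representation B (g c) b *\<^sub>R b)"
      by (rule real_vector.sum_representation_eq[OF \<open>independent B\<close>
            gm[OF span_base[OF that]] \<open>finite B\<close> order_refl, symmetric])
    from arg_cong[where f = f, OF this]
    have "f (g c) = (\<Sum>b\<in>B. representation B (g c) b *\<^sub>R f b)"
      by (simp only: linear_sum[OF \<open>linear f\<close>] linear_scale[OF \<open>linear f\<close>])
    moreover have "f b \<in> span C" if "b \<in> B" for b using fm that by (simp add: span_base)
    ultimately show ?thesis using \<open>independent C\<close>
      by (simp add: real_vector.representation_sum real_vector.representation_scale span_scale)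
  qed
  have "(\<Sum>b\<in>B. representation B (g (f b)) b) =
      (\<Sum>b\<in>B. \<Sum>c\<in>C. representation C (f b) c * representation B (g c) b)"
    by (rule sum.cong[OF refl 1])
  also have "\<dots> = (\<Sum>c\<in>C. \<Sum>b\<in>B. representation B (g c) b * representation C (f b) c)"
    by (subst sum.swap) (simp only: mult.commute)
  also have "\<dots> = (\<Sum>c\<in>C. representation C (f (g c)) c)"
    by (rule sum.cong[OF refl 2[symmetric]])
  finally show ?thesis .
qed

locale finite_dim_algebra = finite_dim E
  for E :: "'a::{real_normed_algebra_1,banach} set"
begin

text \<open>The trace of left multiplication by \<open>x\<close>.\<close>

definition tr :: "'a \<Rightarrow> real" where
  "tr x = (\<Sum>b\<in>E. coord (x * b) b)"

lemma linear_tr: "linear tr"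
  by (intro linearI) (auto simp: tr_def distrib_right coord_add coord_scale sum.distrib sum_distrib_left)

lemmas tr_add = linear_add[OF linear_tr]
  and tr_diff = linear_diff[OF linear_tr]
  and tr_0 = linear_0[OF linear_tr]
  and tr_sum = linear_sum[OF linear_tr]

lemma tr_scale: "tr (r *\<^sub>R x) = r * tr x"
  using linear_scale[OF linear_tr, of r x] by simp

lemma continuous_on_tr: "continuous_on S f \<Longrightarrow> continuous_on S (\<lambda>x. tr (f x))"
  using bounded_linear.continuous_on[OF linear_imp_bounded[OF linear_tr]] .

lemma tr_commute: "tr (x * y) = tr (y * x)"
  using trace_swap[OF fin indep fin indep, of "(*) y" "(*) x"]
  by (simp add: tr_def mult.assoc spans linear_times)

text \<open>Left multiplication by \<open>c\<close> is a projection onto \<open>c A\<close>, so its trace is the dimension of \<open>c A\<close>.\<close>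

lemma tr_idempotent_pos:
  assumes "c * c = c" "c \<noteq> 0"
  shows "tr c > 0"
proof -
  let ?V = "range ((*) c)"
  have V: "subspace ?V" by (intro linear_subspace_image linear_times subspace_UNIV)
  obtain C where C: "C \<subseteq> ?V" "independent C" "?V \<subseteq> span C"
    by (rule real_vector.maximal_independent_subset[of ?V])
  have span: "span C = ?V" using C V by (simp add: span_minimal subset_antisym)
  have fC: "finite C" by (rule finite_if_independent[OF C(2)])
  have cv: "c * v = v" if v: "v \<in> ?V" for v
  proof -
    obtain y where "v = c * y" by (rule rangeE[OF v])
    then show ?thesis by (simp only: mult.assoc[symmetric] assms(1))
  qed
  have "tr c = (\<Sum>v\<in>C. representation C (c * v) v)"
    unfolding tr_def
  proof (rule trace_swap[OF fin indep fC C(2) linear_times linear_ident])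
    show "c * x \<in> span C" for x unfolding span by (rule rangeI)
    show "y \<in> span E" for y using spans by (simp only: UNIV_I)
  qed
  also have "\<dots> = (\<Sum>v\<in>C. 1)"
  proof (rule sum.cong[OF refl])
    fix v assume v: "v \<in> C"
    then have "c * v = v" using cv C(1) by blast
    then show "representation C (c * v) v = 1"
      by (simp only: real_vector.representation_basis[OF C(2) v] simp_thms if_True)
  qed
  also have "\<dots> = card C" by simp
  finally have "tr c = card C" .
  moreover have "C \<noteq> {}"
  proof
    assume "C = {}"
    then have "c * 1 \<in> span {}" using span by (metis rangeI)
    then show False using assms(2) by simp
  qed
  ultimately show ?thesis using fC by (simp add: card_gt_0_iff)
qed

end

section \<open>Formally real Jordan algebras of associative type\<close>

text \<open>Evaluation in an algebra that need not be commutative. Applied to the complex numbers it is also the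
evaluation of a real polynomial at a complex point, so one set of rules serves both purposes.\<close>

definition peval :: "real poly \<Rightarrow> 'a::real_algebra_1 \<Rightarrow> 'a" where
  "peval p x = fold_coeffs (\<lambda>a y. a *\<^sub>R 1 + x * y) p 0"

lemma peval_0 [simp]: "peval 0 x = 0"
  by (simp add: peval_def)

lemma peval_pCons [simp]: "peval (pCons a p) x = a *\<^sub>R 1 + x * peval p x"
  by (cases "p = 0 \<and> a = 0") (auto simp: peval_def)

lemma peval_add: "peval (p + q) x = peval p x + peval q x"
proof (induction p arbitrary: q)
  case 0
  then show ?case by simp
next
  case (pCons a p)
  then show ?case by (cases q) (simp add: algebra_simps)
qed

lemma peval_smult: "peval (smult a p) x = a *\<^sub>R peval p x"
  by (induction p) (auto simp: algebra_simps)

lemma peval_commute: "x * peval p x = peval p x * x"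
proof (induction p)
  case (pCons a p)
  have "x * peval (pCons a p) x = a *\<^sub>R x + x * (x * peval p x)" by (simp add: algebra_simps)
  also have "\<dots> = a *\<^sub>R x + x * (peval p x * x)" by (simp only: pCons.IH)
  finally show ?case by (simp add: algebra_simps)
qed simp

lemma peval_mult: "peval (p * q) x = peval p x * peval q x"
  by (induction p) (auto simp: peval_add peval_smult algebra_simps)

lemma peval_monom: "peval (monom a n) x = a *\<^sub>R x ^ n"
  by (induction n) (auto simp: monom_0 monom_Suc)

lemma peval_sum: "peval (\<Sum>i\<in>I. f i) x = (\<Sum>i\<in>I. peval (f i) x)"
  by (induction I rule: infinite_finite_induct) (auto simp: peval_add)

lemma poly_map_of_real: "poly (map_poly of_real p) z = peval p (z :: complex)"
  by (induction p) (auto simp: map_poly_pCons scaleR_conv_of_real)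

lemma peval_of_real: "peval p (of_real a :: complex) = of_real (poly p a)"
  by (induction p) (auto simp: scaleR_conv_of_real)

lemma (in finite_dim_algebra) annihilating_poly: "\<exists>p. p \<noteq> 0 \<and> peval p (x::'a) = 0"
proof (cases "inj_on (\<lambda>i. x ^ i) {..card E}")
  case False
  then obtain i j where ij: "i \<noteq> j" "x ^ i = x ^ j" by (auto simp: inj_on_def)
  let ?p = "monom 1 i + smult (-1) (monom 1 j) :: real poly"
  have "coeff ?p i = 1" using ij(1) by simp
  then have "?p \<noteq> 0" by (metis coeff_0 zero_neq_one)
  moreover have "peval ?p x = 0"
    unfolding peval_add peval_smult peval_monom using ij(2) by simp
  ultimately show ?thesis by blast
next
  case True
  let ?S = "(\<lambda>i. x ^ i) ` {..card E}"
  have "card ?S = Suc (card E)" using card_image[OF True] by simp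
  have "dependent ?S"
  proof (rule ccontr)
    assume "\<not> dependent ?S"
    then have "card ?S \<le> card E"
      using real_vector.independent_span_bound[OF fin, of ?S] spans by simp
    then show False using \<open>card ?S = Suc (card E)\<close> by simp
  qed
  then obtain u v where u: "(\<Sum>v\<in>?S. u v *\<^sub>R v) = 0" and v: "v \<in> ?S" "u v \<noteq> 0"
    using dependent_finite[of ?S] by auto
  then obtain k where k: "k \<le> card E" "u (x ^ k) \<noteq> 0" by auto
  let ?p = "\<Sum>i\<le>card E. monom (u (x ^ i)) i"
  have "coeff ?p k = (\<Sum>i\<le>card E. if i = k then u (x ^ i) else 0)"
    by (simp add: coeff_sum)
  also have "\<dots> = u (x ^ k)" using k(1) by simp
  finally have "?p \<noteq> 0" using k(2) by (metis coeff_0)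
  moreover have "peval ?p x = (\<Sum>v\<in>?S. u v *\<^sub>R v)"
    by (simp add: peval_sum peval_monom sum.reindex[OF True])
  ultimately show ?thesis using u by metis
qed

text \<open>Closure under squares amounts to closure under the Jordan product. The condition on two squares is the
formal reality needed to exclude non-real eigenvalues; with \<open>y = 0\<close> it excludes nilpotents.\<close>

locale formally_real_jordan = finite_dim_algebra E
  for E :: "'a::{real_normed_algebra_1,banach} set" +
  fixes J :: "'a set"
  assumes subspace_J: "subspace J" and one_J: "1 \<in> J"
    and square_J: "x \<in> J \<Longrightarrow> x * x \<in> J"
    and formally_real: "x \<in> J \<Longrightarrow> y \<in> J \<Longrightarrow> x * x + y * y = 0 \<Longrightarrow> x = 0"
begin

lemmas add_J = subspace_add[OF subspace_J] and scale_J = subspace_scale[OF subspace_J]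
  and diff_J = subspace_diff[OF subspace_J] and sum_J = subspace_sum[OF subspace_J]
  and zero_J = subspace_0[OF subspace_J] and neg_J = subspace_neg[OF subspace_J]

lemma closed_J: "closed J"
  by (rule closed_subspaces[OF subspace_J])

lemma jordan_J: "x \<in> J \<Longrightarrow> y \<in> J \<Longrightarrow> x * y + y * x \<in> J"
proof -
  assume xy: "x \<in> J" "y \<in> J"
  have "x * y + y * x = (x + y) * (x + y) - x * x - y * y" by (simp add: algebra_simps)
  then show ?thesis using xy by (simp add: add_J diff_J square_J)
qed

lemma half_J: "x + x \<in> J \<Longrightarrow> x \<in> J"
  using scale_J[of "x + x" "1/2"] by (simp add: scaleR_2[symmetric])

lemma commuting_mult_J: "x \<in> J \<Longrightarrow> y \<in> J \<Longrightarrow> x * y = y * x \<Longrightarrow> x * y \<in> J"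
  using jordan_J[of x y] by (auto intro: half_J)

lemma quadratic_J: "x \<in> J \<Longrightarrow> y \<in> J \<Longrightarrow> x * y * x \<in> J"
proof (rule half_J)
  assume xy: "x \<in> J" "y \<in> J"
  have "x * y * x + x * y * x =
      (x * (x * y + y * x) + (x * y + y * x) * x) - (x * x * y + y * (x * x))"
    by (simp add: algebra_simps)
  then show "x * y * x + x * y * x \<in> J"
    using xy by (simp only: diff_J jordan_J square_J)
qed

lemma square_eq_0: "x \<in> J \<Longrightarrow> x * x = 0 \<Longrightarrow> x = 0"
  using formally_real[of x 0] zero_J by simp

lemma formally_real': "x \<in> J \<Longrightarrow> y \<in> J \<Longrightarrow> x * x + y * y = 0 \<Longrightarrow> y = 0"
  using formally_real[of y x] by (simp add: add.commute)

definition idem :: "'a \<Rightarrow> bool" where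
  "idem c \<longleftrightarrow> c \<in> J \<and> c * c = c"

text \<open>Orthogonality of \<open>d\<close> and \<open>e\<close> is stated by means of the associative products; for idempotents this
is the same as the vanishing of the Jordan product.\<close>

definition prim :: "'a \<Rightarrow> bool" where
  "prim c \<longleftrightarrow> idem c \<and> c \<noteq> 0 \<and>
     \<not> (\<exists>d e. idem d \<and> idem e \<and> d \<noteq> 0 \<and> e \<noteq> 0 \<and> d * e = 0 \<and> e * d = 0 \<and> c = d + e)"

text \<open>Let \<open>p\<close> be a nonzero real polynomial of least degree with \<open>p(x) e = 0\<close>. A non-real root would give
a quadratic factor \<open>(t - a)\<^sup>2 + b\<^sup>2\<close> of \<open>p\<close>, and the complementary factor \<open>r\<close> would satisfy
\<open>((x - a) r(x) e)\<^sup>2 + (b r(x) e)\<^sup>2 = 0\<close>, whereas \<open>b r(x) e\<close> is not 0 by minimality; this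
contradicts formal reality. So \<open>p = (t - a) r\<close> with \<open>a\<close>
real, and \<open>w = r(x) e\<close> is a nonzero eigenvector. As \<open>w\<close> is a polynomial in \<open>x\<close>, we have
\<open>w\<^sup>2 = r(a) w\<close>, where \<open>r(a)\<close> is not 0 because there are no nilpotents; hence \<open>w / r(a)\<close> is an
idempotent.\<close>

lemma eigen_idempotent:
  assumes e: "idem e" "e \<noteq> 0" and x: "x \<in> J" "e * x = x" "x * e = x"
  shows "\<exists>c a. idem c \<and> c \<noteq> 0 \<and> e * c = c \<and> c * e = c \<and> x * c = a *\<^sub>R c \<and> c * x = a *\<^sub>R c"
proof -
  define q where "q p = peval p x * e" for p
  have q_Cons: "q (pCons a p) = a *\<^sub>R e + x * q p" for a p
    by (simp add: q_def distrib_right mult.assoc)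
  have q0: "q 0 = 0" by (simp add: q_def)
  have ee: "e * e = e" "e \<in> J" using e(1) by (auto simp: idem_def)
  have qx: "q p * x = x * q p" and eq: "e * q p = q p" and qe: "q p * e = q p" for p
  proof -
    show "q p * e = q p" by (simp add: q_def mult.assoc ee)
    have "q p * x = peval p x * x" using x(2) by (simp add: q_def mult.assoc)
    also have "\<dots> = x * peval p x" by (simp add: peval_commute)
    also have "\<dots> = peval p x * (x * e)" using x(3) by (simp add: peval_commute)
    also have "\<dots> = x * q p" by (simp add: q_def mult.assoc[symmetric] peval_commute)
    finally show "q p * x = x * q p" .
    show "e * q p = q p"
    proof (induction p)
      case (pCons a p)
      have "e * (x * q p) = x * q p" using x(2) by (simp add: mult.assoc[symmetric])
      then show ?case by (simp add: q_Cons distrib_left ee)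
    qed (simp add: q0)
  qed
  have qJ: "q p \<in> J" for p
  proof (induction p)
    case (pCons a p)
    then show ?case
      unfolding q_Cons by (intro add_J scale_J ee(2) commuting_mult_J x(1)) (auto simp: qx)
  qed (simp add: q0 zero_J)
  have q_mult: "q p * q r = q (p * r)" for p r
    using eq[of r] by (simp add: q_def peval_mult mult.assoc)
  have q_add: "q (p + r) = q p + q r" for p r by (simp add: q_def peval_add distrib_right)
  define N where "N = {n. \<exists>p. p \<noteq> 0 \<and> q p = 0 \<and> degree p = n}"
  have "N \<noteq> {}"
    using annihilating_poly[of x] by (force simp: N_def q_def)
  then obtain p where p: "p \<noteq> 0" "q p = 0" and min: "\<And>r. r \<noteq> 0 \<Longrightarrow> q r = 0 \<Longrightarrow> degree p \<le> degree r"
  proof -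
    assume *: "\<And>p. p \<noteq> 0 \<Longrightarrow> q p = 0 \<Longrightarrow> (\<And>r. r \<noteq> 0 \<Longrightarrow> q r = 0 \<Longrightarrow> degree p \<le> degree r) \<Longrightarrow> thesis"
    have "Inf N \<in> N" using \<open>N \<noteq> {}\<close> by (rule Inf_nat_def1)
    then obtain p where "p \<noteq> 0" "q p = 0" "degree p = Inf N" unfolding N_def by blast
    moreover have "Inf N \<le> degree r" if "r \<noteq> 0" "q r = 0" for r
      by (rule wellorder_Inf_le1) (use that in \<open>auto simp: N_def\<close>)
    ultimately show thesis using * by metis
  qed
  have factor: "q r \<noteq> 0" if "p = s * r" "degree s > 0" for r s
  proof
    assume "q r = 0"
    have "s \<noteq> 0" "r \<noteq> 0" using that p(1) by auto
    then have "degree p = degree s + degree r" using that(1) by (simp add: degree_mult_eq)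
    then show False using min[OF \<open>r \<noteq> 0\<close> \<open>q r = 0\<close>] that(2) by simp
  qed
  have "degree p \<noteq> 0"
  proof
    assume "degree p = 0"
    then obtain a where a: "p = [:a:]" by (metis degree_eq_zeroE)
    then have "a *\<^sub>R e = 0" using p(2) by (simp add: q_Cons q0)
    then show False using a p(1) e(2) by simp
  qed
  define P where "P = map_poly complex_of_real p"
  have "degree P = degree p" unfolding P_def by (rule degree_map_poly) simp
  then have "\<not> constant (poly P)" using \<open>degree p \<noteq> 0\<close> by (simp add: constant_degree)
  then obtain z where z: "poly P z = 0" using fundamental_theorem_of_algebra by blast
  have "Im z = 0"
  proof (rule ccontr)
    assume im: "Im z \<noteq> 0"
    define qd where "qd = [:(Re z)\<^sup>2 + (Im z)\<^sup>2, - 2 * Re z, 1:]"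
    define s where "s = p mod qd"
    have "degree qd = 2" by (simp add: qd_def)
    then have qd0: "qd \<noteq> 0" by auto
    then have "degree s < 2 \<or> s = 0"
      using degree_mod_less[of qd p] \<open>degree qd = 2\<close> unfolding s_def by auto
    then have "degree s \<le> 1" by auto
    obtain s0 t where s: "s = pCons s0 t" by (rule pCons_cases)
    have "degree t = 0" using \<open>degree s \<le> 1\<close> s by (auto split: if_splits)
    then obtain s1 where t: "t = [:s1:]" by (rule degree_eq_zeroE)
    have "peval p z = peval (p div qd) z * peval qd z + peval s z"
      unfolding s_def peval_mult[symmetric] peval_add[symmetric] by simp
    then have "0 = peval (p div qd) z * peval qd z + peval s z"
      using z by (simp add: P_def poly_map_of_real)
    moreover have "peval qd z = 0"
      by (simp add: qd_def complex_eq_iff power2_eq_square algebra_simps)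
    ultimately have 0: "of_real s0 + z * of_real s1 = 0"
      by (simp add: s t scaleR_conv_of_real)
    then have "s1 = 0" using im by (simp add: complex_eq_iff)
    then have "s = 0" using 0 s t by (simp add: complex_eq_iff)
    then have p_eq: "p = qd * (p div qd)" unfolding s_def by (simp add: mod_0_imp_dvd)
    define r where "r = p div qd"
    have w: "q r \<noteq> 0" by (rule factor[of qd]) (use p_eq \<open>degree qd = 2\<close> in \<open>auto simp: r_def\<close>)
    let ?y = "q ([:- Re z, 1:] * r)" and ?t = "q ([:Im z:] * r)"
    have "?y * ?y + ?t * ?t = q (p * r)"
    proof -
      have "[:- Re z, 1:] * r * ([:- Re z, 1:] * r) + [:Im z:] * r * ([:Im z:] * r) = qd * r * r"
      proof -
        have "[:- Re z, 1:] * [:- Re z, 1:] + [:Im z:] * [:Im z:] = qd"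
          by (simp add: qd_def power2_eq_square)
        moreover have "A * r * (A * r) + I * r * (I * r) = (A * A + I * I) * r * r" for A I
          by (simp add: algebra_simps)
        ultimately show ?thesis by (simp only:)
      qed
      then show ?thesis
        unfolding q_mult q_add[symmetric] using p_eq by (simp only: r_def[symmetric])
    qed
    also have "\<dots> = 0" using p(2) by (simp add: q_mult[symmetric])
    finally have "?t = 0" by (rule formally_real'[OF qJ qJ])
    then have "Im z *\<^sub>R q r = 0" by (simp add: q_def peval_smult)
    then show False using im w by simp
  qed
  then have "z = of_real (Re z)" by (simp add: complex_eq_iff)
  then have "poly p (Re z) = 0"
    using z unfolding P_def poly_map_of_real by (metis of_real_eq_0_iff peval_of_real)
  then obtain r where r: "p = [:- Re z, 1:] * r" by (metis dvdE poly_eq_0_iff_dvd)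
  define a where "a = Re z"
  define w where "w = q r"
  have w0: "w \<noteq> 0" unfolding w_def by (rule factor[OF r]) simp
  have "q ([:- a, 1:] * r) = 0" using p(2) r by (simp add: a_def)
  then have xw: "x * w = a *\<^sub>R w"
  proof -
    have "q [:- a, 1:] * w = - a *\<^sub>R w + x * w"
      unfolding w_def by (simp add: q_Cons q0 distrib_right left_diff_distrib mult.assoc eq)
    moreover have "q [:- a, 1:] * w = 0"
      unfolding w_def q_mult by fact
    ultimately show ?thesis by simp
  qed
  have qsw: "q s * w = poly s a *\<^sub>R w" for s
  proof (induction s)
    case (pCons b s)
    have "q (pCons b s) * w = b *\<^sub>R w + q s * (x * w)"
      by (simp add: q_Cons distrib_right mult.assoc[symmetric] qx)
         (simp add: w_def eq)
    also have "\<dots> = b *\<^sub>R w + a *\<^sub>R (q s * w)" by (simp add: xw)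
    finally show ?case by (simp add: pCons.IH scaleR_add_left)
  qed (simp add: q0)
  define k where "k = poly r a"
  have ww: "w * w = k *\<^sub>R w" using qsw[of r] by (simp add: w_def k_def)
  have "k \<noteq> 0"
    using square_eq_0[of w] ww w0 qJ[of r] by (auto simp: w_def)
  define c where "c = (1 / k) *\<^sub>R w"
  have "idem c"
    unfolding idem_def c_def using qJ[of r] \<open>k \<noteq> 0\<close> by (auto simp: ww scale_J w_def[symmetric])
  moreover have "c \<noteq> 0" using \<open>k \<noteq> 0\<close> w0 by (simp add: c_def)
  moreover have "e * c = c" "c * e = c" by (auto simp: c_def w_def eq qe)
  moreover have "x * c = a *\<^sub>R c" by (simp add: c_def xw)
  moreover have "c * x = x * c" by (simp add: c_def w_def qx)
  ultimately show ?thesis by metis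
qed

definition frame_of :: "'a \<Rightarrow> 'a set \<Rightarrow> bool" where
  "frame_of e C \<longleftrightarrow> finite C \<and> (\<forall>c\<in>C. prim c) \<and>
     (\<forall>c\<in>C. \<forall>d\<in>C. c \<noteq> d \<longrightarrow> c * d = 0) \<and> (\<Sum>c\<in>C. c) = e"

text \<open>The functional calculus: for a frame \<open>C\<close> this is the element with eigenvalue \<open>l c\<close> on each
\<open>c \<in> C\<close>, and algebraic operations on such elements are pointwise operations on \<open>l\<close>.\<close>

definition fc :: "'a set \<Rightarrow> ('a \<Rightarrow> real) \<Rightarrow> 'a" where
  "fc C l = (\<Sum>c\<in>C. l c *\<^sub>R c)"

lemma frame_ofD:
  assumes "frame_of e C"
  shows "finite C" "c \<in> C \<Longrightarrow> prim c" "c \<in> C \<Longrightarrow> c \<in> J" "c \<in> C \<Longrightarrow> c * c = c" "c \<in> C \<Longrightarrow> c \<noteq> 0"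
    "c \<in> C \<Longrightarrow> d \<in> C \<Longrightarrow> c \<noteq> d \<Longrightarrow> c * d = 0" "(\<Sum>c\<in>C. c) = e"
  using assms by (auto simp: frame_of_def prim_def idem_def)

lemma fc_mult_elem:
  assumes "frame_of e C" "d \<in> C"
  shows "fc C l * d = l d *\<^sub>R d" "d * fc C l = l d *\<^sub>R d"
proof -
  note C = frame_ofD[OF assms(1)]
  have "fc C l * d = (\<Sum>c\<in>C. if c = d then l d *\<^sub>R d else 0)"
    unfolding fc_def sum_distrib_right by (rule sum.cong) (use C assms(2) in auto)
  then show "fc C l * d = l d *\<^sub>R d" using C(1) assms(2) by simp
  have "d * fc C l = (\<Sum>c\<in>C. if c = d then l d *\<^sub>R d else 0)"
    unfolding fc_def sum_distrib_left by (rule sum.cong) (use C assms(2) in auto)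
  then show "d * fc C l = l d *\<^sub>R d" using C(1) assms(2) by simp
qed

lemma fc_mult:
  assumes "frame_of e C"
  shows "fc C l * fc C m = fc C (\<lambda>c. l c * m c)"
proof -
  have "fc C l * fc C m = (\<Sum>c\<in>C. fc C l * (m c *\<^sub>R c))"
    by (simp add: fc_def[of C m] sum_distrib_left)
  also have "\<dots> = fc C (\<lambda>c. l c * m c)"
    unfolding fc_def[of C "\<lambda>c. l c * m c"]
    by (rule sum.cong) (simp_all add: fc_mult_elem[OF assms] mult.commute)
  finally show ?thesis .
qed

lemma fc_add: "fc C l + fc C m = fc C (\<lambda>c. l c + m c)"
  and fc_diff: "fc C l - fc C m = fc C (\<lambda>c. l c - m c)"
  by (simp_all add: fc_def sum.distrib sum_subtractf scaleR_add_left scaleR_diff_left)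

lemma fc_const: "frame_of e C \<Longrightarrow> fc C (\<lambda>c. a) = a *\<^sub>R e"
  by (simp add: fc_def frame_of_def scaleR_sum_right[symmetric])

lemma fc_J: "frame_of e C \<Longrightarrow> fc C l \<in> J"
  unfolding fc_def by (intro sum_J scale_J) (auto dest: frame_ofD)

lemma fc_cong: "(\<And>c. c \<in> C \<Longrightarrow> l c = m c) \<Longrightarrow> fc C l = fc C m"
  by (simp add: fc_def)

lemma tr_fc: "tr (fc C l) = (\<Sum>c\<in>C. l c * tr c)"
  by (simp add: fc_def tr_sum tr_scale)

lemma frame_tr_pos: "frame_of e C \<Longrightarrow> c \<in> C \<Longrightarrow> tr c > 0"
  by (intro tr_idempotent_pos) (auto dest: frame_ofD)

lemma frame_absorb:
  assumes "frame_of e C" "c \<in> C"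
  shows "e * c = c" "c * e = c"
  using fc_mult_elem[OF assms, of "\<lambda>_. 1"] fc_const[OF assms(1), of 1] by simp_all

lemma frame_join:
  assumes C: "frame_of d C" and D: "frame_of d' D" and orth: "d * d' = 0" "d' * d = 0"
  shows "frame_of (d + d') (C \<union> D)"
    and "\<exists>n. fc C l + fc D m = fc (C \<union> D) n"
proof -
  have CD: "c * c' = 0" "c' * c = 0" if "c \<in> C" "c' \<in> D" for c c'
  proof -
    have "c * c' = (c * d) * (d' * c')" "c' * c = (c' * d') * (d * c)"
      using frame_absorb[OF C that(1)] frame_absorb[OF D that(2)] by simp_all
    moreover have "(c * d) * (d' * c') = c * (d * d') * c'" "(c' * d') * (d * c) = c' * (d' * d) * c"
      by (simp_all add: mult.assoc)
    ultimately show "c * c' = 0" "c' * c = 0" using orth by simp_all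
  qed
  have disj: "C \<inter> D = {}"
    using CD(1) frame_ofD(4,5)[OF C] by (metis disjoint_iff)
  show "frame_of (d + d') (C \<union> D)"
    unfolding frame_of_def
    using C D CD disj by (auto simp: frame_of_def sum.union_disjoint)
  let ?n = "\<lambda>c. if c \<in> C then l c else m c"
  have "fc (C \<union> D) ?n = fc C ?n + fc D ?n"
    unfolding fc_def using frame_ofD(1)[OF C] frame_ofD(1)[OF D] disj by (rule sum.union_disjoint)
  also have "fc C ?n = fc C l" by (rule fc_cong) simp
  also have "fc D ?n = fc D m" using disj by (intro fc_cong) auto
  finally show "\<exists>n. fc C l + fc D m = fc (C \<union> D) n" by metis
qed

text \<open>Induction on the dimension of the corner \<open>e J e\<close>. If \<open>x\<close> is not a multiple of \<open>e\<close>, an eigen-idempotent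
\<open>c\<close> splits the unit of the corner as \<open>c + (e - c)\<close>; if \<open>x\<close> is a multiple of \<open>e\<close>, any decomposition
of \<open>e\<close> into orthogonal idempotents will do. Along either splitting \<open>x\<close> decomposes into elements of two
smaller corners. The induction stops at multiples of primitive idempotents only, so that the resulting
idempotents are primitive.\<close>

lemma spectral_theorem_corner:
  assumes "idem e" "x \<in> J" "e * x = x" "x * e = x"
  shows "\<exists>C l. frame_of e C \<and> x = fc C l"
  using assms
proof (induction "dim {y \<in> J. e * y = y \<and> y * e = y}" arbitrary: e x rule: less_induct)
  case less
  note x = less.prems(2-4)
  have e: "e \<in> J" "e * e = e" using less.prems(1) by (auto simp: idem_def)
  show ?case
  proof (cases "e = 0")
    case True
    then have "frame_of e {}" "x = fc {} (\<lambda>_. 0)" using x by (auto simp: frame_of_def fc_def)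
    then show ?thesis by blast
  next
    case False
    from eigen_idempotent[OF less.prems(1) False x] obtain c a where
      c: "idem c" "c \<noteq> 0" "e * c = c" "c * e = c" "x * c = a *\<^sub>R c" "c * x = a *\<^sub>R c" by blast
    \<comment> \<open>one induction step, for any splitting of the unit into idempotents that commute with \<open>x\<close>\<close>
    have split: ?thesis
      if d: "idem d" "idem d'" "d \<noteq> 0" "d' \<noteq> 0" "d * d' = 0" "d' * d = 0" "e = d + d'"
        and xd: "x * d = d * x" for d d'
    proof -
      have dJ: "d \<in> J" "d * d = d" "d' \<in> J" "d' * d' = d'" using d(1,2) by (auto simp: idem_def)
      have xd': "x * d' = d' * x"
      proof -
        have "d * x + d' * x = d * x + x * d'"
          using x(2,3) xd by (simp add: d(7) distrib_left distrib_right)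
        then show ?thesis by simp
      qed
      have sub: "subspace {y \<in> J. f * y = y \<and> y * f = y}" for f
        by (auto simp: subspace_def zero_J add_J scale_J algebra_simps)
      have corner: "\<exists>C l. frame_of f C \<and> x * f = fc C l"
        if f: "idem f" "e * f = f" "f * e = f" "f * g = 0" "g \<noteq> 0" "idem g" "e * g = g" "g * e = g"
          "x * f = f * x" for f g
      proof (rule less.hyps)
        let ?V = "{y \<in> J. f * y = y \<and> y * f = y}" and ?W = "{y \<in> J. e * y = y \<and> y * e = y}"
        have "g \<in> ?W" "g \<notin> ?V" using f by (auto simp: idem_def)
        moreover have "?V \<subseteq> ?W"
        proof clarify
          fix y assume y: "y \<in> J" "f * y = y" "y * f = y"
          have "e * (f * y) = f * y" "(y * f) * e = y * f"
            using f(2,3) by (simp only: mult.assoc[symmetric], simp only: mult.assoc)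
          then show "e * y = y \<and> y * e = y" using y by simp
        qed
        ultimately show "dim ?V < dim ?W" by (intro dim_less_if_psubset sub) blast
        have f': "f \<in> J" "f * f = f" using f(1) by (auto simp: idem_def)
        show "idem f" by fact
        show "x * f \<in> J" by (rule commuting_mult_J[OF x(1) f'(1) f(9)])
        show "f * (x * f) = x * f" by (metis f(9) f'(2) mult.assoc)
        show "x * f * f = x * f" by (simp add: mult.assoc f')
      qed
      have ed: "e * d = d" "d * e = d" "e * d' = d'" "d' * e = d'"
        using d dJ by (auto simp: distrib_left distrib_right)
      obtain C l where C: "frame_of d C" "x * d = fc C l"
        using corner[of d d'] d ed xd by blast
      obtain D m where D: "frame_of d' D" "x * d' = fc D m"
        using corner[of d' d] d ed xd' by blast
      have "x = fc C l + fc D m"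
        using x(3) by (simp add: d(7) distrib_left C(2) D(2))
      moreover obtain n where "fc C l + fc D m = fc (C \<union> D) n"
        using frame_join(2)[OF C(1) D(1) d(5,6)] by blast
      ultimately show ?thesis
        using frame_join(1)[OF C(1) D(1) d(5,6)] d(7) by auto
    qed
    show ?thesis
    proof (cases "c = e")
      case False
      have "idem (e - c)"
        using c e by (auto simp: idem_def diff_J algebra_simps)
      then show ?thesis
        using c False by (intro split[of c "e - c"]) (auto simp: idem_def algebra_simps)
    next
      case True
      then have xa: "x = a *\<^sub>R e" using c(5) x by simp
      show ?thesis
      proof (cases "prim e")
        case True
        then have "frame_of e {e}" "x = fc {e} (\<lambda>_. a)" using xa by (auto simp: frame_of_def fc_def)
        then show ?thesis by blast
      next
        case False
        then obtain d d' where "idem d" "idem d'" "d \<noteq> 0" "d' \<noteq> 0" "d * d' = 0" "d' * d = 0" "e = d + d'"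
          unfolding prim_def using less.prems(1) \<open>e \<noteq> 0\<close> by blast
        then show ?thesis
          by (intro split[of d d']) (auto simp: xa distrib_left distrib_right idem_def)
      qed
    qed
  qed
qed

abbreviation frame :: "'a set \<Rightarrow> bool" where "frame \<equiv> frame_of 1"

theorem spectral_theorem:
  assumes "x \<in> J"
  obtains C l where "frame C" "x = fc C l"
  using spectral_theorem_corner[of 1 x] assms one_J by (auto simp: idem_def)

lemma fc_one: "frame C \<Longrightarrow> fc C (\<lambda>_. 1) = 1"
  by (simp add: fc_const)

lemma fc_power: "frame C \<Longrightarrow> fc C l ^ n = fc C (\<lambda>c. l c ^ n)"
  by (induction n) (auto simp: fc_one fc_mult mult.commute)

lemma exp_fc:
  assumes C: "frame C"
  shows "exp (fc C l) = fc C (\<lambda>c. exp (l c))"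
proof -
  have "(\<lambda>n. \<Sum>c\<in>C. (l c ^ n /\<^sub>R fact n) *\<^sub>R c) sums (\<Sum>c\<in>C. exp (l c) *\<^sub>R c)"
    by (intro sums_sum sums_scaleR_left exp_converges)
  moreover have "(\<Sum>c\<in>C. (l c ^ n /\<^sub>R fact n) *\<^sub>R c) = fc C l ^ n /\<^sub>R fact n" for n
    by (simp only: fc_power[OF C]) (simp add: fc_def scaleR_sum_right)
  ultimately have "(\<lambda>n. fc C l ^ n /\<^sub>R fact n) sums (\<Sum>c\<in>C. exp (l c) *\<^sub>R c)" by simp
  then show ?thesis using exp_converges sums_unique2 by (auto simp: fc_def)
qed

text \<open>The norm is submultiplicative and \<open>c\<close> is an eigenvector.\<close>

lemma spectral_value_le_norm:
  assumes "frame C" "c \<in> C"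
  shows "\<bar>l c\<bar> \<le> norm (fc C l)"
proof -
  have "\<bar>l c\<bar> * norm c = norm (fc C l * c)" by (simp add: fc_mult_elem[OF assms])
  also have "\<dots> \<le> norm (fc C l) * norm c" by (rule norm_mult_ineq)
  finally show ?thesis using frame_ofD(5)[OF assms] by simp
qed

section \<open>The cone of squares\<close>

lemma tr_square_pos:
  assumes "x \<in> J" "x \<noteq> 0"
  shows "tr (x * x) > 0"
proof -
  obtain C l where C: "frame C" "x = fc C l" by (rule spectral_theorem[OF assms(1)])
  have "tr (x * x) = (\<Sum>c\<in>C. (l c)\<^sup>2 * tr c)"
    by (simp add: C(2) fc_mult[OF C(1)] tr_fc power2_eq_square)
  moreover have "\<exists>c\<in>C. l c \<noteq> 0"
  proof (rule ccontr)
    assume "\<not> ?thesis"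
    then have "fc C l = 0" unfolding fc_def by (intro sum.neutral) auto
    then show False using assms(2) C(2) by simp
  qed
  ultimately show ?thesis
    using frame_ofD(1)[OF C(1)] frame_tr_pos[OF C(1)]
    by (auto intro!: sum_pos2 simp: less_imp_le)
qed

lemma tr_square_nonneg: "x \<in> J \<Longrightarrow> tr (x * x) \<ge> 0"
  using tr_square_pos[of x] tr_0 by (cases "x = 0") auto

text \<open>Let \<open>d = 1 - c\<close>. In the Peirce decomposition of \<open>x\<close> with respect to \<open>c\<close>, the components
\<open>p = c x c\<close> and \<open>a + b = c x d + d x c\<close> lie in \<open>J\<close>, and cyclicity of the trace gives
\<open>tr (x\<^sup>2 c) = tr (p\<^sup>2) + tr ((a + b)\<^sup>2) / 2\<close>.\<close>

lemma tr_square_idem_nonneg: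
  assumes c: "idem c" and x: "x \<in> J"
  shows "tr (x * x * c) \<ge> 0"
proof -
  have cc: "c * c = c" and cJ: "c \<in> J" using c by (auto simp: idem_def)
  define d p a b where "d = 1 - c" and "p = c * x * c" and "a = c * x * d" and "b = d * x * c"
  have dc: "d * c = 0" "c * d = 0" "d * d = d" by (auto simp: d_def algebra_simps cc)
  have "p \<in> J" unfolding p_def by (rule quadratic_J[OF cJ x])
  have "a + b = c * x + x * c - (p + p)"
    by (simp add: a_def b_def p_def d_def algebra_simps)
  then have hJ: "a + b \<in> J" using \<open>p \<in> J\<close> by (simp only: diff_J add_J jordan_J cJ x)
  have "a * a = c * x * (d * c) * x * d" "b * b = d * x * (c * d) * x * c"
    by (simp_all only: a_def b_def mult.assoc)
  then have "(a + b) * (a + b) = a * b + b * a" using dc by (simp add: algebra_simps)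
  then have tr_h: "tr ((a + b) * (a + b)) = 2 * tr (a * b)"
    by (simp add: tr_add tr_commute[of b a])
  have "a * b = c * x * (d * d) * x * c" "p * p = c * x * (c * c) * x * c"
    by (simp_all only: a_def b_def p_def mult.assoc)
  then have "p * p + a * b = c * x * (c + d) * x * c" by (simp add: dc cc algebra_simps)
  then have "p * p + a * b = c * (x * x * c)" by (simp add: d_def mult.assoc)
  then have "tr (p * p) + tr (a * b) = tr (x * x * (c * c))"
    by (metis tr_add tr_commute mult.assoc)
  then have "tr (x * x * c) = tr (p * p) + tr ((a + b) * (a + b)) / 2"
    by (simp add: cc tr_h)
  then show ?thesis using tr_square_nonneg[OF \<open>p \<in> J\<close>] tr_square_nonneg[OF hJ] by simp
qed

end

context formally_real_jordan
begin

text \<open>The dual of the cone of squares with respect to the trace form. Taking the dual cone as the definition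
makes it evident that it is a closed convex cone; the content is in the next lemmas, which show that
it consists of the squares, and equivalently of the elements with nonnegative spectrum.\<close>

definition psd :: "'a set" where
  "psd = {p \<in> J. \<forall>x\<in>J. tr (p * (x * x)) \<ge> 0}"

definition posdef :: "'a set" where
  "posdef = {p \<in> psd. \<exists>y. p * y = 1 \<and> y * p = 1}"

lemma psdD: "p \<in> psd \<Longrightarrow> p \<in> J" "p \<in> psd \<Longrightarrow> x \<in> J \<Longrightarrow> tr (p * (x * x)) \<ge> 0"
  by (auto simp: psd_def)

lemma posdef_J: "p \<in> posdef \<Longrightarrow> p \<in> J" and posdef_psd: "p \<in> posdef \<Longrightarrow> p \<in> psd"
  by (auto simp: posdef_def psd_def)

lemma fc_psd_iff:
  assumes C: "frame C"
  shows "fc C l \<in> psd \<longleftrightarrow> (\<forall>c\<in>C. l c \<ge> 0)"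
proof
  assume p: "fc C l \<in> psd"
  show "\<forall>c\<in>C. l c \<ge> 0"
  proof
    fix c assume c: "c \<in> C"
    have "tr (fc C l * (c * c)) = l c * tr c"
      by (simp add: frame_ofD(4)[OF C c] fc_mult_elem(1)[OF C c] tr_scale)
    then show "l c \<ge> 0"
      using psdD(2)[OF p frame_ofD(3)[OF C c]] frame_tr_pos[OF C c]
      by (simp add: zero_le_mult_iff)
  qed
next
  assume l: "\<forall>c\<in>C. l c \<ge> 0"
  have "tr (fc C l * (x * x)) \<ge> 0" if x: "x \<in> J" for x
  proof -
    have "tr (fc C l * (x * x)) = (\<Sum>c\<in>C. l c * tr (x * x * c))"
      by (simp add: fc_def sum_distrib_right tr_sum tr_scale tr_commute[of _ "x * x"])
    also have "\<dots> \<ge> 0"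
      by (intro sum_nonneg mult_nonneg_nonneg tr_square_idem_nonneg[OF _ x])
         (use l frame_ofD(2)[OF C] in \<open>auto simp: prim_def\<close>)
    finally show ?thesis .
  qed
  then show "fc C l \<in> psd" using fc_J[OF C] by (simp add: psd_def)
qed

lemma psd_eq_squares: "psd = {x * x | x. x \<in> J}"
proof (intro equalityI subsetI)
  fix p assume p: "p \<in> psd"
  obtain C l where C: "frame C" "p = fc C l" using spectral_theorem[OF psdD(1)[OF p]] .
  have "\<forall>c\<in>C. l c \<ge> 0" using p C fc_psd_iff by simp
  then have "p = fc C (\<lambda>c. sqrt (l c)) * fc C (\<lambda>c. sqrt (l c))"
    unfolding C(2) fc_mult[OF C(1)] by (intro fc_cong) simp
  then show "p \<in> {x * x | x. x \<in> J}" using fc_J[OF C(1)] by blast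
next
  fix p assume "p \<in> {x * x | x. x \<in> J}"
  then obtain x where x: "x \<in> J" "p = x * x" by blast
  obtain C l where C: "frame C" "x = fc C l" using spectral_theorem[OF x(1)] .
  show "p \<in> psd" unfolding x(2) C(2) fc_mult[OF C(1)] fc_psd_iff[OF C(1)] by simp
qed

lemma closed_psd: "closed psd"
proof -
  have "psd = J \<inter> (\<Inter>x\<in>J. {p. tr (p * (x * x)) \<ge> 0})" by (auto simp: psd_def)
  moreover have "closed {p. tr (p * y) \<ge> 0}" for y :: 'a
    by (intro closed_Collect_le continuous_on_tr continuous_intros)
  ultimately show ?thesis by (auto intro!: closed_Int closed_J closed_INT)
qed

lemma psd_add: "p \<in> psd \<Longrightarrow> q \<in> psd \<Longrightarrow> p + q \<in> psd"
  and psd_scale: "p \<in> psd \<Longrightarrow> r \<ge> 0 \<Longrightarrow> r *\<^sub>R p \<in> psd"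
  by (auto simp: psd_def add_J scale_J distrib_right tr_add tr_scale)

lemma convex_cone_psd: "convex_cone psd"
  using psd_add psd_scale zero_J
  by (auto simp: convex_cone_def convex_def conic_def psd_def tr_0 intro!: exI[of _ 0])

lemma squares_hull: "(\<lambda>C. closed C \<and> convex_cone C) hull {x * x | x. x \<in> J} = psd"
  using closed_psd convex_cone_psd by (auto simp: psd_eq_squares[symmetric] intro!: hull_same)

lemma fc_posdef_iff:
  assumes C: "frame C"
  shows "fc C l \<in> posdef \<longleftrightarrow> (\<forall>c\<in>C. l c > 0)"
proof
  assume p: "fc C l \<in> posdef"
  then obtain y where y: "y * fc C l = 1" by (auto simp: posdef_def)
  show "\<forall>c\<in>C. l c > 0"
  proof
    fix c assume c: "c \<in> C"
    have "c = y * (fc C l * c)" using y by (simp add: mult.assoc[symmetric])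
    then have "l c \<noteq> 0" using frame_ofD(5)[OF C c] by (auto simp: fc_mult_elem(1)[OF C c])
    then show "l c > 0" using p c fc_psd_iff[OF C] posdef_psd by force
  qed
next
  assume l: "\<forall>c\<in>C. l c > 0"
  let ?y = "fc C (\<lambda>c. 1 / l c)"
  have "fc C l * ?y = fc C (\<lambda>_. 1)" "?y * fc C l = fc C (\<lambda>_. 1)"
    unfolding fc_mult[OF C] by (auto intro!: fc_cong dest: l[rule_format])
  then have "fc C l * ?y = 1" "?y * fc C l = 1" by (simp_all add: fc_one[OF C])
  then show "fc C l \<in> posdef"
    using l fc_psd_iff[OF C, of l] by (auto simp: posdef_def less_imp_le)
qed

lemma one_posdef: "1 \<in> posdef"
proof -
  obtain C l where C: "frame C" using spectral_theorem[OF one_J] by metis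
  show ?thesis using fc_posdef_iff[OF C, of "\<lambda>_. 1"] by (simp add: fc_one[OF C])
qed

text \<open>The inverse may be taken in the ambient algebra: it lies in \<open>J\<close> and belongs to the same frame.\<close>

lemma inverse_J:
  assumes "x \<in> J" "x * y = 1" "y * x = 1"
  obtains C l where "frame C" "x = fc C l" "\<And>c. c \<in> C \<Longrightarrow> l c \<noteq> 0" "y = fc C (\<lambda>c. 1 / l c)"
proof -
  obtain C l where C: "frame C" "x = fc C l" using spectral_theorem[OF assms(1)] .
  have l: "l c \<noteq> 0" if c: "c \<in> C" for c
  proof
    assume "l c = 0"
    then have "y * (x * c) = 0" unfolding C(2) fc_mult_elem(1)[OF C(1) c] by simp
    then show False using assms(3) frame_ofD(5)[OF C(1) c] by (simp add: mult.assoc[symmetric])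
  qed
  have "x * fc C (\<lambda>c. 1 / l c) = 1"
    unfolding C(2) fc_mult[OF C(1)] fc_one[OF C(1), symmetric] using l by (intro fc_cong) auto
  then have "y = fc C (\<lambda>c. 1 / l c)" by (metis assms(3) mult.assoc mult_1_left mult_1_right)
  with C l show thesis using that by blast
qed

lemma inverse_in_J: "x \<in> J \<Longrightarrow> x * y = 1 \<Longrightarrow> y * x = 1 \<Longrightarrow> y \<in> J"
  using inverse_J[of x y] fc_J by metis

lemma inverse_posdef:
  assumes "p \<in> posdef" "p * y = 1" "y * p = 1"
  shows "y \<in> posdef"
proof -
  obtain C l where C: "frame C" "p = fc C l" "y = fc C (\<lambda>c. 1 / l c)"
    using inverse_J[OF posdef_J[OF assms(1)] assms(2,3)] by metis
  then show ?thesis using assms(1) by (auto simp: fc_posdef_iff)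
qed

lemma exp_posdef: "x \<in> J \<Longrightarrow> exp x \<in> posdef"
  by (metis spectral_theorem exp_fc fc_posdef_iff exp_gt_zero)

lemma posdef_exp: "p \<in> posdef \<Longrightarrow> \<exists>x\<in>J. p = exp x"
proof -
  assume p: "p \<in> posdef"
  obtain C l where C: "frame C" "p = fc C l" using spectral_theorem[OF posdef_J[OF p]] .
  have "\<forall>c\<in>C. l c > 0" using p fc_posdef_iff[OF C(1)] C(2) by simp
  then have "p = exp (fc C (\<lambda>c. ln (l c)))"
    unfolding exp_fc[OF C(1)] C(2) by (intro fc_cong) simp
  then show ?thesis using fc_J[OF C(1)] by blast
qed

text \<open>The smallest eigenvalue can be taken for \<open>m\<close>. In this form positive definiteness is visibly stable
under small perturbations and under addition of positive semidefinite elements.\<close>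

lemma posdef_iff_bounded_below:
  "p \<in> posdef \<longleftrightarrow> p \<in> J \<and> (\<exists>m>0. p - m *\<^sub>R 1 \<in> psd)"
proof (cases "p \<in> J")
  case True
  then obtain C l where C: "frame C" "p = fc C l" using spectral_theorem by blast
  have "p - m *\<^sub>R 1 \<in> psd \<longleftrightarrow> (\<forall>c\<in>C. m \<le> l c)" for m
    using fc_psd_iff[OF C(1), of "\<lambda>c. l c - m"]
    by (simp add: C(2) fc_diff[symmetric] fc_const[OF C(1)])
  moreover have "(\<forall>c\<in>C. l c > 0) \<longleftrightarrow> (\<exists>m>0. \<forall>c\<in>C. m \<le> l c)"
  proof
    assume l: "\<forall>c\<in>C. l c > 0"
    let ?m = "Min (insert 1 (l ` C))"
    have "?m > 0" "\<forall>c\<in>C. ?m \<le> l c" using l frame_ofD(1)[OF C(1)] by auto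
    then show "\<exists>m>0. \<forall>c\<in>C. m \<le> l c" by blast
  qed force
  ultimately show ?thesis using True fc_posdef_iff[OF C(1)] C(2) by simp
qed (auto dest: posdef_J)

lemma posdefI: "p \<in> J \<Longrightarrow> m > 0 \<Longrightarrow> p - m *\<^sub>R 1 \<in> psd \<Longrightarrow> p \<in> posdef"
  using posdef_iff_bounded_below by blast

lemma posdef_add: "p \<in> posdef \<Longrightarrow> q \<in> psd \<Longrightarrow> p + q \<in> posdef"
proof -
  assume p: "p \<in> posdef" and q: "q \<in> psd"
  then obtain m where m: "m > 0" "p - m *\<^sub>R 1 \<in> psd" by (auto simp: posdef_iff_bounded_below)
  have "p + q - m *\<^sub>R 1 \<in> psd" using psd_add[OF m(2) q] by (simp add: algebra_simps)
  then show ?thesis using m(1) by (intro posdefI[of _ m] add_J posdef_J[OF p] psdD(1)[OF q])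
qed

lemma norm_bound_psd: "d \<in> J \<Longrightarrow> norm d \<le> m \<Longrightarrow> m *\<^sub>R 1 + d \<in> psd"
proof -
  assume d: "d \<in> J" "norm d \<le> m"
  obtain C l where C: "frame C" "d = fc C l" using spectral_theorem[OF d(1)] .
  have "m *\<^sub>R 1 + d = fc C (\<lambda>c. m + l c)"
    by (simp add: C(2) fc_add[symmetric] fc_const[OF C(1)])
  moreover have "m + l c \<ge> 0" if "c \<in> C" for c
    using spectral_value_le_norm[OF C(1) that, of l] d(2)[unfolded C(2)] by linarith
  ultimately show ?thesis by (simp add: fc_psd_iff[OF C(1)])
qed

text \<open>If \<open>p - m\<close> is positive semidefinite and \<open>norm (q - p) < m/2\<close>, then \<open>m/2 + (q - p)\<close> is positive
semidefinite too, and adding the two shows that \<open>m/2\<close> is a lower bound for \<open>q\<close>.\<close>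

lemma posdef_open:
  assumes p: "p \<in> posdef"
  shows "\<exists>r>0. \<forall>q\<in>J. norm (q - p) < r \<longrightarrow> q \<in> posdef"
proof -
  obtain m where m: "m > 0" "p - m *\<^sub>R 1 \<in> psd" using p by (auto simp: posdef_iff_bounded_below)
  have "q \<in> posdef" if q: "q \<in> J" "norm (q - p) < m / 2" for q
  proof -
    have "(m/2) *\<^sub>R 1 + (q - p) \<in> psd"
      using q posdef_J[OF p] by (intro norm_bound_psd diff_J) auto
    moreover have "(p - m *\<^sub>R 1) + ((m/2) *\<^sub>R 1 + (q - p)) = q - (m/2) *\<^sub>R 1"
    proof -
      have "m *\<^sub>R 1 = (m/2) *\<^sub>R 1 + (m/2) *\<^sub>R (1::'a)"
        by (simp flip: scaleR_add_left)
      then show ?thesis by (simp only: algebra_simps)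
    qed
    ultimately have "q - (m/2) *\<^sub>R 1 \<in> psd" using psd_add[OF m(2)] by metis
    then show ?thesis using q(1) m(1) by (intro posdefI[of _ "m/2"]) auto
  qed
  then show ?thesis using m(1) by (intro exI[of _ "m/2"]) auto
qed

section \<open>Norm estimates and the square root\<close>

text \<open>The positive continuous function \<open>x \<mapsto> tr (x\<^sup>2)\<close> attains its minimum on the compact unit sphere of
\<open>J\<close>.\<close>

lemma norm_le_tr: "\<exists>K>0. \<forall>x\<in>J. (norm x)\<^sup>2 \<le> K * tr (x * x)"
proof -
  let ?S = "sphere 0 1 \<inter> J"
  have "compact ?S"
  proof (rule closed_bounded_imp_compact)
    show "closed ?S" by (intro closed_Int closed_J) (simp add: sphere_def closed_Collect_eq continuous_intros)
    show "bounded ?S" unfolding bounded_iff by (intro exI[of _ 1]) auto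
  qed
  moreover have "1 \<in> ?S" using one_J by simp
  then have "?S \<noteq> {}" by blast
  moreover have "continuous_on ?S (\<lambda>x. tr (x * x))"
    by (intro continuous_on_tr continuous_intros)
  ultimately obtain u where u: "u \<in> ?S" "\<And>x. x \<in> ?S \<Longrightarrow> tr (u * u) \<le> tr (x * x)"
    using continuous_attains_inf[of ?S "\<lambda>x. tr (x * x)"] by blast
  have pos: "tr (u * u) > 0" using u(1) by (intro tr_square_pos) auto
  have "(norm x)\<^sup>2 \<le> (1 / tr (u * u)) * tr (x * x)" if x: "x \<in> J" for x
  proof (cases "x = 0")
    case False
    let ?y = "(1 / norm x) *\<^sub>R x"
    have "?y \<in> ?S" using False x by (simp add: scale_J)
    then have "tr (u * u) \<le> tr (?y * ?y)" by (rule u(2))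
    also have "\<dots> = tr (x * x) / (norm x)\<^sup>2" by (simp add: tr_scale power2_eq_square)
    finally show ?thesis using False pos by (simp add: field_simps)
  qed (simp add: tr_0)
  then show ?thesis using pos by (intro exI[of _ "1 / tr (u * u)"]) auto
qed

text \<open>If all eigenvalues are at most 1 in absolute value, then \<open>tr (x\<^sup>2)\<close> is at most \<open>tr 1\<close>.\<close>

lemma bounded_spectrum: "\<exists>R. \<forall>C l. frame C \<longrightarrow> (\<forall>c\<in>C. \<bar>l c\<bar> \<le> 1) \<longrightarrow> norm (fc C l) \<le> R"
proof -
  obtain K where K: "K > 0" "\<And>x. x \<in> J \<Longrightarrow> (norm x)\<^sup>2 \<le> K * tr (x * x)" using norm_le_tr by blast
  have "norm (fc C l) \<le> sqrt (K * tr 1)" if C: "frame C" and l: "\<forall>c\<in>C. \<bar>l c\<bar> \<le> 1" for C l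
  proof -
    have "tr (fc C l * fc C l) = (\<Sum>c\<in>C. (l c * l c) * tr c)" by (simp add: fc_mult[OF C] tr_fc)
    also have "\<dots> \<le> (\<Sum>c\<in>C. 1 * tr c)"
    proof (intro sum_mono mult_right_mono)
      fix c assume "c \<in> C"
      then show "l c * l c \<le> 1" using l by (simp add: abs_square_le_1 power2_eq_square[symmetric])
    qed (use frame_tr_pos[OF C] in \<open>auto simp: less_imp_le\<close>)
    also have "\<dots> = tr 1" using frame_ofD(7)[OF C] by (simp add: tr_sum[symmetric])
    finally have "(norm (fc C l))\<^sup>2 \<le> K * tr 1"
      using K(1) K(2)[OF fc_J[OF C], of l] by (meson mult_left_mono order_trans less_imp_le)
    then show ?thesis by (rule real_le_rsqrt)
  qed
  then show ?thesis by blast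
qed

lemma tr_sandwich:
  assumes "s \<in> J" "s - m *\<^sub>R 1 \<in> psd" "r \<in> J"
  shows "tr (s * (r * r)) \<ge> m * tr (r * r)"
proof -
  have "(s - m *\<^sub>R 1) * (r * r) = s * (r * r) - m *\<^sub>R (r * r)" by (simp add: left_diff_distrib)
  then show ?thesis using psdD(2)[OF assms(2,3)] by (simp only: tr_diff tr_scale diff_ge_0_iff_ge)
qed

lemma tr_square_difference:
  fixes s t :: 'a
  defines "r \<equiv> s - t"
  shows "tr (r * (s * s - t * t)) = tr (s * (r * r)) + tr (t * (r * r))"
proof -
  have "s * s - t * t = s * r + r * t" by (simp add: r_def algebra_simps)
  then have "tr (r * (s * s - t * t)) = tr (r * (s * r)) + tr (r * (r * t))"
    by (simp add: distrib_left tr_add)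
  moreover have "tr (r * (s * r)) = tr (s * (r * r))"
    by (subst tr_commute) (simp add: mult.assoc)
  moreover have "tr (r * (r * t)) = tr (t * (r * r))"
    by (subst mult.assoc[symmetric], subst tr_commute) simp
  ultimately show ?thesis by simp
qed

text \<open>With \<open>r = s - t\<close> we have \<open>s\<^sup>2 - t\<^sup>2 = s r + r t\<close>, so that
\<open>tr (r (s\<^sup>2 - t\<^sup>2)) = tr (s r\<^sup>2) + tr (t r\<^sup>2)\<close> is at least \<open>m tr (r\<^sup>2)\<close> for a lower bound \<open>m\<close>
of \<open>t\<close>. Comparing the trace form with the norm gives the estimate, which proves at once that the
square root is unique and that it is continuous.\<close>

lemma posdef_sqrt_lipschitz:
  assumes t: "t \<in> posdef"
  shows "\<exists>K. \<forall>s\<in>posdef. norm (s - t) \<le> K * norm (s * s - t * t)"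
proof -
  obtain m where m: "m > 0" "t - m *\<^sub>R 1 \<in> psd" using t by (auto simp: posdef_iff_bounded_below)
  obtain K where K: "K > 0" "\<And>x. x \<in> J \<Longrightarrow> (norm x)\<^sup>2 \<le> K * tr (x * x)" using norm_le_tr by blast
  obtain M where M: "M > 0" "\<And>x. norm (tr x) \<le> norm x * M"
    using bounded_linear.pos_bounded[OF linear_imp_bounded[OF linear_tr]] by blast
  have "norm (s - t) \<le> K * M / m * norm (s * s - t * t)" if s: "s \<in> posdef" for s
  proof (cases "s = t")
    case False
    let ?r = "s - t"
    have rJ: "?r \<in> J" using s t by (simp add: diff_J posdef_J)
    have "m * (norm ?r)\<^sup>2 \<le> K * (m * tr (?r * ?r))"
      using mult_left_mono[OF K(2)[OF rJ], of m] m(1) by (simp add: mult_ac)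
    also have "m * tr (?r * ?r) \<le> tr (?r * (s * s - t * t))"
      unfolding tr_square_difference
      using tr_sandwich[OF posdef_J[OF t] m(2) rJ] psdD(2)[OF posdef_psd[OF s] rJ] by simp
    also have "\<dots> \<le> norm (?r * (s * s - t * t)) * M"
      using M(2)[of "?r * (s * s - t * t)"] by simp
    also have "\<dots> \<le> norm ?r * norm (s * s - t * t) * M"
      using M(1) by (intro mult_right_mono norm_mult_ineq) simp
    finally have "norm ?r * (m * norm ?r) \<le> norm ?r * (K * M * norm (s * s - t * t))"
      using K(1) by (simp add: power2_eq_square mult_ac)
    then have "m * norm ?r \<le> K * M * norm (s * s - t * t)"
      using False by (simp add: mult_le_cancel_left)
    then show ?thesis using m(1) by (simp add: field_simps)
  qed simp
  then show ?thesis by blast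
qed

lemma posdef_sqrt_unique: "s \<in> posdef \<Longrightarrow> t \<in> posdef \<Longrightarrow> s * s = t * t \<Longrightarrow> s = t"
  using posdef_sqrt_lipschitz[of t] by force

definition psqrt :: "'a \<Rightarrow> 'a" where
  "psqrt p = (THE s. s \<in> posdef \<and> s * s = p)"

lemma psqrt:
  assumes p: "p \<in> posdef"
  shows "psqrt p \<in> posdef" "psqrt p * psqrt p = p"
proof -
  obtain C l where C: "frame C" "p = fc C l" using spectral_theorem[OF posdef_J[OF p]] .
  have l: "\<forall>c\<in>C. l c > 0" using p fc_posdef_iff[OF C(1)] C(2) by simp
  let ?s = "fc C (\<lambda>c. sqrt (l c))"
  have "?s \<in> posdef" using l by (simp add: fc_posdef_iff[OF C(1)])
  moreover have "?s * ?s = p"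
    unfolding fc_mult[OF C(1)] C(2) by (intro fc_cong) (use l in \<open>auto simp: less_imp_le\<close>)
  ultimately have "\<exists>!s. s \<in> posdef \<and> s * s = p" using posdef_sqrt_unique by metis
  from theI'[OF this] show "psqrt p \<in> posdef" "psqrt p * psqrt p = p"
    by (auto simp: psqrt_def)
qed

lemma psqrt_unique: "s \<in> posdef \<Longrightarrow> s * s = p \<Longrightarrow> p \<in> posdef \<Longrightarrow> psqrt p = s"
  using psqrt posdef_sqrt_unique by metis

lemma continuous_on_psqrt: "continuous_on posdef psqrt"
  unfolding continuous_on_def
proof
  fix p assume p: "p \<in> posdef"
  obtain K where K: "\<And>s. s \<in> posdef \<Longrightarrow> norm (s - psqrt p) \<le> K * norm (s * s - p)"
    using posdef_sqrt_lipschitz[OF psqrt(1)[OF p]] psqrt(2)[OF p] by auto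
  have "((\<lambda>q. K * norm (q - p)) \<longlongrightarrow> K * norm (p - p)) (at p within posdef)"
    by (intro tendsto_intros)
  moreover have "\<forall>\<^sub>F q in at p within posdef. norm (psqrt q - psqrt p) \<le> K * norm (q - p)"
    unfolding eventually_at_filter using K[OF psqrt(1)] by (intro always_eventually) (simp add: psqrt(2))
  ultimately have "((\<lambda>q. psqrt q - psqrt p) \<longlongrightarrow> 0) (at p within posdef)"
    by (intro Lim_null_comparison[of "\<lambda>q. psqrt q - psqrt p"]) auto
  then show "(psqrt \<longlongrightarrow> psqrt p) (at p within posdef)" by (simp add: LIM_zero_iff)
qed

text \<open>The eigenvalues of \<open>p\<close> and their inverses have bounded powers, so they equal 1. This is what excludes
compact subgroups larger than the stabilizers.\<close>

lemma power_bounded_posdef: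
  assumes p: "p \<in> posdef" "p * y = 1" "y * p = 1"
    and bd: "\<And>n. norm (p ^ n) \<le> M" "\<And>n. norm (y ^ n) \<le> M"
  shows "p = 1"
proof -
  obtain C l where C: "frame C" "p = fc C l" "y = fc C (\<lambda>c. 1 / l c)"
    using inverse_J[OF posdef_J[OF p(1)] p(2,3)] by metis
  have l: "l c > 0" if "c \<in> C" for c using p(1) C that by (simp add: fc_posdef_iff[OF C(1)])
  have le1: "a \<le> 1" if "\<And>n. a ^ n \<le> M" for a :: real
  proof (rule ccontr)
    assume "\<not> a \<le> 1"
    then obtain n where "M < a ^ n" using real_arch_pow[of a M] by auto
    then show False using that[of n] by simp
  qed
  have "l c = 1" if c: "c \<in> C" for c
  proof -
    have "l c ^ n \<le> M" for n
      using order_trans[OF spectral_value_le_norm[OF C(1) c, of "\<lambda>c. l c ^ n"]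
          bd(1)[of n, unfolded C(2) fc_power[OF C(1)]]] by (rule abs_le_D1)
    moreover have "(1 / l c) ^ n \<le> M" for n
      using order_trans[OF spectral_value_le_norm[OF C(1) c, of "\<lambda>c. (1 / l c) ^ n"]
          bd(2)[of n, unfolded C(3) fc_power[OF C(1)]]] by (rule abs_le_D1)
    ultimately have "l c \<le> 1" "1 / l c \<le> 1" by (simp_all only: le1)
    then show ?thesis using l[OF c] by (simp add: field_simps)
  qed
  then have "p = fc C (\<lambda>_. 1)" unfolding C(2) by (intro fc_cong)
  then show ?thesis by (simp add: fc_one[OF C(1)])
qed

end

section \<open>Unit groups and continuity of inversion\<close>

abbreviation ainv :: "'a::ring_1 \<Rightarrow> 'a" where "ainv x \<equiv> inv\<^bsub>alg_units\<^esub> x"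

lemma monoid_of_ring: "Group.monoid \<lparr>carrier = (UNIV::'a::ring_1 set), monoid.mult = (*), one = 1\<rparr>"
  by unfold_locales (auto simp: mult.assoc)

lemma group_alg_units: "group (alg_units :: 'a::ring_1 monoid)"
  unfolding alg_units_def by (rule monoid.units_group[OF monoid_of_ring])

lemma alg_units_simps [simp]:
  "monoid.mult alg_units = (*)" "one alg_units = 1"
  by (simp_all add: alg_units_def units_of_def)

lemma carrier_alg_units: "x \<in> carrier alg_units \<longleftrightarrow> (\<exists>y. x * y = 1 \<and> y * x = 1)"
  by (auto simp: alg_units_def units_of_def Units_def)

lemma unitI: "x * y = 1 \<Longrightarrow> y * x = 1 \<Longrightarrow> x \<in> carrier alg_units"
  by (auto simp: carrier_alg_units)

lemma ainv:
  assumes "x \<in> carrier alg_units"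
  shows "x * ainv x = 1" "ainv x * x = 1" "ainv x \<in> carrier alg_units"
  using group.r_inv[OF group_alg_units assms] group.l_inv[OF group_alg_units assms]
    group.inv_closed[OF group_alg_units assms] by simp_all

lemma ainv_unique:
  assumes "x * y = 1" "y * x = 1"
  shows "ainv x = y"
  using group.inv_equality[OF group_alg_units, of y x] assms unitI[of x y] unitI[of y x] by simp

lemma unit_mult: "x \<in> carrier alg_units \<Longrightarrow> y \<in> carrier alg_units \<Longrightarrow> x * y \<in> carrier alg_units"
  using monoid.m_closed[OF group.is_monoid[OF group_alg_units], of x y] by simp

lemma one_unit: "1 \<in> carrier alg_units"
  by (rule unitI[of 1 1]) auto

lemma ainv_mult:
  "x \<in> carrier alg_units \<Longrightarrow> y \<in> carrier alg_units \<Longrightarrow> ainv (x * y) = ainv y * ainv x"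
  using group.inv_mult_group[OF group_alg_units, of x y] by simp

lemma ainv_ainv: "x \<in> carrier alg_units \<Longrightarrow> ainv (ainv x) = x"
  using group.inv_inv[OF group_alg_units, of x] by simp

lemma exp_inverse: "exp x * exp (- x) = 1" "exp (- x) * exp x = 1"
  for x :: "'a::{real_normed_algebra_1,banach}"
  using exp_minus_inverse[of x] exp_minus_inverse[of "- x"] by simp_all

lemma exp_unit: "exp x \<in> carrier alg_units" for x :: "'a::{real_normed_algebra_1,banach}"
  using exp_inverse[of x] by (rule unitI)

text \<open>From \<open>g - m = g (l - f) m\<close> one first gets a bound for \<open>g\<close> near the limit and then the convergence.
The product is a parameter because the lemma is applied to the algebra and to its complexification,
which is a product space with a multiplication of its own.\<close>

lemma tendsto_bilinear_inverse:
  fixes prod :: "'b::real_normed_vector \<Rightarrow> 'b \<Rightarrow> 'b"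
  assumes "bounded_bilinear prod"
    and assoc: "\<And>x y z. prod (prod x y) z = prod x (prod y z)"
    and unit: "\<And>x. prod e x = x" "\<And>x. prod x e = x"
    and f: "(f \<longlongrightarrow> l) F" and l: "prod l m = e"
    and g: "\<forall>\<^sub>F x in F. prod (g x) (f x) = e"
  shows "(g \<longlongrightarrow> m) F"
proof -
  interpret bounded_bilinear prod by fact
  obtain K where K: "K > 0" "\<And>a b. norm (prod a b) \<le> norm a * norm b * K"
    using pos_bounded by blast
  define c where "c x = norm (l - f x) * (norm m * K * K)" for x
  have "(c \<longlongrightarrow> norm (l - l) * (norm m * K * K)) F"
    unfolding c_def by (intro tendsto_intros f)
  then have c: "(c \<longlongrightarrow> 0) F" by simp
  have est: "norm (g x - m) \<le> norm (g x) * c x" if "prod (g x) (f x) = e" for x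
  proof -
    have "g x - m = prod (g x) (prod l m) - prod (prod (g x) (f x)) m"
      using that l unit by simp
    also have "\<dots> = prod (g x) (prod (l - f x) m)"
      by (simp add: assoc diff_left diff_right)
    finally have "norm (g x - m) \<le> norm (g x) * norm (prod (l - f x) m) * K" using K(2) by simp
    also have "\<dots> \<le> norm (g x) * (norm (l - f x) * norm m * K) * K"
      using K by (intro mult_right_mono mult_left_mono) auto
    finally show ?thesis by (simp add: c_def mult_ac)
  qed
  have "\<forall>\<^sub>F x in F. c x < 1/2" using c by (rule order_tendstoD) simp
  then have "\<forall>\<^sub>F x in F. norm (g x - m) \<le> (2 * norm m) * c x"
    using g
  proof eventually_elim
    case (elim x)
    have c0: "c x \<ge> 0" using K by (simp add: c_def)
    have "norm (g x) \<le> norm m + norm (g x - m)" by (metis add.commute diff_add_cancel norm_triangle_ineq)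
    also have "\<dots> \<le> norm m + norm (g x) * (1/2)"
      using est[OF elim(2)] elim(1) mult_left_mono[of "c x" "1/2" "norm (g x)"] by simp
    finally have "norm (g x) \<le> 2 * norm m" by simp
    then show ?case using est[OF elim(2)] mult_right_mono[OF _ c0] order_trans by blast
  qed
  moreover have "((\<lambda>x. (2 * norm m) * c x) \<longlongrightarrow> (2 * norm m) * 0) F" by (intro tendsto_intros c)
  ultimately have "((\<lambda>x. g x - m) \<longlongrightarrow> 0) F"
    by (intro Lim_null_comparison[of "\<lambda>x. g x - m"]) auto
  then show ?thesis by (simp add: LIM_zero_iff)
qed

lemma tendsto_ainv:
  fixes f :: "_ \<Rightarrow> 'a::real_normed_algebra_1"
  assumes "(f \<longlongrightarrow> l) F" "l \<in> carrier alg_units" "\<forall>\<^sub>F x in F. f x \<in> carrier alg_units"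
  shows "((\<lambda>x. ainv (f x)) \<longlongrightarrow> ainv l) F"
  by (rule tendsto_bilinear_inverse[OF bounded_bilinear_mult _ _ _ assms(1), of 1])
     (use ainv(1)[OF assms(2)] in \<open>auto simp: mult.assoc intro: eventually_mono[OF assms(3)] ainv\<close>)

lemma continuous_on_ainv:
  fixes f :: "_ \<Rightarrow> 'a::real_normed_algebra_1"
  assumes "continuous_on S f" "\<And>x. x \<in> S \<Longrightarrow> f x \<in> carrier alg_units"
  shows "continuous_on S (\<lambda>x. ainv (f x))"
  using assms unfolding continuous_on_def
  by (auto intro!: tendsto_ainv simp: eventually_at_filter)

section \<open>Closed subgroups of the unit group\<close>

lemma lie_subgroupD:
  assumes "lie_subgroup H alg_units"
  shows "x \<in> H \<Longrightarrow> x \<in> carrier alg_units" "1 \<in> H" "x \<in> H \<Longrightarrow> y \<in> H \<Longrightarrow> x * y \<in> H"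
    "x \<in> H \<Longrightarrow> ainv x \<in> H"
proof -
  have H: "subgroup H alg_units" using assms by (simp add: lie_subgroup_def)
  show "x \<in> H \<Longrightarrow> x \<in> carrier alg_units" "1 \<in> H" "x \<in> H \<Longrightarrow> y \<in> H \<Longrightarrow> x * y \<in> H"
    "x \<in> H \<Longrightarrow> ainv x \<in> H"
    using subgroup.mem_carrier[OF H] subgroup.one_closed[OF H] subgroup.m_closed[OF H]
      subgroup.m_inv_closed[OF H] by simp_all
qed

text \<open>Groups are only closed relative to the group of units, so a limit has to be known to be a unit.\<close>

lemma closedin_limit:
  fixes H :: "'a::metric_space set"
  assumes "closedin (top_of_set U) H" "\<And>n. f n \<in> H" "f \<longlonglongrightarrow> x" "x \<in> U"
  shows "x \<in> H"
proof -
  obtain T where T: "closed T" "H = U \<inter> T" using assms(1) by (auto simp: closedin_closed)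
  then have "x \<in> T" using closed_sequentially[OF T(1) _ assms(3)] assms(2) by blast
  then show ?thesis using T(2) assms(4) by blast
qed

lemma lie_subgroup_limit:
  fixes f :: "nat \<Rightarrow> 'a::{real_normed_algebra_1,banach}"
  assumes "lie_subgroup H alg_units" "\<And>n. f n \<in> H" "f \<longlonglongrightarrow> x" "x \<in> carrier alg_units"
  shows "x \<in> H"
  by (rule closedin_limit[OF _ assms(2-4)]) (use assms(1) in \<open>simp add: lie_subgroup_def\<close>)

lemma lie_subgroup_power: "lie_subgroup H alg_units \<Longrightarrow> x \<in> H \<Longrightarrow> x ^ n \<in> H"
  by (induction n) (auto intro: lie_subgroupD)

lemma norm_exp_second_order:
  fixes y :: "'a::{real_normed_algebra_1,banach}"
  shows "norm (exp y - 1 - y) \<le> (norm y)\<^sup>2 * exp (norm y)"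
proof -
  let ?a = "\<lambda>n. y ^ n /\<^sub>R fact n"
  have s: "summable ?a" by (rule summable_exp_generic)
  have "exp y = (\<Sum>n. ?a (n + 2)) + (\<Sum>i<2. ?a i)"
    unfolding exp_def by (rule suminf_split_initial_segment[OF s])
  then have "exp y - 1 - y = (\<Sum>n. ?a (n + 2))" by (simp add: numeral_2_eq_2)
  moreover have b: "norm (?a (n + 2)) \<le> (norm y)\<^sup>2 * (norm y ^ n /\<^sub>R fact n)" for n
  proof -
    have "norm (?a (n + 2)) \<le> norm y ^ (n + 2) / fact (n + 2)"
      by (simp add: divide_inverse mult.commute norm_power_ineq mult_left_mono del: power_Suc)
    also have "\<dots> \<le> norm y ^ (n + 2) / fact n"
      by (intro divide_left_mono fact_mono) auto
    also have "\<dots> = (norm y)\<^sup>2 * (norm y ^ n /\<^sub>R fact n)"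
      by (simp add: power_add divide_inverse mult_ac power2_eq_square)
    finally show ?thesis .
  qed
  moreover have s2: "summable (\<lambda>n. (norm y)\<^sup>2 * (norm y ^ n /\<^sub>R fact n))"
    by (intro summable_mult summable_exp_generic)
  ultimately have "norm (exp y - 1 - y) \<le> (\<Sum>n. (norm y)\<^sup>2 * (norm y ^ n /\<^sub>R fact n))"
    by (simp add: norm_suminf_le)
  also have "\<dots> = (norm y)\<^sup>2 * exp (norm y)"
    unfolding exp_def by (rule suminf_mult) (rule summable_exp_generic)
  finally show ?thesis .
qed

lemma isCont_exp_banach: "isCont exp x" for x :: "'a::{real_normed_algebra_1,banach}"
proof -
  let ?A = "ball 0 (norm x + 1) :: 'a set"
  have "uniform_limit ?A (\<lambda>n z. \<Sum>i<n. z ^ i /\<^sub>R fact i) (\<lambda>z. \<Sum>i. z ^ i /\<^sub>R fact i) sequentially"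
  proof (rule Weierstrass_m_test)
    show "norm (z ^ n /\<^sub>R fact n) \<le> (norm x + 1) ^ n /\<^sub>R fact n" if "z \<in> ?A" for n and z :: 'a
      using that order_trans[OF norm_power_ineq power_mono[of "norm z" "norm x + 1" n]]
      by (simp add: mult_left_mono)
    show "summable (\<lambda>n. (norm x + 1) ^ n /\<^sub>R fact n)" by (rule summable_exp_generic)
  qed
  then have "continuous_on ?A (\<lambda>z. \<Sum>i. z ^ i /\<^sub>R fact i)"
    by (rule uniform_limit_theorem[rotated]) (auto intro!: always_eventually continuous_intros)
  then have "continuous_on ?A exp" by (simp add: exp_def[abs_def])
  then show ?thesis by (simp add: continuous_on_eq_continuous_at)
qed

lemma norm_power_diff_le:
  fixes a b :: "'a::real_normed_algebra_1"
  assumes "norm a \<le> M" "norm b \<le> M" "M \<ge> 1"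
  shows "norm (a ^ k - b ^ k) \<le> k * M ^ k * norm (a - b)"
proof (induction k)
  case (Suc k)
  have M: "M ^ k \<ge> 1" "M ^ k \<le> M ^ Suc k" using assms(3) by auto
  have "a ^ Suc k - b ^ Suc k = a * (a ^ k - b ^ k) + (a - b) * b ^ k" by (simp add: algebra_simps)
  then have "norm (a ^ Suc k - b ^ Suc k) \<le> norm (a * (a ^ k - b ^ k)) + norm ((a - b) * b ^ k)"
    by (metis norm_triangle_ineq)
  also have "norm (a * (a ^ k - b ^ k)) \<le> M * (k * M ^ k * norm (a - b))"
    by (rule order_trans[OF norm_mult_ineq mult_mono]) (use assms Suc in auto)
  also have "norm ((a - b) * b ^ k) \<le> norm (a - b) * M ^ k"
    by (rule order_trans[OF norm_mult_ineq mult_left_mono])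
       (use assms order_trans[OF norm_power_ineq power_mono] in auto)
  also have "norm (a - b) * M ^ k \<le> norm (a - b) * M ^ Suc k"
    using M by (intro mult_left_mono) auto
  finally show ?case by (simp add: algebra_simps)
qed simp

text \<open>Compare \<open>(1 + y)\<^sup>k\<close> with \<open>exp (y)\<^sup>k = exp (k y)\<close>: the error is of order \<open>k (norm y)\<^sup>2\<close>, which
tends to 0 because \<open>k y\<close> stays bounded.\<close>

lemma power_tendsto_exp:
  fixes y :: "nat \<Rightarrow> 'a::{real_normed_algebra_1,banach}"
  assumes y: "y \<longlonglongrightarrow> 0" and ky: "(\<lambda>n. real (k n) *\<^sub>R y n) \<longlonglongrightarrow> w"
  shows "(\<lambda>n. (1 + y n) ^ k n) \<longlonglongrightarrow> exp w"
proof -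
  have e: "exp (y n) ^ k n = exp (real (k n) *\<^sub>R y n)" for n
  proof -
    have "exp (y n) ^ k = exp (real k *\<^sub>R y n)" for k
    proof (induction k)
      case (Suc k)
      have "exp (real (Suc k) *\<^sub>R y n) = exp (y n + real k *\<^sub>R y n)" by (simp add: scaleR_add_left)
      also have "\<dots> = exp (y n) * exp (real k *\<^sub>R y n)" by (rule exp_add_commuting) simp
      finally show ?case using Suc by simp
    qed simp
    then show ?thesis .
  qed
  let ?r = "\<lambda>n. norm (real (k n) *\<^sub>R y n)"
  have bd: "norm ((1 + y n) ^ k n - exp (y n) ^ k n) \<le> ?r n * exp (?r n) * (norm (y n) * exp (norm (y n)))" for n
  proof -
    have "norm (1 + y n) \<le> exp (norm (y n))"
      by (metis exp_ge_add_one_self norm_one norm_triangle_ineq order_trans)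
    then have "norm ((1 + y n) ^ k n - exp (y n) ^ k n)
        \<le> k n * exp (norm (y n)) ^ k n * norm (1 + y n - exp (y n))"
      by (intro norm_power_diff_le norm_exp) auto
    also have "\<dots> \<le> k n * exp (norm (y n)) ^ k n * ((norm (y n))\<^sup>2 * exp (norm (y n)))"
      using norm_exp_second_order[of "y n"] by (intro mult_left_mono) (auto simp: norm_minus_commute algebra_simps)
    also have "exp (norm (y n)) ^ k n = exp (?r n)" by (simp add: exp_of_nat_mult)
    finally show ?thesis by (simp add: power2_eq_square mult_ac)
  qed
  have r: "?r \<longlonglongrightarrow> norm w" by (intro tendsto_intros ky)
  have "(\<lambda>n. ?r n * exp (?r n) * (norm (y n) * exp (norm (y n))))
      \<longlonglongrightarrow> norm w * exp (norm w) * (norm (0::'a) * exp (norm (0::'a)))"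
    by (intro tendsto_intros r y)
  then have "(\<lambda>n. ?r n * exp (?r n) * (norm (y n) * exp (norm (y n)))) \<longlonglongrightarrow> 0" by simp
  then have "(\<lambda>n. (1 + y n) ^ k n - exp (y n) ^ k n) \<longlonglongrightarrow> 0"
    by (rule Lim_null_comparison[rotated]) (use bd in auto)
  moreover have "(\<lambda>n. exp (y n) ^ k n) \<longlonglongrightarrow> exp w"
    unfolding e by (rule isCont_tendsto_compose[OF isCont_exp_banach ky])
  ultimately have "(\<lambda>n. ((1 + y n) ^ k n - exp (y n) ^ k n) + exp (y n) ^ k n) \<longlonglongrightarrow> 0 + exp w"
    by (rule tendsto_add)
  then show ?thesis by simp
qed

text \<open>If the unit vectors in the directions \<open>g n - 1\<close> converge to \<open>v\<close>, then suitable powers of \<open>g n\<close>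
converge to \<open>exp (t v)\<close>.\<close>

lemma tangent_direction_in_lie_algebra:
  fixes g :: "nat \<Rightarrow> 'a::{real_normed_algebra_1,banach}"
  assumes H: "lie_subgroup H alg_units" and g: "\<And>n. g n \<in> H" "\<And>n. g n \<noteq> 1" "g \<longlonglongrightarrow> 1"
    and v: "(\<lambda>n. (1 / norm (g n - 1)) *\<^sub>R (g n - 1)) \<longlonglongrightarrow> v"
  shows "v \<in> lie_algebra H"
proof -
  define y where "y n = g n - 1" for n
  have y0: "norm (y n) > 0" for n using g(2) by (simp add: y_def)
  have y: "y \<longlonglongrightarrow> 0" unfolding y_def using g(3) by (simp add: LIM_zero)
  have pos: "exp (t *\<^sub>R v) \<in> H" if t: "t \<ge> 0" for t
  proof -
    \<comment> \<open>the exponent for which \<open>k n\<close> steps of length \<open>norm (y n)\<close> approximate the time \<open>t\<close>\<close>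
    define k where "k n = nat \<lfloor>t / norm (y n)\<rfloor>" for n
    have k: "\<bar>real (k n) * norm (y n) - t\<bar> \<le> norm (y n)" for n
    proof -
      have "real (k n) = of_int \<lfloor>t / norm (y n)\<rfloor>" using t y0[of n] by (simp add: k_def)
      then have "real (k n) \<le> t / norm (y n)" "t / norm (y n) \<le> real (k n) + 1" by linarith+
      then show ?thesis using y0[of n] by (simp add: field_simps abs_le_iff)
    qed
    have "(\<lambda>n. real (k n) * norm (y n) - t) \<longlonglongrightarrow> 0"
      using k by (intro Lim_null_comparison[OF _ tendsto_norm_zero[OF y]]) auto
    then have "(\<lambda>n. real (k n) * norm (y n)) \<longlonglongrightarrow> t" by (simp add: LIM_zero_iff)
    then have "(\<lambda>n. (real (k n) * norm (y n)) *\<^sub>R ((1 / norm (y n)) *\<^sub>R y n)) \<longlonglongrightarrow> t *\<^sub>R v"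
      using v by (intro tendsto_scaleR) (auto simp: y_def)
    moreover have "norm (y n) \<noteq> 0" for n using y0[of n] by simp
    ultimately have "(\<lambda>n. real (k n) *\<^sub>R y n) \<longlonglongrightarrow> t *\<^sub>R v" by simp
    from power_tendsto_exp[OF y this] have "(\<lambda>n. g n ^ k n) \<longlonglongrightarrow> exp (t *\<^sub>R v)"
      by (simp add: y_def)
    then show ?thesis
      by (rule lie_subgroup_limit[OF H lie_subgroup_power[OF H g(1)] _ exp_unit])
  qed
  have "exp (t *\<^sub>R v) \<in> H" for t
  proof (cases "t \<ge> 0")
    case False
    then have "exp ((-t) *\<^sub>R v) \<in> H" by (intro pos) simp
    then have "ainv (exp ((-t) *\<^sub>R v)) \<in> H" by (rule lie_subgroupD(4)[OF H])
    moreover have "ainv (exp ((-t) *\<^sub>R v)) = exp (t *\<^sub>R v)"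
      using exp_inverse[of "t *\<^sub>R v"] by (intro ainv_unique) simp_all
    ultimately show ?thesis by (simp only:)
  qed (rule pos)
  then show ?thesis by (simp add: lie_algebra_def)
qed

text \<open>If \<open>b\<close> approximates \<open>x\<close> up to a quarter of its length, multiplication by \<open>exp (- b)\<close> moves \<open>1 + x\<close>
closer to 1 by a factor 2; the bound 1/40 absorbs the terms of second order.\<close>

lemma exp_step_halves_distance:
  fixes x b :: "'a::{real_normed_algebra_1,banach}"
  assumes x: "norm x \<le> 1/40" and b: "norm (x - b) \<le> (1/4) * norm x"
  shows "norm (exp (- b) * (1 + x) - 1) \<le> (1/2) * norm x"
proof -
  define R where "R = exp (- b) - 1 + b"
  have nb: "norm b \<le> (5/4) * norm x"
    using norm_triangle_ineq4[of x "x - b"] b by simp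
  have "exp (norm b) \<le> 2"
    using exp_bound_half[of "norm b"] nb x by simp
  then have "norm R \<le> (norm b)\<^sup>2 * 2"
    using norm_exp_second_order[of "- b"] mult_left_mono[of "exp (norm b)" 2 "(norm b)\<^sup>2"]
    by (simp add: R_def)
  also have "\<dots> \<le> ((5/4) * norm x)\<^sup>2 * 2" using nb by (intro mult_right_mono power_mono) auto
  finally have R: "norm R \<le> (25/8) * (norm x)\<^sup>2" by (simp add: power2_eq_square)
  have eq: "exp (- b) * (1 + x) - 1 = (x - b) + (R * (1 + x) - b * x)"
    by (simp add: R_def algebra_simps)
  have "norm (exp (- b) * (1 + x) - 1) \<le> norm (x - b) + (norm (R * (1 + x)) + norm (b * x))"
    unfolding eq using norm_triangle_ineq[of "x - b" "R * (1 + x) - b * x"]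
      norm_triangle_ineq4[of "R * (1 + x)" "b * x"] by linarith
  also have "norm (R * (1 + x)) \<le> ((25/8) * (norm x)\<^sup>2) * 2"
    by (rule order_trans[OF norm_mult_ineq mult_mono])
       (use R x norm_triangle_ineq[of 1 x] in auto)
  also have "norm (b * x) \<le> (5/4) * norm x * norm x"
    by (rule order_trans[OF norm_mult_ineq mult_right_mono]) (use nb in auto)
  also have "norm (x - b) \<le> (1/4) * norm x" by fact
  finally have "norm (exp (- b) * (1 + x) - 1) \<le> (1/4 + (15/2) * norm x) * norm x"
    by (simp add: power2_eq_square algebra_simps)
  also have "\<dots> \<le> (1/2) * norm x" using x by (intro mult_right_mono) auto
  finally show ?thesis .
qed

context finite_dim_algebra
begin

text \<open>Otherwise there would be a sequence in \<open>H\<close> tending to 1 whose directions keep a positive distance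
from the Lie algebra; by compactness a subsequence of the directions converges, and its limit lies in
the Lie algebra.\<close>

lemma close_to_lie_algebra:
  fixes H :: "'a set"
  assumes H: "lie_subgroup H alg_units" and sub: "subspace (lie_algebra H)"
  shows "\<exists>r>0. \<forall>g\<in>H. norm (g - 1) < r \<longrightarrow> (\<exists>b\<in>lie_algebra H. norm (g - 1 - b) \<le> (1/4) * norm (g - 1))"
proof (rule ccontr)
  assume neg: "\<not> ?thesis"
  have "\<exists>g. g \<in> H \<and> norm (g - 1) < 1 / Suc n \<and> \<not> (\<exists>b\<in>lie_algebra H. norm (g - 1 - b) \<le> (1/4) * norm (g - 1))" for n
  proof -
    have "1 / real (Suc n) > 0" by simp
    then show ?thesis using neg by metis
  qed
  then obtain g where g: "\<And>n. g n \<in> H" "\<And>n. norm (g n - 1) < 1 / Suc n"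
    and far: "\<And>n. \<not> (\<exists>b\<in>lie_algebra H. norm (g n - 1 - b) \<le> (1/4) * norm (g n - 1))"
    by metis
  have ne: "g n \<noteq> 1" for n
    using far[of n] subspace_0[OF sub] by force
  have "(\<lambda>n. g n - 1) \<longlonglongrightarrow> 0"
    by (rule Lim_null_comparison[OF _ LIMSEQ_inverse_real_of_nat])
       (use g(2) in \<open>auto simp: divide_inverse intro!: always_eventually less_imp_le\<close>)
  then have lim: "g \<longlonglongrightarrow> 1" by (simp add: LIM_zero_iff)
  define v where "v n = (1 / norm (g n - 1)) *\<^sub>R (g n - 1)" for n
  have v1: "norm (v n) = 1" for n using ne by (simp add: v_def)
  have "compact (closure (range v))"
    using v1 by (intro closed_bounded_imp_compact bounded_closure) (auto simp: bounded_iff)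
  then obtain w r where w: "strict_mono r" "(v \<circ> r) \<longlonglongrightarrow> w"
    unfolding compact_def using closure_subset[of "range v"] by (metis rangeI subsetD)
  have wB: "w \<in> lie_algebra H"
  proof (rule tangent_direction_in_lie_algebra[OF H, of "g \<circ> r"])
    show "(g \<circ> r) \<longlonglongrightarrow> 1" by (rule LIMSEQ_subseq_LIMSEQ[OF lim w(1)])
  qed (use g ne w(2) in \<open>auto simp: v_def o_def\<close>)
  have "\<forall>\<^sub>F n in sequentially. dist ((v \<circ> r) n) w < 1/4" using w(2) by (rule tendstoD) simp
  then obtain n where n: "norm (v (r n) - w) < 1/4"
    by (auto simp: eventually_sequentially dist_norm)
  let ?y = "g (r n) - 1"
  have "?y = norm ?y *\<^sub>R v (r n)" using ne[of "r n"] by (simp add: v_def)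
  then have "?y - norm ?y *\<^sub>R w = norm ?y *\<^sub>R (v (r n) - w)"
    by (simp only: scaleR_diff_right)
  then have "norm (?y - norm ?y *\<^sub>R w) = norm ?y * norm (v (r n) - w)" by simp
  also have "\<dots> \<le> norm ?y * (1/4)" using n by (intro mult_left_mono) auto
  finally show False using far[of "r n"] subspace_scale[OF sub wB] by (metis mult.commute)
qed

text \<open>A weak form of Cartan's theorem on closed subgroups. Near 1, an element \<open>g\<close> of \<open>H\<close> can be multiplied
by exponentials of elements of the Lie algebra so that its distance from 1 is halved in each step.
Collecting the inverse exponentials on the left gives \<open>g = p n * q n\<close> with \<open>p n\<close> in \<open>N\<close> and \<open>q n\<close>
tending to 1, so \<open>g\<close> lies in \<open>N\<close>. Hence \<open>N\<close> is open in the connected group \<open>H\<close>, and it is closed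
by assumption.\<close>

lemma connected_subgroup_eqI:
  fixes H N :: "'a set"
  assumes H: "lie_subgroup H alg_units" and conn: "connected H" and sub: "subspace (lie_algebra H)"
    and N: "N \<subseteq> H" "\<And>b. b \<in> lie_algebra H \<Longrightarrow> exp b \<in> N" "\<And>x y. x \<in> N \<Longrightarrow> y \<in> N \<Longrightarrow> x * y \<in> N"
    and cl: "closedin (top_of_set H) N"
  shows "N = H"
proof -
  note HD = lie_subgroupD[OF H]
  have N1: "1 \<in> N" using N(2)[OF subspace_0[OF sub]] by simp
  obtain r where r: "r > 0" "\<And>g. g \<in> H \<Longrightarrow> norm (g - 1) < r \<Longrightarrow>
      \<exists>b\<in>lie_algebra H. norm (g - 1 - b) \<le> (1/4) * norm (g - 1)"
    using close_to_lie_algebra[OF H sub] by blast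
  \<comment> \<open>within radius \<open>r\<close> the Lie algebra approximates \<open>H\<close>; 1/40 is the bound under which the exponential step contracts\<close>
  define d where "d = min r (1/40)"
  have near: "g \<in> N" if g: "g \<in> H" "norm (g - 1) < d" for g
  proof -
    have "\<exists>p q. p \<in> N \<and> q \<in> H \<and> p * q = g \<and> norm (q - 1) \<le> (1/2)^n * norm (g - 1)" for n
    proof (induction n)
      case 0
      then show ?case using N1 g(1) by (intro exI[of _ 1] exI[of _ g]) auto
    next
      case (Suc n)
      then obtain p q where pq: "p \<in> N" "q \<in> H" "p * q = g" "norm (q - 1) \<le> (1/2)^n * norm (g - 1)" by blast
      have "(1/2::real)^n \<le> 1" by (simp add: power_le_one)
      then have "(1/2)^n * norm (g - 1) \<le> 1 * norm (g - 1)" by (intro mult_right_mono) auto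
      then have q1: "norm (q - 1) < d" using pq(4) g(2) by simp
      then obtain b where b: "b \<in> lie_algebra H" "norm (q - 1 - b) \<le> (1/4) * norm (q - 1)"
        using r(2)[OF pq(2)] by (auto simp: d_def)
      have "norm (exp (- b) * q - 1) \<le> (1/2) * norm (q - 1)"
        using exp_step_halves_distance[of "q - 1" b] b(2) q1 by (simp add: d_def)
      also have "\<dots> \<le> (1/2) ^ Suc n * norm (g - 1)" using pq(4) by simp
      finally have "norm (exp (- b) * q - 1) \<le> (1/2) ^ Suc n * norm (g - 1)" .
      moreover have "exp (- b) \<in> N" by (rule N(2)[OF subspace_neg[OF sub b(1)]])
      then have "exp (- b) * q \<in> H" using N(1) pq(2) HD(3) by blast
      moreover have "(p * exp b) * (exp (- b) * q) = p * (exp b * exp (- b)) * q" by (simp only: mult.assoc)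
      then have "(p * exp b) * (exp (- b) * q) = g" by (simp add: exp_inverse pq(3))
      moreover have "p * exp b \<in> N" by (intro N(3) pq(1) N(2) b(1))
      ultimately show ?case by blast
    qed
    then obtain p q where pq: "\<And>n. p n \<in> N" "\<And>n. q n \<in> H" "\<And>n. p n * q n = g"
      "\<And>n. norm (q n - 1) \<le> (1/2)^n * norm (g - 1)" by metis
    have "(\<lambda>n. (1/2::real)^n * norm (g - 1)) \<longlonglongrightarrow> 0"
      by (intro tendsto_mult_left_zero LIMSEQ_power_zero) simp
    then have "(\<lambda>n. q n - 1) \<longlonglongrightarrow> 0"
      by (rule Lim_null_comparison[rotated]) (use pq(4) in auto)
    then have "q \<longlonglongrightarrow> 1" by (simp add: LIM_zero_iff)
    then have "(\<lambda>n. ainv (q n)) \<longlonglongrightarrow> ainv 1"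
      by (rule tendsto_ainv[OF _ one_unit]) (simp add: HD(1)[OF pq(2)])
    moreover have "ainv 1 = (1::'a)" by (rule ainv_unique) auto
    ultimately have "(\<lambda>n. g * ainv (q n)) \<longlonglongrightarrow> g * 1" by (intro tendsto_mult tendsto_const) (simp only:)
    moreover have "g * ainv (q n) = p n" for n
    proof -
      have "g * ainv (q n) = p n * (q n * ainv (q n))"
        by (simp only: pq(3)[of n, symmetric] mult.assoc)
      then show ?thesis by (simp only: ainv(1)[OF HD(1)[OF pq(2)]] mult_1_right)
    qed
    ultimately have "p \<longlonglongrightarrow> g" by (simp only: mult_1_right)
    then show ?thesis by (rule closedin_limit[OF cl pq(1) _ g(1)])
  qed
  have "openin (top_of_set H) N"
    unfolding openin_contains_ball
  proof (intro conjI ballI N(1))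
    fix p assume p: "p \<in> N"
    then have pH: "p \<in> H" using N(1) by blast
    define e where "e = d / (norm (ainv p) + 1)"
    have "norm (ainv p) + 1 > 0" by (simp add: add_nonneg_pos)
    then have e: "e > 0" using r(1) by (simp add: e_def d_def)
    have "g \<in> N" if g: "g \<in> ball p e" "g \<in> H" for g
    proof -
      have "ainv p * g - 1 = ainv p * (g - p)"
        using ainv(2)[OF HD(1)[OF pH]] by (simp add: right_diff_distrib)
      then have "norm (ainv p * g - 1) \<le> norm (ainv p) * norm (g - p)" by (simp only: norm_mult_ineq)
      also have "\<dots> \<le> norm (ainv p) * e"
      proof (rule mult_left_mono)
        show "norm (g - p) \<le> e" using g(1) by (metis dist_commute dist_norm less_imp_le mem_ball)
      qed (rule norm_ge_zero)
      also have "\<dots> < (norm (ainv p) + 1) * e" by (rule mult_strict_right_mono[OF _ e]) simp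
      also have "\<dots> = d"
        unfolding e_def using \<open>norm (ainv p) + 1 > 0\<close> by (metis less_irrefl nonzero_mult_div_cancel_left times_divide_eq_right)
      finally have "norm (ainv p * g - 1) < d" .
      then have "ainv p * g \<in> N" by (rule near[OF HD(3)[OF HD(4)[OF pH] g(2)]])
      then have "p * (ainv p * g) \<in> N" by (rule N(3)[OF p])
      then show ?thesis by (simp only: mult.assoc[symmetric] ainv(1)[OF HD(1)[OF pH]] mult_1_left)
    qed
    then show "\<exists>e>0. ball p e \<inter> H \<subseteq> N" using e by blast
  qed
  then have "N = {} \<or> N = H" using conn cl unfolding connected_clopen by blast
  then show ?thesis using N1 by blast
qed

end

section \<open>Hermitian groups\<close>

text \<open>The terms of the Cauchy product of the series for \<open>exp b * x\<close> and \<open>exp c\<close> are \<open>D\<^sup>n x / n!\<close>, where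
\<open>D y = b y + y c\<close>; the recursion for them is \<open>rec\<close> below.\<close>

lemma exp_twisted_conjugation_in_subspace:
  fixes b c x :: "'a::{real_normed_algebra_1,banach}"
  assumes V: "subspace V" "closed V" and x: "x \<in> V" and D: "\<And>y. y \<in> V \<Longrightarrow> b * y + y * c \<in> V"
  shows "exp b * x * exp c \<in> V"
proof -
  define A where "A i = b ^ i /\<^sub>R fact i" for i
  define C where "C i = c ^ i /\<^sub>R fact i" for i
  define T where "T n = (\<Sum>i\<le>n. (A i * x) * C (n - i))" for n
  have A_Suc: "b * A i = real (Suc i) *\<^sub>R A (Suc i)" for i
    by (simp add: A_def)
  have C_Suc: "C i * c = real (Suc i) *\<^sub>R C (Suc i)" for i
    by (simp add: C_def power_commutes)
  have rec: "real (Suc n) *\<^sub>R T (Suc n) = b * T n + T n * c" for n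
  proof -
    have "real (Suc n) *\<^sub>R T (Suc n) =
        (\<Sum>i\<le>Suc n. real i *\<^sub>R ((A i * x) * C (Suc n - i)) + real (Suc n - i) *\<^sub>R ((A i * x) * C (Suc n - i)))"
      unfolding T_def scaleR_sum_right
      by (intro sum.cong refl) (simp flip: scaleR_add_left of_nat_add)
    also have "\<dots> = (\<Sum>i\<le>Suc n. real i *\<^sub>R ((A i * x) * C (Suc n - i)))
        + (\<Sum>i\<le>Suc n. real (Suc n - i) *\<^sub>R ((A i * x) * C (Suc n - i)))"
      by (rule sum.distrib)
    also have "(\<Sum>i\<le>Suc n. real i *\<^sub>R ((A i * x) * C (Suc n - i))) = b * T n"
      by (subst sum.atMost_Suc_shift)
         (simp add: T_def sum_distrib_left mult.assoc[symmetric] A_Suc)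
    also have "(\<Sum>i\<le>Suc n. real (Suc n - i) *\<^sub>R ((A i * x) * C (Suc n - i))) = T n * c"
    proof -
      have "(A i * x) * C (n - i) * c = real (Suc n - i) *\<^sub>R ((A i * x) * C (Suc n - i))" if "i \<le> n" for i
        using C_Suc[of "n - i"] that by (simp add: mult.assoc Suc_diff_le)
      then show ?thesis by (simp add: T_def sum_distrib_right)
    qed
    finally show ?thesis .
  qed
  have TV: "T n \<in> V" for n
  proof (induction n)
    case 0
    then show ?case using x by (simp add: T_def A_def C_def)
  next
    case (Suc n)
    have "T (Suc n) = (1 / real (Suc n)) *\<^sub>R (real (Suc n) *\<^sub>R T (Suc n))" by simp
    then show ?case unfolding rec using subspace_scale[OF V(1) D[OF Suc]] by metis
  qed
  have "summable (\<lambda>i. norm (A i * x))"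
  proof (rule summable_comparison_test')
    show "summable (\<lambda>i. norm (A i) * norm x)"
      unfolding A_def by (intro summable_mult2 summable_norm_exp)
  qed (simp add: norm_mult_ineq)
  moreover have "summable (\<lambda>i. norm (C i))" unfolding C_def by (rule summable_norm_exp)
  ultimately have "T sums ((\<Sum>i. A i * x) * (\<Sum>i. C i))"
    unfolding T_def by (rule Cauchy_product_sums)
  moreover have "(\<Sum>i. A i * x) = exp b * x"
    unfolding A_def exp_def by (rule suminf_mult2[symmetric, OF summable_exp_generic])
  moreover have "(\<Sum>i. C i) = exp c" unfolding C_def exp_def ..
  ultimately have "(\<lambda>n. \<Sum>i<n. T i) \<longlonglongrightarrow> exp b * x * exp c" by (simp add: sums_def)
  then show ?thesis
    by (rule closed_sequentially[OF V(2), rotated]) (intro subspace_sum V TV)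
qed

text \<open>The assumptions on the Hermitian Lie algebra in the form in which the proof uses them: Jordan frames are
finite sets instead of tuples, and the condition on the cone of squares has become the formal reality
of \<open>J\<close>.\<close>

locale hermitian_group = formally_real_jordan E J
  for E :: "'a::{real_normed_algebra_1,banach} set" and J +
  fixes \<sigma> :: "'a \<Rightarrow> 'a" and G\<^sub>0 B :: "'a set"
  assumes linear_\<sigma>: "linear \<sigma>" and \<sigma>_mult: "\<sigma> (a * b) = \<sigma> b * \<sigma> a" and \<sigma>_\<sigma>: "\<sigma> (\<sigma> a) = a"
    and lie_G0: "lie_subgroup G\<^sub>0 alg_units" and connected_G0: "connected G\<^sub>0"
    and \<sigma>_G0: "g \<in> G\<^sub>0 \<Longrightarrow> \<sigma> g \<in> G\<^sub>0"
    and B_def: "B = lie_algebra G\<^sub>0"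
    and subspace_B: "subspace B" and bracket_B: "x \<in> B \<Longrightarrow> y \<in> B \<Longrightarrow> x * y - y * x \<in> B"
    and \<sigma>_B: "b \<in> B \<Longrightarrow> \<sigma> b \<in> B"
    and J_def: "J = sym_part \<sigma> B" and J_mult_B: "x \<in> J \<Longrightarrow> y \<in> J \<Longrightarrow> x * y \<in> B"
    and compact_O: "compact (orthogonal_group G\<^sub>0 \<sigma>)"
    and frames_conjugate: "frame C \<Longrightarrow> frame D \<Longrightarrow>
      \<exists>u\<in>orthogonal_group G\<^sub>0 \<sigma>. (\<lambda>c. u * c * ainv u) ` C = D"
begin

lemmas G0D = lie_subgroupD[OF lie_G0]
lemmas \<sigma>_add = linear_add[OF linear_\<sigma>] and \<sigma>_diff = linear_diff[OF linear_\<sigma>]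
  and \<sigma>_scale = linear_scale[OF linear_\<sigma>] and \<sigma>_0 = linear_0[OF linear_\<sigma>]
  and \<sigma>_neg = linear_neg[OF linear_\<sigma>]

lemma \<sigma>_1: "\<sigma> 1 = 1"
  by (metis \<sigma>_\<sigma> \<sigma>_mult mult_1_left mult_1_right)

lemma continuous_\<sigma>: "continuous_on S f \<Longrightarrow> continuous_on S (\<lambda>x. \<sigma> (f x))"
  using bounded_linear.continuous_on[OF linear_imp_bounded[OF linear_\<sigma>]] .

lemma tendsto_\<sigma>: "(f \<longlongrightarrow> l) F \<Longrightarrow> ((\<lambda>x. \<sigma> (f x)) \<longlongrightarrow> \<sigma> l) F"
  using bounded_linear.tendsto[OF linear_imp_bounded[OF linear_\<sigma>]] .

lemma J_B: "x \<in> J \<Longrightarrow> x \<in> B" and J_sym: "x \<in> J \<Longrightarrow> \<sigma> x = x"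
  and J_iff: "x \<in> J \<longleftrightarrow> x \<in> B \<and> \<sigma> x = x"
  by (auto simp: J_def sym_part_def)

lemma \<sigma>_unit: "x \<in> carrier alg_units \<Longrightarrow> \<sigma> x \<in> carrier alg_units"
  and \<sigma>_ainv: "x \<in> carrier alg_units \<Longrightarrow> ainv (\<sigma> x) = \<sigma> (ainv x)"
proof -
  assume x: "x \<in> carrier alg_units"
  have "\<sigma> x * \<sigma> (ainv x) = 1" "\<sigma> (ainv x) * \<sigma> x = 1"
    using ainv[OF x] by (simp_all add: \<sigma>_mult[symmetric] \<sigma>_1)
  then show "\<sigma> x \<in> carrier alg_units" "ainv (\<sigma> x) = \<sigma> (ainv x)"
    by (auto intro: unitI ainv_unique)
qed

lemma exp_\<sigma>: "\<sigma> (exp x) = exp (\<sigma> x)"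
proof -
  have "(\<lambda>n. \<sigma> (x ^ n /\<^sub>R fact n)) sums \<sigma> (exp x)"
    using exp_converges by (rule bounded_linear.sums[OF linear_imp_bounded[OF linear_\<sigma>]])
  moreover have "\<sigma> (x ^ n) = \<sigma> x ^ n" for n
    by (induction n) (auto simp: \<sigma>_1 \<sigma>_mult power_commutes)
  then have "\<sigma> (x ^ n /\<^sub>R fact n) = \<sigma> x ^ n /\<^sub>R fact n" for n by (simp add: \<sigma>_scale)
  ultimately have "(\<lambda>n. \<sigma> x ^ n /\<^sub>R fact n) sums \<sigma> (exp x)" by (simp only:)
  then show ?thesis by (rule sums_unique2[OF _ exp_converges])
qed

lemma exp_B: "b \<in> B \<Longrightarrow> exp b \<in> G\<^sub>0"
proof -
  assume "b \<in> B"
  then have "exp (1 *\<^sub>R b) \<in> G\<^sub>0" unfolding B_def lie_algebra_def by blast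
  then show ?thesis by simp
qed

lemma G0_eqI:
  assumes "N \<subseteq> G\<^sub>0" "\<And>b. b \<in> B \<Longrightarrow> exp b \<in> N" "\<And>x y. x \<in> N \<Longrightarrow> y \<in> N \<Longrightarrow> x * y \<in> N"
    "closedin (top_of_set G\<^sub>0) N"
  shows "N = G\<^sub>0"
  by (rule connected_subgroup_eqI[OF lie_G0 connected_G0 subspace_B[unfolded B_def] assms(1)
        assms(2)[unfolded B_def] assms(3,4)])

lemma posdef_G0: "p \<in> posdef \<Longrightarrow> p \<in> G\<^sub>0"
  using posdef_exp exp_B J_B by blast

lemma posdef_unit: "p \<in> posdef \<Longrightarrow> p \<in> carrier alg_units"
  by (rule G0D(1)[OF posdef_G0])

lemma posdef_iff_unit: "p \<in> posdef \<longleftrightarrow> p \<in> psd \<and> p \<in> carrier alg_units"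
  by (simp add: posdef_def carrier_alg_units)

text \<open>The infinitesimal form of the action: \<open>b x + x \<sigma>(b) = [b, x] + x (b + \<sigma>(b))\<close>, where the first term
lies in \<open>B\<close> because \<open>B\<close> is a Lie algebra and the second one because \<open>B\<close> is of Jordan type.\<close>

lemma derivation_J:
  assumes b: "b \<in> B" and x: "x \<in> J"
  shows "b * x + x * \<sigma> b \<in> J"
proof -
  have s: "b + \<sigma> b \<in> J" using b by (simp add: J_iff subspace_add[OF subspace_B] \<sigma>_B \<sigma>_add \<sigma>_\<sigma> add.commute)
  have "b * x + x * \<sigma> b = (b * x - x * b) + x * (b + \<sigma> b)" by (simp add: algebra_simps)
  then have "b * x + x * \<sigma> b \<in> B"
    using subspace_add[OF subspace_B bracket_B[OF b J_B[OF x]] J_mult_B[OF x s]] by (simp only:)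
  moreover have "\<sigma> (b * x + x * \<sigma> b) = b * x + x * \<sigma> b"
    using x by (simp add: \<sigma>_add \<sigma>_mult \<sigma>_\<sigma> J_sym add.commute)
  ultimately show ?thesis by (simp add: J_iff)
qed

lemma G0_act_J: "g \<in> G\<^sub>0 \<Longrightarrow> x \<in> J \<Longrightarrow> g * x * \<sigma> g \<in> J"
proof -
  let ?N = "{g \<in> G\<^sub>0. \<forall>x\<in>J. g * x * \<sigma> g \<in> J}"
  have "?N = G\<^sub>0"
  proof (rule G0_eqI)
    show "exp b \<in> ?N" if "b \<in> B" for b
      using exp_twisted_conjugation_in_subspace[OF subspace_J closed_J _ derivation_J[OF that]] exp_B[OF that]
      by (simp add: exp_\<sigma>)
    show "g * h \<in> ?N" if "g \<in> ?N" "h \<in> ?N" for g h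
    proof -
      have "g * h * x * \<sigma> (g * h) = g * (h * x * \<sigma> h) * \<sigma> g" for x
        by (simp add: \<sigma>_mult mult.assoc)
      then show ?thesis using that G0D(3) by simp
    qed
    have "?N = G\<^sub>0 \<inter> (\<Inter>x\<in>J. (\<lambda>g. g * x * \<sigma> g) -` J)" by auto
    moreover have "closed ((\<lambda>g. g * x * \<sigma> g) -` J)" for x
      by (rule closed_vimage[OF closed_J]) (intro continuous_intros continuous_\<sigma>)
    ultimately show "closedin (top_of_set G\<^sub>0) ?N"
      by (simp only:) (intro closedin_closed_Int closed_INT ballI)
  qed auto
  then show "g \<in> G\<^sub>0 \<Longrightarrow> x \<in> J \<Longrightarrow> g * x * \<sigma> g \<in> J" by blast
qed

text \<open>The set of all \<open>g * \<sigma> g\<close> is connected, contains 1 and consists of units of \<open>J\<close>. Among those, the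
positive definite elements form an open set, and a closed one since they are the positive
semidefinite units.\<close>

lemma G0_hermitian_square: "g \<in> G\<^sub>0 \<Longrightarrow> g * \<sigma> g \<in> posdef"
proof -
  let ?T = "(\<lambda>g. g * \<sigma> g) ` G\<^sub>0"
  have TJ: "?T \<subseteq> J" using G0_act_J[OF _ one_J] by auto
  have TU: "t \<in> carrier alg_units" if "t \<in> ?T" for t
    using that by (auto intro: unit_mult \<sigma>_unit dest: G0D(1))
  have "connected ?T"
    by (intro connected_continuous_image connected_G0 continuous_intros continuous_\<sigma>)
  moreover have "openin (top_of_set ?T) (?T \<inter> posdef)"
    unfolding openin_contains_ball
  proof (intro conjI ballI)
    fix p assume "p \<in> ?T \<inter> posdef"
    then obtain r where r: "r > 0" "\<And>q. q \<in> J \<Longrightarrow> norm (q - p) < r \<Longrightarrow> q \<in> posdef"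
      using posdef_open[of p] by blast
    have "ball p r \<inter> ?T \<subseteq> ?T \<inter> posdef"
      using TJ r(2) by (auto simp: dist_norm norm_minus_commute)
    then show "\<exists>e>0. ball p e \<inter> ?T \<subseteq> ?T \<inter> posdef" using r(1) by blast
  qed simp
  moreover have "?T \<inter> posdef = ?T \<inter> psd" using TU posdef_iff_unit by blast
  then have "closedin (top_of_set ?T) (?T \<inter> posdef)"
    using closed_psd by (simp add: closedin_closed_Int)
  ultimately have "?T \<inter> posdef = {} \<or> ?T \<inter> posdef = ?T"
    using connected_clopen[THEN iffD1, rule_format, of ?T "?T \<inter> posdef"] by (simp only: simp_thms)
  moreover have "1 * \<sigma> 1 \<in> ?T" by (rule imageI[OF G0D(2)])
  then have "1 \<in> ?T" by (simp only: \<sigma>_1 mult_1_left)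
  then have "?T \<inter> posdef \<noteq> {}" using one_posdef by (metis IntI empty_iff)
  ultimately have "?T \<inter> posdef = ?T" by (simp only: simp_thms)
  moreover assume "g \<in> G\<^sub>0"
  then have "g * \<sigma> g \<in> ?T" by (rule imageI)
  ultimately show "g * \<sigma> g \<in> posdef" by (metis IntD2)
qed

text \<open>With \<open>s\<close> the square root of \<open>p\<close>, which lies in \<open>G\<^sub>0\<close>, we have \<open>g p \<sigma>(g) = (g s) \<sigma>(g s)\<close>.\<close>

lemma G0_act_posdef: "g \<in> G\<^sub>0 \<Longrightarrow> p \<in> posdef \<Longrightarrow> g * p * \<sigma> g \<in> posdef"
proof -
  assume g: "g \<in> G\<^sub>0" and p: "p \<in> posdef"
  let ?s = "psqrt p"
  have "g * p * \<sigma> g = (g * ?s) * \<sigma> (g * ?s)"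
    using psqrt[OF p] by (simp add: \<sigma>_mult J_sym posdef_J mult.assoc) (simp add: mult.assoc[symmetric])
  then show ?thesis using G0_hermitian_square[OF G0D(3)[OF g posdef_G0[OF psqrt(1)[OF p]]]] by simp
qed

lemma posdef_sandwich: "p \<in> posdef \<Longrightarrow> q \<in> posdef \<Longrightarrow> p * q * p \<in> posdef"
  using G0_act_posdef[OF posdef_G0, of p q] by (simp add: J_sym posdef_J)

subsection \<open>Symmetries\<close>

definition F\<^sub>0 :: "'a set" where
  "F\<^sub>0 = (SOME C. frame C)"

lemma frame_F0: "frame F\<^sub>0"
proof -
  obtain C l where "frame C" "1 = fc C l" by (rule spectral_theorem[OF one_J])
  then show ?thesis unfolding F\<^sub>0_def by (intro someI)
qed

text \<open>The combinations of the reference frame with coefficients 1 and -1. They form a finite group of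
symmetries of \<open>J\<close> and represent the cosets of \<open>G\<^sub>0\<close> in \<open>G\<close>.\<close>

definition signs :: "'a set" where
  "signs = (\<lambda>T. fc F\<^sub>0 (\<lambda>c. if c \<in> T then 1 else -1)) ` Pow F\<^sub>0"

lemma finite_signs: "finite signs"
  unfolding signs_def using frame_ofD(1)[OF frame_F0] by simp

lemma signs_iff: "f \<in> signs \<longleftrightarrow> (\<exists>s. (\<forall>c\<in>F\<^sub>0. s c = 1 \<or> s c = -1) \<and> f = fc F\<^sub>0 s)"
proof
  assume "\<exists>s. (\<forall>c\<in>F\<^sub>0. s c = 1 \<or> s c = -1) \<and> f = fc F\<^sub>0 s"
  then obtain s where s: "\<forall>c\<in>F\<^sub>0. s c = 1 \<or> s c = -1" "f = fc F\<^sub>0 s" by blast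
  then have "f = fc F\<^sub>0 (\<lambda>c. if c \<in> {c \<in> F\<^sub>0. s c = 1} then 1 else -1)"
    unfolding s(2) by (intro fc_cong) auto
  then show "f \<in> signs" unfolding signs_def by blast
next
  assume "f \<in> signs"
  then obtain T where "f = fc F\<^sub>0 (\<lambda>c. if c \<in> T then 1 else -1)" unfolding signs_def by blast
  then show "\<exists>s. (\<forall>c\<in>F\<^sub>0. s c = 1 \<or> s c = -1) \<and> f = fc F\<^sub>0 s"
    by (intro exI[of _ "\<lambda>c. if c \<in> T then 1 else -1"]) auto
qed

lemma signs_cases:
  assumes "f \<in> signs"
  obtains s where "\<forall>c\<in>F\<^sub>0. s c = 1 \<or> s c = -1" "f = fc F\<^sub>0 s"
  using assms unfolding signs_iff by (elim exE conjE)

lemma signs_J: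
  assumes "f \<in> signs"
  shows "f \<in> J"
proof -
  obtain s where "f = fc F\<^sub>0 s" using assms unfolding signs_iff by blast
  then show ?thesis by (simp only: fc_J[OF frame_F0])
qed

lemma one_signs: "1 \<in> signs"
  unfolding signs_iff by (rule exI[of _ "\<lambda>_. 1"]) (simp add: fc_one[OF frame_F0])

lemma signs_square:
  assumes "f \<in> signs"
  shows "f * f = 1"
proof -
  obtain s where s: "\<forall>c\<in>F\<^sub>0. s c = 1 \<or> s c = -1" "f = fc F\<^sub>0 s"
    by (rule signs_cases[OF assms])
  have "s c * s c = 1" if "c \<in> F\<^sub>0" for c using bspec[OF s(1) that] by (elim disjE) simp_all
  then have "fc F\<^sub>0 (\<lambda>c. s c * s c) = fc F\<^sub>0 (\<lambda>_. 1)" by (rule fc_cong)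
  then show ?thesis by (simp only: s(2) fc_mult[OF frame_F0] fc_one[OF frame_F0])
qed

lemma signs_mult: "f \<in> signs \<Longrightarrow> h \<in> signs \<Longrightarrow> f * h \<in> signs"
proof -
  assume fh: "f \<in> signs" "h \<in> signs"
  obtain s where s: "\<forall>c\<in>F\<^sub>0. s c = 1 \<or> s c = -1" "f = fc F\<^sub>0 s"
    by (rule signs_cases[OF fh(1)])
  obtain t where t: "\<forall>c\<in>F\<^sub>0. t c = 1 \<or> t c = -1" "h = fc F\<^sub>0 t"
    by (rule signs_cases[OF fh(2)])
  have "s c * t c = 1 \<or> s c * t c = -1" if "c \<in> F\<^sub>0" for c
    using bspec[OF s(1) that] bspec[OF t(1) that] by (elim disjE) simp_all
  then have "\<forall>c\<in>F\<^sub>0. s c * t c = 1 \<or> s c * t c = -1" by blast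
  then show ?thesis
    unfolding signs_iff s(2) t(2) fc_mult[OF frame_F0]
    by (intro exI[of _ "\<lambda>c. s c * t c"] conjI refl)
qed

lemma signs_sym: "f \<in> signs \<Longrightarrow> \<sigma> f = f"
  by (rule J_sym[OF signs_J])

lemma signs_unit: "f \<in> signs \<Longrightarrow> f \<in> carrier alg_units"
  by (rule unitI[OF signs_square signs_square])

lemma signs_ainv: "f \<in> signs \<Longrightarrow> ainv f = f"
  by (rule ainv_unique[OF signs_square signs_square])

lemma exp_conjugate:
  fixes b f :: 'a
  assumes "f * f = 1"
  shows "f * exp b * f = exp (f * b * f)"
proof -
  have p: "f * b ^ n * f = (f * b * f) ^ n" for n
  proof (induction n)
    case (Suc n)
    have "f * b ^ Suc n * f = (f * b * f) * (f * b ^ n * f)"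
      using assms by (simp add: mult.assoc) (simp add: mult.assoc[symmetric])
    then show ?case using Suc by simp
  qed (simp add: assms)
  have "bounded_linear (\<lambda>x. f * x * f)"
    by (intro linear_imp_bounded linearI) (simp_all add: distrib_left distrib_right)
  then have "(\<lambda>n. f * (b ^ n /\<^sub>R fact n) * f) sums (f * exp b * f)"
    by (rule bounded_linear.sums) (rule exp_converges)
  then have "(\<lambda>n. (f * b * f) ^ n /\<^sub>R fact n) sums (f * exp b * f)" by (simp add: p)
  then show ?thesis by (rule sums_unique2[OF _ exp_converges])
qed

text \<open>Split \<open>b\<close> into its symmetric part \<open>s\<close> and its skew part \<open>k\<close>. The element \<open>f s f\<close> lies in \<open>J\<close>. The
commutator \<open>[f, k]\<close> is symmetric, so \<open>f k f = [f, k] f + k\<close> lies in \<open>B\<close> because \<open>B\<close> is of Jordan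
type.\<close>

lemma symmetry_conjugates_B:
  assumes f: "f \<in> J" "f * f = 1" and b: "b \<in> B"
  shows "f * b * f \<in> B"
proof -
  define s k where "s = (1/2) *\<^sub>R (b + \<sigma> b)" and "k = (1/2) *\<^sub>R (b - \<sigma> b)"
  have bsk: "b = s + k" by (simp add: s_def k_def algebra_simps flip: scaleR_add_left)
  have sJ: "s \<in> J" and kB: "k \<in> B" and \<sigma>k: "\<sigma> k = - k"
    using b subspace_add[OF subspace_B] subspace_diff[OF subspace_B] subspace_scale[OF subspace_B] \<sigma>_B
    by (simp_all add: s_def k_def J_iff \<sigma>_scale \<sigma>_add \<sigma>_diff \<sigma>_\<sigma> add.commute flip: scaleR_minus_right)
  have "\<sigma> (f * k - k * f) = f * k - k * f" by (simp add: \<sigma>_diff \<sigma>_mult \<sigma>k J_sym[OF f(1)])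
  then have "f * k - k * f \<in> J" using bracket_B[OF J_B[OF f(1)] kB] by (simp add: J_iff)
  then have "(f * k - k * f) * f \<in> B" by (rule J_mult_B[OF _ f(1)])
  moreover have "f * k * f = (f * k - k * f) * f + k"
    by (simp add: left_diff_distrib mult.assoc f(2))
  ultimately have "f * k * f \<in> B" using kB by (simp only: subspace_add[OF subspace_B])
  moreover have "f * s * f \<in> B" by (rule J_B[OF quadratic_J[OF f(1) sJ]])
  ultimately show ?thesis
    unfolding bsk distrib_left distrib_right by (simp only: subspace_add[OF subspace_B])
qed

lemma symmetry_conjugates_G0:
  assumes f: "f \<in> J" "f * f = 1" and g: "g \<in> G\<^sub>0"
  shows "f * g * f \<in> G\<^sub>0"
proof -
  let ?N = "G\<^sub>0 \<inter> (\<lambda>g. f * g * f) -` G\<^sub>0"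
  have fU: "f \<in> carrier alg_units" by (rule unitI[OF f(2) f(2)])
  have "?N = G\<^sub>0"
  proof (rule G0_eqI)
    show "exp b \<in> ?N" if "b \<in> B" for b
      using exp_B[OF that] exp_B[OF symmetry_conjugates_B[OF f that]] by (simp add: exp_conjugate[OF f(2)])
    show "x * y \<in> ?N" if "x \<in> ?N" "y \<in> ?N" for x y
    proof -
      have "(f * x * f) * (f * y * f) = f * x * (f * f) * y * f" by (simp only: mult.assoc)
      then have "(f * x * f) * (f * y * f) = f * (x * y) * f" by (simp add: f(2) mult.assoc)
      moreover have "(f * x * f) * (f * y * f) \<in> G\<^sub>0" by (rule G0D(3)) (use that in auto)
      ultimately show ?thesis using that G0D(3) by simp
    qed
    show "closedin (top_of_set G\<^sub>0) ?N"
    proof (rule continuous_closedin_preimage_gen)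
      show "continuous_on G\<^sub>0 (\<lambda>g. f * g * f)" by (intro continuous_intros)
      show "(\<lambda>g. f * g * f) \<in> G\<^sub>0 \<rightarrow> carrier alg_units"
        using fU G0D(1) by (auto intro!: unit_mult)
      show "closedin (top_of_set (carrier alg_units)) G\<^sub>0"
        using lie_G0 by (simp add: lie_subgroup_def)
    qed
  qed simp
  then show ?thesis using g by blast
qed

lemma symmetry_conjugates_posdef:
  assumes f: "f \<in> J" "f * f = 1" and p: "p \<in> posdef"
  shows "f * p * f \<in> posdef"
proof -
  obtain b where b: "b \<in> J" "p = exp b" using posdef_exp[OF p] by blast
  show ?thesis unfolding b(2) exp_conjugate[OF f(2)] by (rule exp_posdef[OF quadratic_J[OF f(1) b(1)]])
qed

subsection \<open>The minimal extension\<close>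

definition G :: "'a set" where "G = minimal_extension \<sigma> G\<^sub>0 B"

lemma O_G0: "u \<in> orthogonal_group G\<^sub>0 \<sigma> \<longleftrightarrow> u \<in> G\<^sub>0 \<and> u * \<sigma> u = 1"
proof -
  have "\<sigma> u * u = 1 \<longleftrightarrow> u * \<sigma> u = 1" if "u \<in> G\<^sub>0"
    using ainv[OF G0D(1)[OF that]] by (metis mult.assoc mult_1_left mult_1_right)
  then show ?thesis by (auto simp: orthogonal_group_def)
qed

lemma subgroup_G0_signs: "subgroup {g * f |g f. g \<in> G\<^sub>0 \<and> f \<in> signs} alg_units" (is "subgroup ?G _")
proof
  show "?G \<subseteq> carrier alg_units" using G0D(1) signs_unit unit_mult by blast
  have "1 * 1 \<in> ?G" using G0D(2) one_signs by blast
  then show "\<one>\<^bsub>alg_units\<^esub> \<in> ?G" by simp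
  show "x \<otimes>\<^bsub>alg_units\<^esub> y \<in> ?G" if xy: "x \<in> ?G" "y \<in> ?G" for x y
  proof -
    obtain g f g' f' where *: "x = g * f" "y = g' * f'" "g \<in> G\<^sub>0" "g' \<in> G\<^sub>0" "f \<in> signs" "f' \<in> signs"
      using xy by blast
    have "(g * (f * g' * f)) * (f * f') = g * f * g' * (f * f) * f'" by (simp only: mult.assoc)
    then have "x * y = (g * (f * g' * f)) * (f * f')" by (simp add: * signs_square mult.assoc)
    moreover have "f * g' * f \<in> G\<^sub>0" using * by (intro symmetry_conjugates_G0 signs_J signs_square)
    ultimately show ?thesis using G0D(3)[OF *(3)] signs_mult[OF *(5,6)] by auto
  qed
  show "ainv x \<in> ?G" if x: "x \<in> ?G" for x
  proof -
    obtain g f where *: "x = g * f" "g \<in> G\<^sub>0" "f \<in> signs" using x by blast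
    have "ainv x = f * ainv g" using * by (simp add: ainv_mult G0D(1) signs_unit signs_ainv)
    also have "\<dots> = (f * ainv g * f) * f" using * by (simp add: mult.assoc signs_square)
    finally show ?thesis
      using *(3) symmetry_conjugates_G0[OF signs_J[OF *(3)] signs_square[OF *(3)] G0D(4)[OF *(2)]] by blast
  qed
qed

text \<open>By conjugacy of frames, \<open>x = u y ainv u\<close> with \<open>u\<close> orthogonal and \<open>y\<close> a combination of the reference
frame, and \<open>y\<close> is the product of its absolute value, which is positive definite and hence in
\<open>G\<^sub>0\<close>, and its sign \<open>f\<close>. The remaining factor \<open>ainv u\<close> is moved to the left of \<open>f\<close> by
conjugation.\<close>

lemma J_units_decompose:
  assumes x: "x \<in> J" "x \<in> carrier alg_units"
  shows "\<exists>g f. x = g * f \<and> g \<in> G\<^sub>0 \<and> f \<in> signs"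
proof -
  obtain C l where C: "frame C" "x = fc C l" "\<And>c. c \<in> C \<Longrightarrow> l c \<noteq> 0"
    by (rule inverse_J[OF x(1) ainv(1,2)[OF x(2)]]) blast
  obtain u where u: "u \<in> orthogonal_group G\<^sub>0 \<sigma>" "(\<lambda>c. u * c * ainv u) ` F\<^sub>0 = C"
    using frames_conjugate[OF frame_F0 C(1)] by blast
  have uG: "u \<in> G\<^sub>0" using u(1) O_G0 by blast
  note uU = ainv[OF G0D(1)[OF uG]]
  define m where "m c = l (u * c * ainv u)" for c
  have m0: "m c \<noteq> 0" if "c \<in> F\<^sub>0" for c using that C(3) u(2) unfolding m_def by blast
  have inj: "inj_on (\<lambda>c. u * c * ainv u) F\<^sub>0"
  proof (rule inj_onI)
    fix c d assume "u * c * ainv u = u * d * ainv u"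
    then have "ainv u * (u * c * ainv u) * u = ainv u * (u * d * ainv u) * u" by simp
    moreover have "ainv u * (u * c * ainv u) * u = (ainv u * u) * c * (ainv u * u)" for c
      by (simp only: mult.assoc)
    ultimately show "c = d" by (simp add: uU)
  qed
  have "x = (\<Sum>c\<in>F\<^sub>0. m c *\<^sub>R (u * c * ainv u))"
    unfolding C(2) fc_def u(2)[symmetric] sum.reindex[OF inj] by (simp add: m_def)
  also have "\<dots> = u * fc F\<^sub>0 m * ainv u"
    by (simp add: fc_def sum_distrib_left sum_distrib_right)
  finally have xu: "x = u * fc F\<^sub>0 m * ainv u" .
  define p where "p = fc F\<^sub>0 (\<lambda>c. \<bar>m c\<bar>)"
  define f where "f = fc F\<^sub>0 (\<lambda>c. sgn (m c))"
  have "fc F\<^sub>0 m = p * f"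
    unfolding p_def f_def fc_mult[OF frame_F0] by (intro fc_cong) (simp add: sgn_if)
  have f: "f \<in> signs" unfolding signs_iff f_def
    by (rule exI[of _ "\<lambda>c. sgn (m c)"]) (use m0 in \<open>auto simp: sgn_if\<close>)
  have "p \<in> posdef" unfolding p_def fc_posdef_iff[OF frame_F0] using m0 by auto
  then have pG: "p \<in> G\<^sub>0" by (rule posdef_G0)
  have "x = (u * p * (f * ainv u * f)) * f"
    unfolding xu \<open>fc F\<^sub>0 m = p * f\<close> using signs_square[OF f] by (simp add: mult.assoc)
  moreover have "u * p * (f * ainv u * f) \<in> G\<^sub>0"
    by (intro G0D(3) uG pG symmetry_conjugates_G0 signs_J signs_square f G0D(4))
  ultimately show ?thesis using f by blast
qed

lemma G_eq: "G = {g * f |g f. g \<in> G\<^sub>0 \<and> f \<in> signs}" (is "_ = ?G")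
proof
  have *: "g * 1 \<in> ?G" if "g \<in> G\<^sub>0" for g using that one_signs by blast
  show "G \<subseteq> ?G"
    unfolding G_def minimal_extension_def
  proof (rule group.generate_subgroup_incl[OF group_alg_units _ subgroup_G0_signs])
    have "x \<in> ?G" if "x \<in> G\<^sub>0" for x using *[OF that] by (simp only: mult_1_right)
    moreover have "x \<in> ?G" if "x \<in> J" "x \<in> carrier alg_units" for x
      using J_units_decompose[OF that] by blast
    ultimately show "G\<^sub>0 \<union> sym_part \<sigma> B \<inter> carrier alg_units \<subseteq> ?G"
      unfolding J_def[symmetric] by blast
  qed
  show "?G \<subseteq> G"
  proof
    fix x assume "x \<in> ?G"
    then obtain g f where *: "x = g * f" "g \<in> G\<^sub>0" "f \<in> signs" by blast
    have "g \<in> G\<^sub>0 \<union> (J \<inter> carrier alg_units)" "f \<in> G\<^sub>0 \<union> (J \<inter> carrier alg_units)"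
      using *(2) signs_J[OF *(3)] signs_unit[OF *(3)] by blast+
    then have "g \<otimes>\<^bsub>alg_units\<^esub> f \<in> G"
      unfolding G_def minimal_extension_def J_def by (intro generate.eng generate.incl)
    then show "x \<in> G" by (simp add: *(1))
  qed
qed

lemma subgroup_G: "subgroup G alg_units"
  unfolding G_eq by (rule subgroup_G0_signs)

text \<open>A finite union of translates of the relatively closed set \<open>G\<^sub>0\<close> is relatively closed.\<close>

lemma lie_G: "lie_subgroup G alg_units"
proof -
  let ?U = "carrier (alg_units :: 'a monoid)"
  have "closedin (top_of_set ?U) (?U \<inter> (\<lambda>x. x * f) -` G\<^sub>0)" if f: "f \<in> signs" for f
  proof (rule continuous_closedin_preimage_gen)
    show "continuous_on ?U (\<lambda>x. x * f)" by (intro continuous_intros)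
    show "(\<lambda>x. x * f) \<in> ?U \<rightarrow> ?U" using unit_mult signs_unit[OF f] by auto
    show "closedin (top_of_set ?U) G\<^sub>0" using lie_G0 by (simp add: lie_subgroup_def)
  qed
  then have "closedin (top_of_set ?U) (\<Union>f\<in>signs. ?U \<inter> (\<lambda>x. x * f) -` G\<^sub>0)"
    using finite_signs by (intro closedin_Union) auto
  moreover have "(\<Union>f\<in>signs. ?U \<inter> (\<lambda>x. x * f) -` G\<^sub>0) = G"
  proof (intro equalityI subsetI)
    fix x assume "x \<in> (\<Union>f\<in>signs. ?U \<inter> (\<lambda>x. x * f) -` G\<^sub>0)"
    then obtain f where f: "f \<in> signs" "x * f \<in> G\<^sub>0" by blast
    moreover have "x = (x * f) * f" using signs_square[OF f(1)] by (simp add: mult.assoc)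
    ultimately show "x \<in> G" unfolding G_eq by blast
  next
    fix x assume "x \<in> G"
    then obtain g f where *: "x = g * f" "g \<in> G\<^sub>0" "f \<in> signs" unfolding G_eq by blast
    then have "x * f \<in> G\<^sub>0" by (simp add: mult.assoc signs_square)
    moreover have "x \<in> ?U" using * G0D(1) signs_unit unit_mult by blast
    ultimately show "x \<in> (\<Union>f\<in>signs. ?U \<inter> (\<lambda>x. x * f) -` G\<^sub>0)" using *(3) by blast
  qed
  ultimately show ?thesis using subgroup_G by (simp add: lie_subgroup_def)
qed

lemmas GD = lie_subgroupD[OF lie_G]

lemma G_cases: assumes "x \<in> G" obtains g f where "x = g * f" "g \<in> G\<^sub>0" "f \<in> signs"
  using assms unfolding G_eq by blast

lemma G_I: "g \<in> G\<^sub>0 \<Longrightarrow> f \<in> signs \<Longrightarrow> g * f \<in> G"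
  unfolding G_eq by blast

lemma G0_G: "g \<in> G\<^sub>0 \<Longrightarrow> g \<in> G"
  using G_I[OF _ one_signs] by (simp only: mult_1_right)

lemma posdef_G: "p \<in> posdef \<Longrightarrow> p \<in> G"
  by (rule G0_G[OF posdef_G0])

lemma J_units_G: "x \<in> J \<Longrightarrow> x \<in> carrier alg_units \<Longrightarrow> x \<in> G"
  unfolding G_eq using J_units_decompose by blast

lemma \<sigma>_G: "x \<in> G \<Longrightarrow> \<sigma> x \<in> G"
proof -
  assume "x \<in> G"
  then obtain g f where *: "x = g * f" "g \<in> G\<^sub>0" "f \<in> signs" by (rule G_cases)
  have "\<sigma> x = (f * \<sigma> g * f) * f"
    using * by (simp add: \<sigma>_mult signs_sym signs_square mult.assoc)
  then show ?thesis
    unfolding G_eq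
    using *(3) symmetry_conjugates_G0[OF signs_J[OF *(3)] signs_square[OF *(3)] \<sigma>_G0[OF *(2)]] by blast
qed

lemma G_act_J: "g \<in> G \<Longrightarrow> x \<in> J \<Longrightarrow> g * x * \<sigma> g \<in> J"
  and G_act_posdef: "g \<in> G \<Longrightarrow> p \<in> posdef \<Longrightarrow> g * p * \<sigma> g \<in> posdef"
proof -
  assume "g \<in> G"
  then obtain h f where *: "g = h * f" "h \<in> G\<^sub>0" "f \<in> signs" by (rule G_cases)
  have eq: "g * x * \<sigma> g = h * (f * x * f) * \<sigma> h" for x
    using * by (simp add: \<sigma>_mult signs_sym mult.assoc)
  show "x \<in> J \<Longrightarrow> g * x * \<sigma> g \<in> J"
    unfolding eq by (intro G0_act_J[OF *(2)] quadratic_J signs_J[OF *(3)])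
  show "p \<in> posdef \<Longrightarrow> g * p * \<sigma> g \<in> posdef"
    unfolding eq by (intro G0_act_posdef[OF *(2)] symmetry_conjugates_posdef signs_J[OF *(3)] signs_square[OF *(3)])
qed

text \<open>The stabilizer of 1 in \<open>G\<close>; the symmetries \<open>signs\<close> belong to it, so it is a finite union of translates
of the orthogonal group of \<open>G\<^sub>0\<close>.\<close>

definition K :: "'a set" where "K = {g \<in> G. g * \<sigma> g = 1}"

lemma compact_K: "compact K"
proof -
  have "K = (\<Union>f\<in>signs. (\<lambda>u. u * f) ` orthogonal_group G\<^sub>0 \<sigma>)"
  proof (intro equalityI subsetI)
    fix x assume x: "x \<in> K"
    then have xG: "x \<in> G" and x1: "x * \<sigma> x = 1" by (simp_all add: K_def)
    obtain g f where *: "x = g * f" "g \<in> G\<^sub>0" "f \<in> signs" by (rule G_cases[OF xG])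
    have "x * \<sigma> x = g * (f * f) * \<sigma> g"
      by (simp only: *(1) \<sigma>_mult signs_sym[OF *(3)] mult.assoc)
    then have "g * \<sigma> g = 1" by (simp only: x1 signs_square[OF *(3)] mult_1_right)
    then have "g \<in> orthogonal_group G\<^sub>0 \<sigma>" using *(2) by (simp only: O_G0)
    then have "x \<in> (\<lambda>u. u * f) ` orthogonal_group G\<^sub>0 \<sigma>" by (rule image_eqI[where f = "\<lambda>u. u * f", OF *(1)])
    then show "x \<in> (\<Union>f\<in>signs. (\<lambda>u. u * f) ` orthogonal_group G\<^sub>0 \<sigma>)"
      by (rule UN_I[OF *(3)])
  next
    fix x assume "x \<in> (\<Union>f\<in>signs. (\<lambda>u. u * f) ` orthogonal_group G\<^sub>0 \<sigma>)"
    then obtain f u where fu: "f \<in> signs" "x = u * f" "u \<in> orthogonal_group G\<^sub>0 \<sigma>"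
      by (elim UN_E imageE)
    then have *: "f \<in> signs" "x = u * f" "u \<in> G\<^sub>0" "u * \<sigma> u = 1" by (simp_all only: O_G0)
    have "x * \<sigma> x = u * (f * f) * \<sigma> u"
      by (simp only: *(2) \<sigma>_mult signs_sym[OF *(1)] mult.assoc)
    then have "x * \<sigma> x = 1" by (simp only: signs_square[OF *(1)] *(4) mult_1_right)
    moreover have "x \<in> G" unfolding *(2) by (rule G_I[OF *(3,1)])
    ultimately show "x \<in> K" by (simp only: K_def mem_Collect_eq simp_thms)
  qed
  then show ?thesis
    by (simp only:) (intro compact_UN finite_signs compact_continuous_image compact_O continuous_intros)
qed

end

section \<open>A criterion for models of symmetric spaces\<close>

lemma topspace_coset_space: "topspace (coset_space L K) = (\<lambda>h. h <#\<^bsub>L\<^esub> K) ` carrier L"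
proof
  let ?Q = "coset_space L K" and ?p = "\<lambda>h. h <#\<^bsub>L\<^esub> K"
  show "topspace ?Q \<subseteq> ?p ` carrier L"
    using openin_topspace[of ?Q] unfolding coset_space_def openin_quotient_topology by simp
  have "{x \<in> topspace (top_of_set (carrier L)). ?p x \<in> ?p ` carrier L} = topspace (top_of_set (carrier L))"
    by auto
  then have "openin ?Q (?p ` carrier L)"
    unfolding coset_space_def openin_quotient_topology by (simp only: openin_topspace) simp
  then show "?p ` carrier L \<subseteq> topspace ?Q" by (rule openin_subset)
qed

lemma openin_coset_space:
  "openin (coset_space L K) V \<longleftrightarrow> V \<subseteq> (\<lambda>h. h <#\<^bsub>L\<^esub> K) ` carrier L \<and>
     openin (top_of_set (carrier L)) {h \<in> carrier L. h <#\<^bsub>L\<^esub> K \<in> V}"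
  unfolding coset_space_def openin_quotient_topology by simp

text \<open>The continuous section \<open>q\<close> makes the induced bijection from cosets to \<open>X\<close> open, since the image of a
set of cosets is the preimage under \<open>q\<close> of its union. An element \<open>k\<close> of a subgroup \<open>K\<close> that contains
the stabilizer differs from \<open>q (k x0)\<close> by an element of the stabilizer, so \<open>q (k x0)\<close> lies in \<open>K\<close>;
therefore the last assumption suffices for the maximality of the stabilizer.\<close>

theorem symmetric_space_modelI:
  fixes U :: "'g::topological_space monoid" and f :: "'g \<Rightarrow> 'x::topological_space \<Rightarrow> 'x"
  defines "L H \<equiv> U\<lparr>carrier := H\<rparr>"
  assumes U: "group U" and H: "lie_subgroup H U"
    and closed: "\<And>h x. h \<in> H \<Longrightarrow> x \<in> X \<Longrightarrow> f h x \<in> X"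
    and mult: "\<And>g h x. g \<in> H \<Longrightarrow> h \<in> H \<Longrightarrow> x \<in> X \<Longrightarrow> f (g \<otimes>\<^bsub>U\<^esub> h) x = f g (f h x)"
    and one: "\<And>x. x \<in> X \<Longrightarrow> f \<one>\<^bsub>U\<^esub> x = x"
    and cont: "continuous_on (H \<times> X) (\<lambda>(h, x). f h x)"
    and x0: "x0 \<in> X"
    and q: "continuous_on X q" "\<And>x. x \<in> X \<Longrightarrow> q x \<in> H" "\<And>x. x \<in> X \<Longrightarrow> f (q x) x0 = x"
    and compact: "compact {h \<in> H. f h x0 = x0}"
    and maximal: "\<And>K x. subgroup K (L H) \<Longrightarrow> compact K \<Longrightarrow> x \<in> X \<Longrightarrow> q x \<in> K \<Longrightarrow> x = x0"
  shows "symmetric_space_model U H X (\<lambda>h. \<lambda>x\<in>X. f h x)"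
proof -
  define M where "M = U\<lparr>carrier := H\<rparr>"
  define \<alpha> where "\<alpha> = (\<lambda>h. \<lambda>x\<in>X. f h x)"
  define K where "K = {h \<in> H. f h x0 = x0}"
  have sub: "subgroup H U" using H by (simp add: lie_subgroup_def)
  have M: "carrier M = H" "\<And>g h. g \<otimes>\<^bsub>M\<^esub> h = g \<otimes>\<^bsub>U\<^esub> h" "\<one>\<^bsub>M\<^esub> = \<one>\<^bsub>U\<^esub>" by (simp_all add: M_def)
  interpret M: group M unfolding M_def by (rule subgroup.subgroup_is_group[OF sub U])
  have \<alpha>: "\<alpha> h x = f h x" if "x \<in> X" for h x using that by (simp add: \<alpha>_def)
  have inverse: "f (inv\<^bsub>M\<^esub> h) (f h x) = x" "f h (f (inv\<^bsub>M\<^esub> h) x) = x" "inv\<^bsub>M\<^esub> h \<in> H"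
    if h: "h \<in> H" and x: "x \<in> X" for h x
  proof -
    show i: "inv\<^bsub>M\<^esub> h \<in> H" using M.inv_closed[of h] h by (simp add: M)
    have "inv\<^bsub>M\<^esub> h \<otimes>\<^bsub>U\<^esub> h = \<one>\<^bsub>U\<^esub>" "h \<otimes>\<^bsub>U\<^esub> inv\<^bsub>M\<^esub> h = \<one>\<^bsub>U\<^esub>"
      using M.l_inv[of h] M.r_inv[of h] h by (simp_all add: M)
    then show "f (inv\<^bsub>M\<^esub> h) (f h x) = x" "f h (f (inv\<^bsub>M\<^esub> h) x) = x"
      using mult[OF i h x] mult[OF h i x] one[OF x] by simp_all
  qed
  have Bij: "\<alpha> h \<in> Bij X" if h: "h \<in> H" for h
  proof -
    have "bij_betw (\<alpha> h) X X"
      by (rule bij_betw_byWitness[of _ "f (inv\<^bsub>M\<^esub> h)"])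
         (use h inverse closed in \<open>auto simp: \<alpha>\<close>)
    then show ?thesis by (simp add: Bij_def \<alpha>_def)
  qed
  have "\<alpha> \<in> hom M (BijGroup X)"
  proof (rule homI)
    show "\<alpha> h \<in> carrier (BijGroup X)" if "h \<in> carrier M" for h
      using that Bij by (simp add: BijGroup_def M)
    show "\<alpha> (g \<otimes>\<^bsub>M\<^esub> h) = \<alpha> g \<otimes>\<^bsub>BijGroup X\<^esub> \<alpha> h" if "g \<in> carrier M" "h \<in> carrier M" for g h
    proof
      fix x
      show "\<alpha> (g \<otimes>\<^bsub>M\<^esub> h) x = (\<alpha> g \<otimes>\<^bsub>BijGroup X\<^esub> \<alpha> h) x"
        using that by (simp add: BijGroup_def Bij M compose_def) (simp add: \<alpha>_def mult closed)
    qed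
  qed
  then interpret A: group_action M X \<alpha>
    by (intro group_action.intro group_hom.intro M.group_axioms group_BijGroup group_hom_axioms.intro)
  have trans: "transitive_action M X \<alpha>"
  proof (intro transitive_action.intro A.group_action_axioms transitive_action_axioms.intro)
    fix x y assume x: "x \<in> X" and y: "y \<in> X"
    note i = inverse(3)[OF q(2)[OF x] x0]
    have "f (inv\<^bsub>M\<^esub> (q x)) x = x0" using inverse(1)[OF q(2)[OF x] x0] by (simp add: q(3)[OF x])
    then have "f (q y \<otimes>\<^bsub>U\<^esub> inv\<^bsub>M\<^esub> (q x)) x = y"
      using mult[OF q(2)[OF y] i x] by (simp add: q(3)[OF y])
    moreover have "q y \<otimes>\<^bsub>U\<^esub> inv\<^bsub>M\<^esub> (q x) \<in> H" by (rule subgroup.m_closed[OF sub q(2)[OF y] i])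
    ultimately show "\<exists>g\<in>carrier M. \<alpha> g x = y" using \<alpha>[OF x] by (intro bexI) (simp_all add: M)
  qed
  have stab: "stabilizer M \<alpha> x0 = K"
    unfolding stabilizer_def K_def by (simp add: M \<alpha>[OF x0])
  have subK: "subgroup K M" using A.stabilizer_subgroup[OF x0] by (simp only: stab)
  have KH: "K \<subseteq> H" by (auto simp: K_def)
  have max: "maximal_compact_subgroup K M"
    unfolding maximal_compact_subgroup_def
  proof (intro conjI allI impI)
    show "compact K" using compact by (simp only: K_def)
    fix K' assume K': "subgroup K' M \<and> compact K' \<and> K \<subseteq> K'"
    then have sK': "subgroup K' M" by blast
    have "k \<in> K" if k: "k \<in> K'" for k
    proof -
      have kH: "k \<in> H" using subgroup.mem_carrier[OF sK' k] by (simp add: M)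
      define x where "x = f k x0"
      have x: "x \<in> X" unfolding x_def by (rule closed[OF kH x0])
      note i = inverse(3)[OF q(2)[OF x] x0]
      have iM: "inv\<^bsub>M\<^esub> (q x) \<otimes>\<^bsub>M\<^esub> k \<in> H" using subgroup.m_closed[OF sub i kH] by (simp add: M)
      have "f (inv\<^bsub>M\<^esub> (q x) \<otimes>\<^bsub>M\<^esub> k) x0 = x0"
        using mult[OF i kH x0] inverse(1)[OF q(2)[OF x] x0] by (simp add: M q(3)[OF x] x_def[symmetric])
      then have "inv\<^bsub>M\<^esub> (q x) \<otimes>\<^bsub>M\<^esub> k \<in> K'" using K' iM by (auto simp: K_def)
      then have "k \<otimes>\<^bsub>M\<^esub> inv\<^bsub>M\<^esub> (inv\<^bsub>M\<^esub> (q x) \<otimes>\<^bsub>M\<^esub> k) \<in> K'"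
        by (rule subgroup.m_closed[OF sK' k subgroup.m_inv_closed[OF sK']])
      moreover have "k \<otimes>\<^bsub>M\<^esub> inv\<^bsub>M\<^esub> (inv\<^bsub>M\<^esub> (q x) \<otimes>\<^bsub>M\<^esub> k) = q x"
      proof -
        have c: "k \<in> carrier M" "q x \<in> carrier M" using kH q(2)[OF x] by (simp_all add: M)
        then show ?thesis by (simp add: M.inv_mult_group M.m_assoc[symmetric])
      qed
      ultimately have "q x \<in> K'" by (simp only:)
      then have "x = x0" using maximal[of K' x] K' x by (simp add: L_def M_def)
      then show "k \<in> K" using kH by (simp add: K_def x_def)
    qed
    then show "K' = K" using K' by blast
  qed (rule subK)
  define \<phi> where "\<phi> C = f (SOME h. h \<in> H \<and> C = h <#\<^bsub>M\<^esub> K) x0" for C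
  have coset_eq: "f g x0 = f h x0" if "g \<in> H" "h \<in> H" "g <#\<^bsub>M\<^esub> K = h <#\<^bsub>M\<^esub> K" for g h
  proof -
    have "\<one>\<^bsub>M\<^esub> \<in> K" by (rule subgroup.one_closed[OF subK])
    then have "g \<otimes>\<^bsub>M\<^esub> \<one>\<^bsub>M\<^esub> \<in> g <#\<^bsub>M\<^esub> K" by (auto simp: l_coset_def)
    then have "g \<in> h <#\<^bsub>M\<^esub> K" using that M.r_one[of g] by (simp add: M(1))
    then obtain k where k: "k \<in> K" "g = h \<otimes>\<^bsub>U\<^esub> k" by (auto simp: l_coset_def M)
    then show ?thesis using mult[OF that(2) _ x0, of k] by (simp add: K_def)
  qed
  have \<phi>: "\<phi> (h <#\<^bsub>M\<^esub> K) = f h x0" if h: "h \<in> H" for h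
  proof -
    have "(SOME g. g \<in> H \<and> h <#\<^bsub>M\<^esub> K = g <#\<^bsub>M\<^esub> K) \<in> H \<and>
        h <#\<^bsub>M\<^esub> K = (SOME g. g \<in> H \<and> h <#\<^bsub>M\<^esub> K = g <#\<^bsub>M\<^esub> K) <#\<^bsub>M\<^esub> K"
      by (rule someI[of "\<lambda>g. g \<in> H \<and> h <#\<^bsub>M\<^esub> K = g <#\<^bsub>M\<^esub> K" h]) (simp add: h)
    then show ?thesis unfolding \<phi>_def using coset_eq[OF h] by metis
  qed
  have coset_eqI: "g <#\<^bsub>M\<^esub> K = h <#\<^bsub>M\<^esub> K" if gh: "g \<in> H" "h \<in> H" "f g x0 = f h x0" for g h
  proof -
    have "f (inv\<^bsub>M\<^esub> g \<otimes>\<^bsub>U\<^esub> h) x0 = x0"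
      using mult[OF inverse(3)[OF gh(1) x0] gh(2) x0] inverse(1)[OF gh(1) x0] gh(3) by simp
    then have k: "inv\<^bsub>M\<^esub> g \<otimes>\<^bsub>M\<^esub> h \<in> K"
      using subgroup.m_closed[OF sub inverse(3)[OF gh(1) x0] gh(2)] by (simp add: K_def M)
    have c: "g \<in> carrier M" "h \<in> carrier M" "K \<subseteq> carrier M" using gh KH by (simp_all add: M)
    have "h <#\<^bsub>M\<^esub> K = (g \<otimes>\<^bsub>M\<^esub> (inv\<^bsub>M\<^esub> g \<otimes>\<^bsub>M\<^esub> h)) <#\<^bsub>M\<^esub> K"
      using c by (simp add: M.m_assoc[symmetric])
    also have "\<dots> = g <#\<^bsub>M\<^esub> ((inv\<^bsub>M\<^esub> g \<otimes>\<^bsub>M\<^esub> h) <#\<^bsub>M\<^esub> K)"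
      using c by (simp add: M.lcos_m_assoc)
    also have "(inv\<^bsub>M\<^esub> g \<otimes>\<^bsub>M\<^esub> h) <#\<^bsub>M\<^esub> K = K"
      using M.coset_join3[OF _ subK k] c by simp
    finally show ?thesis by simp
  qed
  have top: "topspace (coset_space M K) = (\<lambda>h. h <#\<^bsub>M\<^esub> K) ` H"
    by (simp add: topspace_coset_space M)
  have orbit: "continuous_on H (\<lambda>h. f h x0)"
  proof -
    have "continuous_on H (\<lambda>h. case (h, x0) of (h, x) \<Rightarrow> f h x)"
      by (rule continuous_on_compose2[OF cont]) (use x0 in \<open>auto intro!: continuous_intros\<close>)
    then show ?thesis by simp
  qed
  have homeo: "homeomorphic_map (coset_space M K) (top_of_set X) \<phi>"
  proof (rule bijective_open_imp_homeomorphic_map)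
    show "continuous_map (coset_space M K) (top_of_set X) \<phi>"
      unfolding continuous_map_def
    proof (intro conjI allI impI)
      show "\<phi> \<in> topspace (coset_space M K) \<rightarrow> topspace (top_of_set X)"
        using \<phi> closed x0 by (auto simp: top)
      fix V assume V: "openin (top_of_set X) V"
      have "{h \<in> H. h <#\<^bsub>M\<^esub> K \<in> {C \<in> topspace (coset_space M K). \<phi> C \<in> V}} = H \<inter> (\<lambda>h. f h x0) -` V"
        using \<phi> by (auto simp: top)
      moreover have "openin (top_of_set H) (H \<inter> (\<lambda>h. f h x0) -` V)"
        by (rule continuous_openin_preimage[OF orbit _ V]) (use closed x0 in auto)
      ultimately show "openin (coset_space M K) {C \<in> topspace (coset_space M K). \<phi> C \<in> V}"
        unfolding openin_coset_space M by (simp only:) (auto simp: top)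
    qed
    show "open_map (coset_space M K) (top_of_set X) \<phi>"
      unfolding open_map_def
    proof (intro allI impI)
      fix W assume W: "openin (coset_space M K) W"
      then have WH: "W \<subseteq> (\<lambda>h. h <#\<^bsub>M\<^esub> K) ` H" "openin (top_of_set H) {h \<in> H. h <#\<^bsub>M\<^esub> K \<in> W}"
        unfolding openin_coset_space M by blast+
      have "\<phi> ` W = X \<inter> q -` {h \<in> H. h <#\<^bsub>M\<^esub> K \<in> W}"
      proof (intro equalityI subsetI)
        fix y assume "y \<in> \<phi> ` W"
        then obtain h where h: "h \<in> H" "h <#\<^bsub>M\<^esub> K \<in> W" "y = f h x0" using WH(1) \<phi> by blast
        have y: "y \<in> X" unfolding h(3) by (rule closed[OF h(1) x0])
        have "q y <#\<^bsub>M\<^esub> K = h <#\<^bsub>M\<^esub> K"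
          by (rule coset_eqI[OF q(2)[OF y] h(1)]) (simp add: q(3)[OF y] h(3)[symmetric])
        then show "y \<in> X \<inter> q -` {h \<in> H. h <#\<^bsub>M\<^esub> K \<in> W}" using h(2) y q(2)[OF y] by simp
      next
        fix y assume "y \<in> X \<inter> q -` {h \<in> H. h <#\<^bsub>M\<^esub> K \<in> W}"
        then have y: "y \<in> X" "q y <#\<^bsub>M\<^esub> K \<in> W" by auto
        then show "y \<in> \<phi> ` W" using \<phi>[OF q(2)[OF y(1)]] q(3)[OF y(1)] by (intro image_eqI) simp_all
      qed
      moreover have "openin (top_of_set X) (X \<inter> q -` {h \<in> H. h <#\<^bsub>M\<^esub> K \<in> W})"
        by (rule continuous_openin_preimage[OF q(1) _ WH(2)]) (use q(2) in auto)
      ultimately show "openin (top_of_set X) (\<phi> ` W)" by (simp only:)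
    qed
    show "\<phi> ` topspace (coset_space M K) = topspace (top_of_set X)"
    proof
      show "\<phi> ` topspace (coset_space M K) \<subseteq> topspace (top_of_set X)"
        using \<phi> closed x0 by (auto simp: top)
      have "y \<in> \<phi> ` (\<lambda>h. h <#\<^bsub>M\<^esub> K) ` H" if "y \<in> X" for y
        by (rule image_eqI[OF _ imageI[OF q(2)[OF that]]]) (simp add: \<phi>[OF q(2)[OF that]] q(3)[OF that])
      then show "topspace (top_of_set X) \<subseteq> \<phi> ` topspace (coset_space M K)" by (auto simp: top)
    qed
    show "inj_on \<phi> (topspace (coset_space M K))"
      unfolding top
    proof (rule inj_onI, elim imageE)
      fix C D g h
      assume *: "\<phi> C = \<phi> D" "C = g <#\<^bsub>M\<^esub> K" "g \<in> H" "D = h <#\<^bsub>M\<^esub> K" "h \<in> H"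
      then have "f g x0 = f h x0" using \<phi>[OF *(3)] \<phi>[OF *(5)] by simp
      then show "C = D" unfolding *(2,4) by (rule coset_eqI[OF *(3,5)])
    qed
  qed
  have cont': "continuous_on (H \<times> X) (\<lambda>(h, x). \<alpha> h x)"
    using cont by (rule continuous_on_eq) (auto simp: \<alpha>)
  have equi: "\<forall>h\<in>H. \<forall>C\<in>topspace (coset_space M K). \<phi> (h <#\<^bsub>M\<^esub> C) = \<alpha> h (\<phi> C)"
    unfolding top
  proof clarify
    fix h g assume h: "h \<in> H" "g \<in> H"
    have "h <#\<^bsub>M\<^esub> (g <#\<^bsub>M\<^esub> K) = (h \<otimes>\<^bsub>U\<^esub> g) <#\<^bsub>M\<^esub> K"
      using M.lcos_m_assoc[of K h g] h KH by (simp add: M)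
    then show "\<phi> (h <#\<^bsub>M\<^esub> (g <#\<^bsub>M\<^esub> K)) = \<alpha> h (\<phi> (g <#\<^bsub>M\<^esub> K))"
      using h x0 by (simp add: \<phi> subgroup.m_closed[OF sub] mult \<alpha> closed)
  qed
  have orb: "\<forall>h\<in>H. \<phi> (h <#\<^bsub>M\<^esub> K) = \<alpha> h x0" using \<phi> \<alpha>[OF x0] by simp
  show ?thesis
    unfolding symmetric_space_model_def Let_def \<alpha>_def[symmetric] M_def[symmetric]
    by (intro conjI bexI[OF _ x0] exI[of _ \<phi>]; (unfold stab)?; fact)
qed

section \<open>The symmetric space of the minimal extension\<close>

lemma (in hermitian_group) positive_cone_model:
  "symmetric_space_model alg_units G posdef (\<lambda>g. \<lambda>b\<in>posdef. g * b * \<sigma> g)"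
proof (rule symmetric_space_modelI[where q = psqrt and ?x0.0 = 1])
  show "group (alg_units :: 'a monoid)" by (rule group_alg_units)
  show "lie_subgroup G alg_units" by (rule lie_G)
  show "h * x * \<sigma> h \<in> posdef" if "h \<in> G" "x \<in> posdef" for h x by (rule G_act_posdef[OF that])
  show "(g \<otimes>\<^bsub>alg_units\<^esub> h) * x * \<sigma> (g \<otimes>\<^bsub>alg_units\<^esub> h) = g * (h * x * \<sigma> h) * \<sigma> g" for g h x
    by (simp add: \<sigma>_mult mult.assoc)
  show "\<one>\<^bsub>alg_units\<^esub> * x * \<sigma> \<one>\<^bsub>alg_units\<^esub> = x" for x by (simp add: \<sigma>_1)
  show "continuous_on (G \<times> posdef) (\<lambda>(h, x). h * x * \<sigma> h)"
    unfolding case_prod_beta by (intro continuous_intros continuous_\<sigma>)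
  show "1 \<in> posdef" by (rule one_posdef)
  show "continuous_on posdef psqrt" by (rule continuous_on_psqrt)
  show "psqrt x \<in> G" "psqrt x * 1 * \<sigma> (psqrt x) = x" if "x \<in> posdef" for x
    using psqrt[OF that] by (simp_all add: posdef_G J_sym[OF posdef_J])
  show "compact {h \<in> G. h * 1 * \<sigma> h = 1}" using compact_K by (simp add: K_def)
  fix K' x assume K': "subgroup K' (alg_units\<lparr>carrier := G\<rparr>)" "compact K'" and x: "x \<in> posdef" "psqrt x \<in> K'"
  have sub: "subgroup K' alg_units" by (rule group.incl_subgroup[OF group_alg_units subgroup_G K'(1)])
  have pow: "s ^ n \<in> K'" if "s \<in> K'" for s n
    using subgroup.one_closed[OF sub] subgroup.m_closed[OF sub] that by (induction n) auto
  obtain M where M: "\<And>s. s \<in> K' \<Longrightarrow> norm s \<le> M"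
    using compact_imp_bounded[OF K'(2)] by (auto simp: bounded_iff)
  have inv: "ainv (psqrt x) \<in> K'" by (rule subgroup.m_inv_closed[OF sub x(2)])
  have "psqrt x = 1"
    using power_bounded_posdef[OF psqrt(1)[OF x(1)] ainv(1,2)[OF posdef_unit[OF psqrt(1)[OF x(1)]]]
        M[OF pow[OF x(2)]] M[OF pow[OF inv]]] .
  then show "x = 1" using psqrt(2)[OF x(1)] by simp
qed

section \<open>Two by two matrices over a ring\<close>

lemma mat2_nth [simp]:
  "mat2 a b c d $ 1 $ 1 = a" "mat2 a b c d $ 1 $ 2 = b"
  "mat2 a b c d $ 2 $ 1 = c" "mat2 a b c d $ 2 $ 2 = d"
  by (simp_all add: mat2_def)

lemma mat2_eq_iff: "M = N \<longleftrightarrow> M $ 1 $ 1 = N $ 1 $ 1 \<and> M $ 1 $ 2 = N $ 1 $ 2 \<and> M $ 2 $ 1 = N $ 2 $ 1 \<and> M $ 2 $ 2 = N $ 2 $ 2"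
  for M N :: "'a^2^2"
  by (auto simp: vec_eq_iff forall_2)

lemma mat2_inject: "mat2 a b c d = mat2 a' b' c' d' \<longleftrightarrow> a = a' \<and> b = b' \<and> c = c' \<and> d = d'"
  by (simp add: mat2_eq_iff)

lemma matrix_mult_nth:
  "(M ** N) $ i $ j = M $ i $ 1 * N $ 1 $ j + M $ i $ 2 * N $ 2 $ j" for M N :: "('a::semiring_1)^2^2"
  by (simp add: matrix_matrix_mult_def sum_2)

lemma mat2_mult: "mat2 a b c d ** mat2 a' b' c' d' =
    mat2 (a * a' + b * c') (a * b' + b * d') (c * a' + d * c') (c * b' + d * (d'::'a::semiring_1))"
  by (simp add: mat2_eq_iff matrix_mult_nth)

lemma mat_1_eq: "mat 1 = mat2 1 0 0 (1::'a::semiring_1)"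
  by (simp add: mat2_eq_iff mat_def)

lemma group_GL2: "group (GL2 :: ('a::ring_1^2^2) monoid)"
proof -
  have "Group.monoid \<lparr>carrier = UNIV :: ('a^2^2) set, monoid.mult = (**), one = mat 1\<rparr>"
    by unfold_locales (auto simp: matrix_mul_assoc)
  then show ?thesis unfolding GL2_def by (rule monoid.units_group)
qed

lemma GL2_simps: "monoid.mult GL2 = (**)" "one GL2 = mat 1"
  by (simp_all add: GL2_def units_of_def)

lemma carrier_GL2: "M \<in> carrier GL2 \<longleftrightarrow> (\<exists>N. M ** N = mat 1 \<and> N ** M = mat 1)"
  by (auto simp: GL2_def units_of_def Units_def)

lemma inv_GL2: "M ** N = mat 1 \<Longrightarrow> N ** M = mat 1 \<Longrightarrow> inv\<^bsub>GL2\<^esub> M = N"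
  by (rule group.inv_equality[OF group_GL2]) (auto simp: GL2_simps carrier_GL2)

lemma tendsto_mat2:
  assumes "(f \<longlongrightarrow> a) F" "(g \<longlongrightarrow> b) F" "(h \<longlongrightarrow> c) F" "(k \<longlongrightarrow> d) F"
  shows "((\<lambda>x. mat2 (f x) (g x) (h x) (k x)) \<longlongrightarrow> mat2 a b c d) F"
proof (intro vec_tendstoI)
  fix i j :: 2
  show "((\<lambda>x. mat2 (f x) (g x) (h x) (k x) $ i $ j) \<longlongrightarrow> mat2 a b c d $ i $ j) F"
    using assms exhaust_2[of i] exhaust_2[of j] by auto
qed

lemma continuous_on_mat2:
  assumes "continuous_on S f" "continuous_on S g" "continuous_on S h" "continuous_on S k"
  shows "continuous_on S (\<lambda>x. mat2 (f x) (g x) (h x) (k x))"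
  using assms unfolding continuous_on_def by (auto intro!: tendsto_mat2)

lemma tendsto_matrix_mult:
  fixes f g :: "_ \<Rightarrow> ('a::real_normed_algebra_1)^2^2"
  assumes "(f \<longlongrightarrow> M) F" "(g \<longlongrightarrow> N) F"
  shows "((\<lambda>x. f x ** g x) \<longlongrightarrow> M ** N) F"
proof (intro vec_tendstoI)
  fix i j :: 2
  show "((\<lambda>x. (f x ** g x) $ i $ j) \<longlongrightarrow> (M ** N) $ i $ j) F"
    unfolding matrix_mult_nth by (intro tendsto_intros assms)
qed

text \<open>The inverse of a symplectic matrix. In terms of it membership in the symplectic group is given by two
closed conditions, so that the group is closed in the space of all matrices.\<close>

definition sp_inverse :: "('a::ring_1 \<Rightarrow> 'a) \<Rightarrow> 'a^2^2 \<Rightarrow> 'a^2^2" where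
  "sp_inverse \<sigma> M = mat2 (\<sigma> (M $ 2 $ 2)) (- \<sigma> (M $ 1 $ 2)) (- \<sigma> (M $ 2 $ 1)) (\<sigma> (M $ 1 $ 1))"

lemma Sp2_iff: "M \<in> Sp2 \<sigma> \<longleftrightarrow> sp_inverse \<sigma> M ** M = mat 1 \<and> M ** sp_inverse \<sigma> M = mat 1"
proof -
  have "transpose (map_matrix \<sigma> M) = mat2 (\<sigma> (M$1$1)) (\<sigma> (M$2$1)) (\<sigma> (M$1$2)) (\<sigma> (M$2$2))"
    by (simp add: mat2_eq_iff transpose_def map_matrix_def)
  then have "transpose (map_matrix \<sigma> M) ** mat2 0 1 (-1) 0 ** M = mat2 0 1 (-1) 0
      \<longleftrightarrow> sp_inverse \<sigma> M ** M = mat 1"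
    by (auto simp: mat2_eq_iff matrix_mult_nth sp_inverse_def mat_1_eq add_eq_0_iff algebra_simps
        minus_equation_iff equation_minus_iff)
  moreover have "M ** N = mat 1" if "N ** M = mat 1" "M \<in> carrier GL2" for N
    using that unfolding carrier_GL2 by (metis matrix_mul_assoc matrix_mul_lid matrix_mul_rid)
  ultimately show ?thesis unfolding Sp2_def using carrier_GL2 by blast
qed

section \<open>The complexification and Moebius transformations\<close>

abbreviation cmult :: "('a::ring_1) \<times> 'a \<Rightarrow> 'a \<times> 'a \<Rightarrow> 'a \<times> 'a" where
  "cmult \<equiv> monoid.mult complexification"

abbreviation cinv :: "('a::ring_1) \<times> 'a \<Rightarrow> 'a \<times> 'a" where
  "cinv w \<equiv> inv\<^bsub>complexification\<^esub> w"

lemma cmult_pair: "cmult (a, b) (c, d) = (a * c - b * d, a * d + b * c)"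
  by (simp add: complexification_def)

lemma complexification_simps: "carrier complexification = UNIV" "one complexification = (1, 0)"
  by (simp_all add: complexification_def)

lemma cmult_assoc: "cmult (cmult x y) z = cmult x (cmult y z)"
  by (cases x; cases y; cases z) (simp add: cmult_pair algebra_simps)

lemma cmult_one: "cmult (1, 0) x = x" "cmult x (1, 0) = x"
  by (cases x; simp add: cmult_pair)+

lemma cmult_add: "cmult (x + y) z = cmult x z + cmult y z" "cmult z (x + y) = cmult z x + cmult z y"
  by (cases x; cases y; cases z; simp add: cmult_pair algebra_simps)+

lemma cmult_neg: "cmult (- x) (- y) = cmult x y"
  by (cases x; cases y) (simp add: cmult_pair)

lemma monoid_complexification: "Group.monoid (complexification :: ('a::ring_1 \<times> 'a) monoid)"
  by unfold_locales (simp_all add: complexification_simps cmult_assoc cmult_one)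

lemma cunit_iff: "w \<in> Units complexification \<longleftrightarrow> (\<exists>v. cmult v w = (1, 0) \<and> cmult w v = (1, 0))"
  by (auto simp: Units_def complexification_simps)

lemma cunitI: "cmult v w = (1, 0) \<Longrightarrow> cmult w v = (1, 0) \<Longrightarrow> w \<in> Units complexification"
  unfolding cunit_iff by blast

lemma cinv_eqI: "cmult v w = (1, 0) \<Longrightarrow> cmult w v = (1, 0) \<Longrightarrow> cinv w = v"
  by (rule monoid.inv_unique'[OF monoid_complexification, symmetric])
     (simp_all add: complexification_simps)

lemma cinv:
  assumes "w \<in> Units complexification"
  shows "cmult (cinv w) w = (1, 0)" "cmult w (cinv w) = (1, 0)"
  using monoid.Units_l_inv[OF monoid_complexification assms]
    monoid.Units_r_inv[OF monoid_complexification assms] by (simp_all only: complexification_simps)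

lemma cunit_mult:
  assumes "v \<in> Units complexification" "w \<in> Units complexification"
  shows "cmult v w \<in> Units complexification"
  by (rule monoid.Units_m_closed[OF monoid_complexification assms])

lemma moebius_eqI:
  assumes "moebius_denom M z \<in> Units complexification" "moebius_num M z = cmult w (moebius_denom M z)"
  shows "moebius_action M z = w"
  unfolding moebius_action_def assms(2) by (simp only: cmult_assoc cinv(2)[OF assms(1)] cmult_one)

lemma moebius_num_eq:
  assumes "moebius_denom M z \<in> Units complexification"
  shows "moebius_num M z = cmult (moebius_action M z) (moebius_denom M z)"
  unfolding moebius_action_def by (simp only: cmult_assoc cinv(1)[OF assms] cmult_one)

text \<open>Numerator and denominator for \<open>M ** N\<close> are those for \<open>M\<close> at the image point, each multiplied on the
right by the denominator for \<open>N\<close>, which cancels.\<close>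

lemma moebius_compose:
  fixes M N :: "('a::ring_1)^2^2"
  assumes N: "moebius_denom N z \<in> Units complexification"
    and M: "moebius_denom M (moebius_action N z) \<in> Units complexification"
  shows "moebius_denom (M ** N) z \<in> Units complexification"
    and "moebius_action (M ** N) z = moebius_action M (moebius_action N z)"
proof -
  let ?w = "moebius_action N z"
  obtain x y where z: "z = (x, y)" by (cases z)
  have "moebius_denom (M ** N) z = cmult (M$2$1, 0) (moebius_num N z) + cmult (M$2$2, 0) (moebius_denom N z)"
    and "moebius_num (M ** N) z = cmult (M$1$1, 0) (moebius_num N z) + cmult (M$1$2, 0) (moebius_denom N z)"
    by (simp_all add: moebius_num_def moebius_denom_def matrix_mult_nth z cmult_pair algebra_simps)
  then have den: "moebius_denom (M ** N) z = cmult (moebius_denom M ?w) (moebius_denom N z)"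
    and num: "moebius_num (M ** N) z = cmult (moebius_num M ?w) (moebius_denom N z)"
    unfolding moebius_num_eq[OF N]
    by (simp_all only: moebius_num_def[of M ?w] moebius_denom_def[of M ?w] cmult_add cmult_assoc)
  show u: "moebius_denom (M ** N) z \<in> Units complexification"
    unfolding den by (rule cunit_mult[OF M N])
  show "moebius_action (M ** N) z = moebius_action M ?w"
    by (rule moebius_eqI[OF u]) (simp only: num den moebius_num_eq[OF M] cmult_assoc)
qed

lemma bounded_bilinear_cmult: "bounded_bilinear (cmult :: ('a::real_normed_algebra_1) \<times> 'a \<Rightarrow> _)"
proof
  fix a b c :: "'a \<times> 'a" and r :: real
  show "cmult (a + b) c = cmult a c + cmult b c" "cmult a (b + c) = cmult a b + cmult a c"
    by (simp_all only: cmult_add)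
  show "cmult (r *\<^sub>R a) b = r *\<^sub>R cmult a b" "cmult a (r *\<^sub>R b) = r *\<^sub>R cmult a b"
    by (cases a; cases b; simp add: cmult_pair scaleR_diff_right scaleR_add_right)+
next
  have "norm (cmult a b) \<le> norm a * norm b * 4" for a b :: "'a \<times> 'a"
  proof -
    obtain a1 a2 b1 b2 where ab: "a = (a1, a2)" "b = (b1, b2)" by (cases a; cases b)
    have n: "norm a1 \<le> norm a" "norm a2 \<le> norm a" "norm b1 \<le> norm b" "norm b2 \<le> norm b"
      using norm_fst_le[of a1 a2] norm_snd_le[of a2 a1] norm_fst_le[of b1 b2] norm_snd_le[of b2 b1] by (simp_all add: ab)
    have p: "norm (x * y) \<le> norm a * norm b" if "norm x \<le> norm a" "norm y \<le> norm b" for x y :: 'a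
      by (rule order_trans[OF norm_mult_ineq mult_mono]) (use that in auto)
    have "norm (cmult a b) \<le> norm (a1 * b1 - a2 * b2) + norm (a1 * b2 + a2 * b1)"
      unfolding ab cmult_pair by (rule norm_Pair_le)
    also have "\<dots> \<le> (norm (a1 * b1) + norm (a2 * b2)) + (norm (a1 * b2) + norm (a2 * b1))"
      by (intro add_mono norm_triangle_ineq4 norm_triangle_ineq)
    also have "\<dots> \<le> norm a * norm b * 4"
      using p[OF n(1,3)] p[OF n(2,4)] p[OF n(1,4)] p[OF n(2,3)] by linarith
    finally show ?thesis .
  qed
  then show "\<exists>K. \<forall>a b :: 'a \<times> 'a. norm (cmult a b) \<le> norm a * norm b * K" by blast
qed

lemma continuous_on_cinv:
  fixes f :: "_ \<Rightarrow> ('a::real_normed_algebra_1) \<times> 'a"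
  assumes "continuous_on S f" "\<And>x. x \<in> S \<Longrightarrow> f x \<in> Units complexification"
  shows "continuous_on S (\<lambda>x. cinv (f x))"
  unfolding continuous_on_def
proof
  fix x assume x: "x \<in> S"
  have f: "(f \<longlongrightarrow> f x) (at x within S)" using assms(1) x by (simp add: continuous_on_def)
  show "((\<lambda>x. cinv (f x)) \<longlongrightarrow> cinv (f x)) (at x within S)"
  proof (rule tendsto_bilinear_inverse[OF bounded_bilinear_cmult cmult_assoc cmult_one f cinv(2)])
    show "\<forall>\<^sub>F x in at x within S. cmult (cinv (f x)) (f x) = (1, 0)"
      using cinv(1)[OF assms(2)] by (simp add: eventually_at_filter)
  qed (rule assms(2)[OF x])
qed

section \<open>The symmetric space of the symplectic group\<close>

text \<open>Left multiplication by \<open>a\<close> is injective, since \<open>a v = 0\<close> implies \<open>norm v = norm ((a - 1) v)\<close>; in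
finite dimension it is then surjective.\<close>

lemma (in finite_dim_algebra) near_one_unit:
  fixes a :: 'a
  assumes "norm (a - 1) < 1"
  shows "a \<in> carrier alg_units"
proof -
  have lin: "linear ((*) a)" by (rule linear_times)
  have inj: "inj ((*) a)"
    unfolding linear_injective_0[OF lin]
  proof (intro allI impI)
    fix v assume "a * v = 0"
    then have "(a - 1) * v = - v" by (simp add: left_diff_distrib)
    then have le: "norm v \<le> norm (a - 1) * norm v" by (metis norm_minus_cancel norm_mult_ineq)
    show "v = 0"
    proof (rule ccontr)
      assume "v \<noteq> 0"
      then have "norm (a - 1) * norm v < 1 * norm v" using assms by (intro mult_strict_right_mono) auto
      then show False using le by simp
    qed
  qed
  have "surj ((*) a)"
    using finite_dimensional_vector_space.linear_inj_imp_surj[OF finite_dimensional _ inj] lin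
    unfolding linear_def by blast
  then obtain b where b: "a * b = 1" by (metis surjD)
  have "a * (b * a) = a * 1" by (simp add: mult.assoc[symmetric] b)
  then have "b * a = 1" by (rule injD[OF inj])
  with b show ?thesis by (rule unitI)
qed

context hermitian_group
begin

subsection \<open>The symplectic group\<close>

abbreviation spinv :: "'a^2^2 \<Rightarrow> 'a^2^2" where "spinv \<equiv> sp_inverse \<sigma>"

text \<open>The product of the three matrices that occur in the definition of the symplectic group, multiplied out.\<close>

definition cell :: "'a \<Rightarrow> 'a \<Rightarrow> 'a \<Rightarrow> 'a^2^2" where
  "cell x y z = mat2 x (x * z) (y * x) (y * x * z + ainv (\<sigma> x))"

definition big_cell :: "('a^2^2) set" where
  "big_cell = {cell x y z | x y z. x \<in> G \<and> y \<in> J \<and> z \<in> J}"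

definition SpG :: "('a^2^2) set" where "SpG = Sp2_group G B \<sigma>"

lemma cell_factors: "mat2 1 0 y 1 ** mat2 x 0 0 (ainv (\<sigma> x)) ** mat2 1 z 0 1 = cell x y z"
  by (simp add: mat2_mult cell_def algebra_simps)

lemma tendsto_spinv: "(f \<longlongrightarrow> M) F \<Longrightarrow> ((\<lambda>x. spinv (f x)) \<longlongrightarrow> spinv M) F"
  unfolding sp_inverse_def by (intro tendsto_mat2 tendsto_minus tendsto_\<sigma> tendsto_vec_nth)

lemma spinv_mult: "spinv (M ** N) = spinv N ** spinv M"
  by (simp add: mat2_eq_iff sp_inverse_def matrix_mult_nth \<sigma>_add \<sigma>_mult)

lemma Sp2_mult: "M \<in> Sp2 \<sigma> \<Longrightarrow> N \<in> Sp2 \<sigma> \<Longrightarrow> M ** N \<in> Sp2 \<sigma>"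
proof -
  assume MN: "M \<in> Sp2 \<sigma>" "N \<in> Sp2 \<sigma>"
  have "spinv N ** spinv M ** (M ** N) = spinv N ** (spinv M ** M) ** N"
    "M ** N ** (spinv N ** spinv M) = M ** (N ** spinv N) ** spinv M"
    by (simp_all only: matrix_mul_assoc)
  then show ?thesis using MN unfolding Sp2_iff spinv_mult by simp
qed

lemma Sp2_limit:
  assumes "\<And>n. f n \<in> Sp2 \<sigma>" "f \<longlonglongrightarrow> M"
  shows "M \<in> Sp2 \<sigma>"
proof -
  have "(\<lambda>n. spinv (f n) ** f n) \<longlonglongrightarrow> spinv M ** M" "(\<lambda>n. f n ** spinv (f n)) \<longlonglongrightarrow> M ** spinv M"
    by (intro tendsto_matrix_mult tendsto_spinv assms(2))+
  moreover have "spinv (f n) ** f n = mat 1" "f n ** spinv (f n) = mat 1" for n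
    using assms(1) unfolding Sp2_iff by blast+
  ultimately show ?thesis unfolding Sp2_iff by (simp add: LIMSEQ_const_iff)
qed

lemma closed_Sp2: "closed (Sp2 \<sigma>)"
  unfolding closed_sequential_limits by (intro allI impI, elim conjE, rule Sp2_limit) auto

lemma cell_Sp2: "x \<in> G \<Longrightarrow> y \<in> J \<Longrightarrow> z \<in> J \<Longrightarrow> cell x y z \<in> Sp2 \<sigma>"
proof -
  assume x: "x \<in> G" and yz: "y \<in> J" "z \<in> J"
  define u w s where "u = ainv x" and "w = ainv (\<sigma> x)" and "s = \<sigma> x"
  have u: "x * u = 1" "u * x = 1" and w: "s * w = 1" "w * s = 1"
    using ainv[OF GD(1)[OF x]] ainv[OF \<sigma>_unit[OF GD(1)[OF x]]] by (simp_all add: u_def w_def s_def)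
  have c: "x * (u * t) = t" "u * (x * t) = t" "s * (w * t) = t" "w * (s * t) = t" for t
    by (simp_all only: mult.assoc[symmetric] u w mult_1_left)
  have \<sigma>w: "\<sigma> w = u" using \<sigma>_ainv[OF GD(1)[OF x]] by (simp add: w_def u_def \<sigma>_\<sigma>)
  have cell: "cell x y z = mat2 x (x * z) (y * x) (y * x * z + w)" by (simp only: cell_def w_def)
  moreover have "spinv (cell x y z) = mat2 (z * (s * y) + u) (- (z * s)) (- (s * y)) s"
    unfolding cell by (simp add: sp_inverse_def \<sigma>_add \<sigma>_mult J_sym yz \<sigma>w s_def[symmetric])
  ultimately show ?thesis
    unfolding Sp2_iff by (simp add: mat2_mult mat_1_eq mat2_inject algebra_simps u w c)
qed

text \<open>The first row and the first column determine \<open>x\<close>, \<open>y\<close> and \<open>z\<close>; the symplectic relation then leaves only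
one possible value for the last entry. The three conditions are stable under limits as long as the
upper left entry stays invertible.\<close>

lemma big_cell_criterion:
  assumes M: "M \<in> Sp2 \<sigma>" and a: "M$1$1 \<in> G" and c: "M$2$1 * ainv (M$1$1) \<in> J" and b: "ainv (M$1$1) * M$1$2 \<in> J"
  shows "M \<in> big_cell"
proof -
  define x y z where "x = M$1$1" and "y = M$2$1 * ainv (M$1$1)" and "z = ainv (M$1$1) * M$1$2"
  note u = ainv[OF GD(1)[OF a], folded x_def]
  have xz: "x * z = M$1$2"
    unfolding z_def x_def[symmetric] by (simp only: mult.assoc[symmetric] u(1) mult_1_left)
  have yx: "y * x = M$2$1"
    unfolding y_def x_def[symmetric] by (simp only: mult.assoc u(2) mult_1_right)
  have "(spinv M ** M)$2$2 = 1" using M unfolding Sp2_iff by (simp add: mat_def)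
  then have d: "\<sigma> x * M$2$2 = 1 + \<sigma> (M$2$1) * M$1$2"
    by (simp add: matrix_mult_nth sp_inverse_def x_def algebra_simps)
  note su = ainv[OF \<sigma>_unit[OF GD(1)[OF a]], folded x_def]
  have \<sigma>y: "\<sigma> y = y" using c by (intro J_sym) (simp add: y_def)
  have "\<sigma> (M$2$1) = \<sigma> x * y" unfolding yx[symmetric] by (simp add: \<sigma>_mult \<sigma>y)
  then have "\<sigma> x * M$2$2 = 1 + \<sigma> x * (y * (x * z))" unfolding d xz[symmetric] by (simp add: mult.assoc)
  then have "ainv (\<sigma> x) * (\<sigma> x * M$2$2) = ainv (\<sigma> x) * (1 + \<sigma> x * (y * (x * z)))" by simp
  then have "M$2$2 = ainv (\<sigma> x) + y * (x * z)"
    by (simp add: distrib_left mult.assoc[symmetric] su(2))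
  then have d2: "M$2$2 = y * x * z + ainv (\<sigma> x)" by (simp only: mult.assoc add.commute)
  have "M = cell x y z"
    unfolding mat2_eq_iff cell_def mat2_nth by (intro conjI xz[symmetric] yx[symmetric] d2) (simp only: x_def)
  then show ?thesis using a b c unfolding big_cell_def x_def y_def z_def by blast
qed

lemma big_cell_cases:
  assumes "M \<in> big_cell"
  obtains x y z where "M = cell x y z" "x \<in> G" "y \<in> J" "z \<in> J"
  using assms unfolding big_cell_def by blast

lemma big_cell_I: "x \<in> G \<Longrightarrow> y \<in> J \<Longrightarrow> z \<in> J \<Longrightarrow> cell x y z \<in> big_cell"
  unfolding big_cell_def by blast

lemma big_cell_Sp2: "big_cell \<subseteq> Sp2 \<sigma>"
  using cell_Sp2 by (auto elim: big_cell_cases)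

lemma SpG_eq: "SpG = closure big_cell"
proof -
  have "{mat2 1 0 y 1 ** mat2 x 0 0 (ainv (\<sigma> x)) ** mat2 1 z 0 1 | x y z.
        x \<in> G \<and> y \<in> sym_part \<sigma> B \<and> z \<in> sym_part \<sigma> B} = big_cell"
    unfolding cell_factors big_cell_def J_def[symmetric] ..
  then have "SpG = top_of_set (Sp2 \<sigma>) closure_of big_cell" by (simp only: SpG_def Sp2_group_def)
  also have "\<dots> = Sp2 \<sigma> \<inter> closure big_cell"
    using big_cell_Sp2 by (simp add: closure_of_subtopology inf.absorb2)
  also have "\<dots> = closure big_cell" using closure_minimal[OF big_cell_Sp2 closed_Sp2] by blast
  finally show ?thesis .
qed

lemma SpG_seq: assumes "M \<in> SpG" obtains f where "\<And>n. f n \<in> big_cell" "f \<longlonglongrightarrow> M"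
  using assms unfolding SpG_eq closure_sequential by blast

lemma SpG_limit: "(\<And>n. f n \<in> SpG) \<Longrightarrow> f \<longlonglongrightarrow> M \<Longrightarrow> M \<in> SpG"
  unfolding SpG_eq by (rule closed_sequentially[OF closed_closure])

lemma big_cell_SpG: "M \<in> big_cell \<Longrightarrow> M \<in> SpG"
  unfolding SpG_eq using closure_subset by blast

lemma S_Sp2: "M \<in> SpG \<Longrightarrow> M \<in> Sp2 \<sigma>"
  unfolding SpG_eq using closure_minimal[OF big_cell_Sp2 closed_Sp2] by blast

lemma perturb_unit:
  assumes z: "z \<in> J" and e: "e > 0"
  shows "\<exists>t. \<bar>t\<bar> < e \<and> z + t *\<^sub>R 1 \<in> carrier alg_units"
proof -
  obtain C l where C: "frame C" "z = fc C l" by (rule spectral_theorem[OF z])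
  have "infinite ({0<..<e} - (\<lambda>c. - l c) ` C)"
    using frame_ofD(1)[OF C(1)] e by (intro Diff_infinite_finite) auto
  then obtain t where t: "t \<in> {0<..<e}" "t \<notin> (\<lambda>c. - l c) ` C"
    by (metis Diff_iff finite.emptyI ex_in_conv)
  have nz: "l c + t \<noteq> 0" if "c \<in> C" for c
  proof
    assume "l c + t = 0"
    then have "t = - l c" by simp
    then show False using t(2) that by blast
  qed
  have "z + t *\<^sub>R 1 = fc C (\<lambda>c. l c + t)"
    by (simp add: C(2) fc_add[symmetric] fc_const[OF C(1)])
  moreover have "fc C (\<lambda>c. l c + t) * fc C (\<lambda>c. 1 / (l c + t)) = 1"
    "fc C (\<lambda>c. 1 / (l c + t)) * fc C (\<lambda>c. l c + t) = 1"
    unfolding fc_mult[OF C(1)] fc_one[OF C(1), symmetric] by (rule fc_cong, simp add: nz)+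
  ultimately have "z + t *\<^sub>R 1 \<in> carrier alg_units" by (simp only: unitI)
  then show ?thesis using t(1) by (intro exI[of _ t]) auto
qed

text \<open>If \<open>z\<close> is a unit, \<open>1 + z y = z (ainv z + y)\<close> is a product of two elements of \<open>J\<close>, so it lies in
\<open>G\<close> as soon as the second factor is a unit. This is why the minimal extension contains the units
of \<open>J\<close>. Both factors become units after adding arbitrarily small scalars.\<close>

lemma perturb_one_plus_product:
  assumes z: "z \<in> J" and y: "y \<in> J"
  shows "\<exists>zs ys. (\<forall>n. zs n \<in> J \<and> ys n \<in> J \<and> 1 + zs n * ys n \<in> G) \<and> zs \<longlonglongrightarrow> z \<and> ys \<longlonglongrightarrow> y"
proof -
  have "\<exists>z' y'. z' \<in> J \<and> y' \<in> J \<and> 1 + z' * y' \<in> G \<and> norm (z' - z) < 1 / Suc n \<and> norm (y' - y) < 1 / Suc n" for n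
  proof -
    have e: "1 / real (Suc n) > 0" by simp
    obtain t where t: "\<bar>t\<bar> < 1 / Suc n" "z + t *\<^sub>R 1 \<in> carrier alg_units"
      using perturb_unit[OF z e] by blast
    define z' where "z' = z + t *\<^sub>R 1"
    have z'J: "z' \<in> J" unfolding z'_def by (intro add_J z scale_J one_J)
    note u = ainv[OF t(2), folded z'_def]
    have uJ: "ainv z' \<in> J" by (rule inverse_in_J[OF z'J u(1,2)])
    obtain s where s: "\<bar>s\<bar> < 1 / Suc n" "ainv z' + y + s *\<^sub>R 1 \<in> carrier alg_units"
      using perturb_unit[OF add_J[OF uJ y] e] by blast
    define y' where "y' = y + s *\<^sub>R 1"
    have y'J: "y' \<in> J" unfolding y'_def by (intro add_J y scale_J one_J)
    have "ainv z' + y' \<in> carrier alg_units" using s(2) by (simp add: y'_def add.assoc)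
    then have "ainv z' + y' \<in> G" by (intro J_units_G add_J uJ y'J)
    moreover have "z' \<in> G" by (rule J_units_G[OF z'J]) (use t(2) in \<open>simp add: z'_def\<close>)
    ultimately have "z' * (ainv z' + y') \<in> G" by (intro GD(3))
    then have "1 + z' * y' \<in> G" by (simp add: distrib_left u(1))
    moreover have "norm (z' - z) < 1 / Suc n" "norm (y' - y) < 1 / Suc n"
      using t(1) s(1) by (simp_all add: z'_def y'_def)
    ultimately show ?thesis using z'J y'J by blast
  qed
  then obtain zs ys where *: "\<And>n. zs n \<in> J" "\<And>n. ys n \<in> J" "\<And>n. 1 + zs n * ys n \<in> G"
    "\<And>n. norm (zs n - z) < 1 / Suc n" "\<And>n. norm (ys n - y) < 1 / Suc n" by metis
  have lim: "(\<lambda>n. f n - a) \<longlonglongrightarrow> 0" if "\<And>n. norm (f n - a) < 1 / Suc n" for f :: "nat \<Rightarrow> 'a" and a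
    by (rule Lim_null_comparison[OF _ LIMSEQ_inverse_real_of_nat])
       (use that in \<open>auto simp: divide_inverse intro!: always_eventually less_imp_le\<close>)
  have "zs \<longlonglongrightarrow> z" "ys \<longlonglongrightarrow> y" using lim[OF *(4)] lim[OF *(5)] by (simp_all only: LIM_zero_iff)
  then show ?thesis using *(1-3) by blast
qed

lemma G_act_ainv_J:
  assumes "x \<in> G" "y \<in> J"
  shows "ainv x * y * \<sigma> (ainv x) \<in> J" "\<sigma> (ainv x) * y * ainv x \<in> J"
proof -
  show "ainv x * y * \<sigma> (ainv x) \<in> J" by (rule G_act_J[OF GD(4)[OF assms(1)] assms(2)])
  show "\<sigma> (ainv x) * y * ainv x \<in> J"
    using G_act_J[OF \<sigma>_G[OF GD(4)[OF assms(1)]] assms(2)] by (simp only: \<sigma>_\<sigma>)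
qed

text \<open>With \<open>g = 1 + z1 y2\<close> the upper left entry of the product is \<open>x1 g x2\<close>. The two other conditions of the
criterion reduce to \<open>ainv g * z1 \<in> J\<close> and \<open>y2 * ainv g \<in> J\<close>. The first one holds because
\<open>z1 \<sigma>(g) = z1 + z1 y2 z1\<close> is in \<open>J\<close> and \<open>ainv g\<close> acts on \<open>J\<close>; the second one is its mirror image.\<close>

lemma big_cell_product:
  assumes x: "x1 \<in> G" "x2 \<in> G" and y: "y1 \<in> J" "y2 \<in> J" and z: "z1 \<in> J" "z2 \<in> J"
    and g: "1 + z1 * y2 \<in> G"
  shows "cell x1 y1 z1 ** cell x2 y2 z2 \<in> big_cell"
proof -
  define g' where "g' = 1 + z1 * y2"
  define u1 u2 h where "u1 = ainv x1" and "u2 = ainv x2" and "h = ainv g'"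
  have gG: "g' \<in> G" using g by (simp add: g'_def)
  have u: "x1 * u1 = 1" "u1 * x1 = 1" "x2 * u2 = 1" "u2 * x2 = 1" "g' * h = 1" "h * g' = 1"
    using ainv[OF GD(1)[OF x(1)]] ainv[OF GD(1)[OF x(2)]] ainv[OF GD(1)[OF gG]]
    by (simp_all add: u1_def u2_def h_def)
  have c: "x1 * (u1 * t) = t" "u1 * (x1 * t) = t" "x2 * (u2 * t) = t" "u2 * (x2 * t) = t"
    "g' * (h * t) = t" "h * (g' * t) = t" for t
    by (simp_all only: mult.assoc[symmetric] u mult_1_left)
  have w: "ainv (\<sigma> x1) = \<sigma> u1" "ainv (\<sigma> x2) = \<sigma> u2"
    using \<sigma>_ainv GD(1) x by (simp_all add: u1_def u2_def)
  have \<sigma>g: "\<sigma> g' = 1 + y2 * z1" by (simp add: g'_def \<sigma>_add \<sigma>_1 \<sigma>_mult J_sym y z)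
  have "\<sigma> h * \<sigma> g' = 1" "\<sigma> g' * \<sigma> h = 1" using u(5,6) by (simp_all add: \<sigma>_mult[symmetric] \<sigma>_1)
  then have \<sigma>h: "\<sigma> h * (\<sigma> g' * t) = t" "t * \<sigma> g' * \<sigma> h = t" for t
    by (simp_all only: mult.assoc[symmetric] mult_1_left) (simp add: mult.assoc)
  let ?M = "cell x1 y1 z1 ** cell x2 y2 z2"
  have a: "?M$1$1 = x1 * g' * x2"
    by (simp add: cell_def mat2_mult g'_def algebra_simps)
  have aG: "?M$1$1 \<in> G" unfolding a by (intro GD(3) x gG)
  have "ainv (x1 * g' * x2) = u2 * h * u1"
    by (rule ainv_unique) (simp_all add: mult.assoc u c)
  then have ia: "ainv (?M$1$1) = u2 * h * u1" by (simp only: a)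
  have "?M$1$2 = x1 * g' * x2 * z2 + x1 * z1 * \<sigma> u2"
    by (simp add: cell_def mat2_mult g'_def algebra_simps w)
  then have b: "ainv (?M$1$1) * ?M$1$2 = z2 + u2 * (h * z1) * \<sigma> u2"
    unfolding ia by (simp add: distrib_left mult.assoc c)
  have "h * z1 = h * (z1 * \<sigma> g') * \<sigma> h" using \<sigma>h(2)[of "h * z1"] by (simp add: mult.assoc)
  also have "z1 * \<sigma> g' = z1 + z1 * y2 * z1" by (simp add: \<sigma>g distrib_left mult.assoc)
  finally have "h * z1 \<in> J"
    using G_act_J[OF GD(4)[OF gG], of "z1 + z1 * y2 * z1"] z y
    by (simp add: add_J quadratic_J h_def[symmetric])
  then have bJ: "ainv (?M$1$1) * ?M$1$2 \<in> J"
    unfolding b u2_def by (intro add_J z G_act_ainv_J x)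
  have "?M$2$1 = y1 * (x1 * g' * x2) + \<sigma> u1 * y2 * x2"
    by (simp add: cell_def mat2_mult g'_def algebra_simps w)
  then have cc: "?M$2$1 * ainv (?M$1$1) = y1 + \<sigma> u1 * (y2 * h) * u1"
    unfolding ia by (simp add: distrib_right mult.assoc c u)
  have "y2 * h = \<sigma> h * (\<sigma> g' * y2) * h" by (simp only: \<sigma>h(1))
  also have "\<sigma> g' * y2 = y2 + y2 * z1 * y2" by (simp add: \<sigma>g distrib_right mult.assoc)
  finally have "y2 * h \<in> J"
    using G_act_ainv_J(2)[OF gG, of "y2 + y2 * z1 * y2"] z y
    by (simp add: add_J quadratic_J h_def[symmetric])
  then have cJ: "?M$2$1 * ainv (?M$1$1) \<in> J"
    unfolding cc u1_def by (intro add_J y G_act_ainv_J x)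
  show ?thesis
    by (rule big_cell_criterion[OF _ aG cJ bJ]) (intro Sp2_mult cell_Sp2 x y z)
qed

lemma tendsto_cell:
  assumes "(f \<longlongrightarrow> x) F" "(g \<longlongrightarrow> y) F" "(h \<longlongrightarrow> z) F" "x \<in> G" "\<And>t. f t \<in> G"
  shows "((\<lambda>t. cell (f t) (g t) (h t)) \<longlongrightarrow> cell x y z) F"
  unfolding cell_def
proof (intro tendsto_mat2 tendsto_intros assms(1-3))
  show "((\<lambda>t. ainv (\<sigma> (f t))) \<longlongrightarrow> ainv (\<sigma> x)) F"
    by (rule tendsto_ainv[OF tendsto_\<sigma>[OF assms(1)] \<sigma>_unit[OF GD(1)[OF assms(4)]]])
       (simp add: \<sigma>_unit[OF GD(1)[OF assms(5)]])
qed

lemma big_cell_mult_SpG: "M \<in> big_cell \<Longrightarrow> N \<in> big_cell \<Longrightarrow> M ** N \<in> SpG"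
proof -
  assume "M \<in> big_cell" "N \<in> big_cell"
  then obtain x1 y1 z1 x2 y2 z2 where M: "M = cell x1 y1 z1" "x1 \<in> G" "y1 \<in> J" "z1 \<in> J"
    and N: "N = cell x2 y2 z2" "x2 \<in> G" "y2 \<in> J" "z2 \<in> J" by (elim big_cell_cases)
  obtain zs ys where s: "\<And>n. zs n \<in> J" "\<And>n. ys n \<in> J" "\<And>n. 1 + zs n * ys n \<in> G" "zs \<longlonglongrightarrow> z1" "ys \<longlonglongrightarrow> y2"
    using perturb_one_plus_product[OF M(4) N(3)] by blast
  have "(\<lambda>n. cell x1 y1 (zs n) ** cell x2 (ys n) z2) \<longlonglongrightarrow> M ** N"
    unfolding M(1) N(1) by (intro tendsto_matrix_mult tendsto_cell tendsto_const s M N)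
  moreover have "cell x1 y1 (zs n) ** cell x2 (ys n) z2 \<in> SpG" for n
    by (rule big_cell_SpG[OF big_cell_product[OF M(2) N(2) M(3) s(2) s(1) N(4) s(3)]])
  ultimately show ?thesis by (rule SpG_limit[rotated])
qed

lemma SpG_mult: "M \<in> SpG \<Longrightarrow> N \<in> SpG \<Longrightarrow> M ** N \<in> SpG"
proof -
  assume MN: "M \<in> SpG" "N \<in> SpG"
  obtain f where f: "\<And>n. f n \<in> big_cell" "f \<longlonglongrightarrow> M" by (rule SpG_seq[OF MN(1)]) blast
  obtain g where g: "\<And>n. g n \<in> big_cell" "g \<longlonglongrightarrow> N" by (rule SpG_seq[OF MN(2)]) blast
  have "(\<lambda>n. f n ** g n) \<longlonglongrightarrow> M ** N" by (intro tendsto_matrix_mult f g)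
  then show ?thesis by (rule SpG_limit[rotated]) (intro big_cell_mult_SpG f g)
qed

lemma SpG_one: "mat 1 \<in> SpG"
proof -
  have "ainv (\<sigma> 1) = (1::'a)" by (rule ainv_unique) (simp_all add: \<sigma>_1)
  then have "cell 1 0 0 = mat 1" by (simp add: cell_def mat_1_eq)
  then show ?thesis using big_cell_SpG[OF big_cell_I[OF GD(2) zero_J zero_J]] by simp
qed

lemma SpG_spinv: "M \<in> SpG \<Longrightarrow> spinv M \<in> SpG"
proof -
  assume M: "M \<in> SpG"
  have big_cell: "spinv N \<in> SpG" if N: "N \<in> big_cell" for N
  proof -
    obtain x y z where N: "N = cell x y z" "x \<in> G" "y \<in> J" "z \<in> J" by (rule big_cell_cases[OF N])
    have s1: "ainv (\<sigma> 1) = (1::'a)" by (rule ainv_unique) (simp_all add: \<sigma>_1)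
    have xU: "x \<in> carrier alg_units" by (rule GD(1)[OF N(2)])
    have e: "ainv (\<sigma> (ainv x)) = \<sigma> x" "\<sigma> (ainv (\<sigma> x)) = ainv x"
      using \<sigma>_ainv[OF ainv(3)[OF xU]] \<sigma>_ainv[OF xU] by (simp_all add: ainv_ainv[OF xU] \<sigma>_\<sigma>)
    have "spinv N = cell 1 0 (- z) ** (cell (ainv x) 0 0 ** cell 1 (- y) 0)"
      by (simp add: N(1) sp_inverse_def cell_def mat2_mult mat2_inject s1 e \<sigma>_add \<sigma>_mult J_sym N(3,4) mult.assoc)
    then show ?thesis
      by (simp only:) (intro SpG_mult big_cell_SpG big_cell_I GD(2) GD(4) N(2) neg_J N zero_J)
  qed
  obtain f where f: "\<And>n. f n \<in> big_cell" "f \<longlonglongrightarrow> M" by (rule SpG_seq[OF M]) blast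
  show ?thesis by (rule SpG_limit[OF big_cell[OF f(1)] tendsto_spinv[OF f(2)]])
qed

text \<open>The cell is relatively closed among the matrices with invertible upper left entry, by the criterion.\<close>

lemma SpG_unit_big_cell:
  assumes M: "M \<in> SpG" and a: "M$1$1 \<in> carrier alg_units"
  shows "M \<in> big_cell"
proof -
  obtain f where f: "\<And>n. f n \<in> big_cell" "f \<longlonglongrightarrow> M" by (rule SpG_seq[OF M]) blast
  have nth: "(\<lambda>n. f n $ i $ j) \<longlonglongrightarrow> M $ i $ j" for i j by (intro tendsto_vec_nth f(2))
  have G: "f n $1$1 \<in> G" and cJ: "f n $2$1 * ainv (f n $1$1) \<in> J" and bJ: "ainv (f n $1$1) * f n $1$2 \<in> J" for n
  proof -
    obtain x y z where *: "f n = cell x y z" "x \<in> G" "y \<in> J" "z \<in> J" by (rule big_cell_cases[OF f(1)])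
    note u = ainv[OF GD(1)[OF *(2)]]
    show "f n $1$1 \<in> G" by (simp add: * cell_def)
    show "f n $2$1 * ainv (f n $1$1) \<in> J" by (simp add: * cell_def mult.assoc u)
    show "ainv (f n $1$1) * f n $1$2 \<in> J" by (simp add: *(1) cell_def mult.assoc[symmetric] u *(4))
  qed
  have aG: "M$1$1 \<in> G" by (rule lie_subgroup_limit[OF lie_G G nth a])
  have ia: "(\<lambda>n. ainv (f n $1$1)) \<longlonglongrightarrow> ainv (M$1$1)"
    by (rule tendsto_ainv[OF nth a]) (simp add: GD(1)[OF G])
  show ?thesis
  proof (rule big_cell_criterion[OF S_Sp2[OF M] aG])
    show "M$2$1 * ainv (M$1$1) \<in> J"
      by (rule closed_sequentially[OF closed_J cJ tendsto_mult[OF nth ia]])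
    show "ainv (M$1$1) * M$1$2 \<in> J"
      by (rule closed_sequentially[OF closed_J bJ tendsto_mult[OF ia nth]])
  qed
qed

text \<open>For \<open>N\<close> in the cell sufficiently close to \<open>M\<close>, the upper left entry of \<open>M ** spinv N\<close> is close to 1
and hence invertible, so this matrix lies in the cell.\<close>

lemma SpG_factor: assumes M: "M \<in> SpG" obtains P Q where "P \<in> big_cell" "Q \<in> big_cell" "M = P ** Q"
proof -
  obtain f where f: "\<And>n. f n \<in> big_cell" "f \<longlonglongrightarrow> M" by (rule SpG_seq[OF M]) blast
  have sM: "M ** spinv M = mat 1" using S_Sp2[OF M] unfolding Sp2_iff by blast
  have "(\<lambda>n. (M ** spinv (f n)) $ 1 $ 1) \<longlonglongrightarrow> (M ** spinv M) $ 1 $ 1"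
    by (intro tendsto_vec_nth tendsto_matrix_mult tendsto_const tendsto_spinv f(2))
  then have "(\<lambda>n. (M ** spinv (f n)) $ 1 $ 1) \<longlonglongrightarrow> 1" by (simp add: sM mat_def)
  then have "\<forall>\<^sub>F n in sequentially. dist ((M ** spinv (f n)) $ 1 $ 1) 1 < 1" by (rule tendstoD) simp
  then obtain n where "norm ((M ** spinv (f n)) $ 1 $ 1 - 1) < 1"
    by (auto simp: eventually_sequentially dist_norm)
  then have u: "(M ** spinv (f n)) $ 1 $ 1 \<in> carrier alg_units" by (rule near_one_unit)
  have P: "M ** spinv (f n) \<in> big_cell"
    by (rule SpG_unit_big_cell[OF SpG_mult[OF M SpG_spinv[OF big_cell_SpG[OF f(1)]]] u])
  have "f n \<in> Sp2 \<sigma>" by (rule S_Sp2[OF big_cell_SpG[OF f(1)]])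
  then have "spinv (f n) ** f n = mat 1" unfolding Sp2_iff by (rule conjunct1)
  then have "M = (M ** spinv (f n)) ** f n" by (simp add: matrix_mul_assoc[symmetric])
  then show thesis by (rule that[OF P f(1)])
qed

lemma lie_SpG: "lie_subgroup SpG GL2"
  unfolding lie_subgroup_def
proof
  have sp: "M ** spinv M = mat 1" "spinv M ** M = mat 1" if "M \<in> SpG" for M
    using S_Sp2[OF that] unfolding Sp2_iff by simp_all
  have inv: "inv\<^bsub>GL2\<^esub> M = spinv M" if "M \<in> SpG" for M by (rule inv_GL2[OF sp[OF that]])
  have GL: "M \<in> carrier GL2" if "M \<in> SpG" for M unfolding carrier_GL2 using sp[OF that] by blast
  show "subgroup SpG GL2"
  proof
    show "SpG \<subseteq> carrier GL2" using GL by blast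
    show "M \<otimes>\<^bsub>GL2\<^esub> N \<in> SpG" if "M \<in> SpG" "N \<in> SpG" for M N unfolding GL2_simps by (rule SpG_mult[OF that])
    show "\<one>\<^bsub>GL2\<^esub> \<in> SpG" unfolding GL2_simps by (rule SpG_one)
    show "inv\<^bsub>GL2\<^esub> M \<in> SpG" if "M \<in> SpG" for M unfolding inv[OF that] by (rule SpG_spinv[OF that])
  qed
  have "SpG \<subseteq> carrier GL2" using GL by blast
  then show "closedin (top_of_set (carrier GL2)) SpG"
    by (intro closed_subset) (simp_all add: SpG_eq)
qed

end

context hermitian_group
begin

subsection \<open>The upper half-space\<close>

definition half_space :: "('a \<times> 'a) set" where "half_space = {(u, v). u \<in> J \<and> v \<in> posdef}"

definition base :: "'a \<times> 'a" where "base = (0, 1)"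

lemma base_half_space: "base \<in> half_space"
  by (simp add: base_def half_space_def zero_J one_posdef)

text \<open>Write \<open>v = w\<^sup>2\<close> and \<open>u = w r w\<close>. Then \<open>u + i v = w (r + i) w\<close>, with inverse
\<open>ainv w (r - i) k (ainv w)\<close>, where \<open>k\<close> is the inverse of \<open>t = 1 + r\<^sup>2\<close> and commutes with \<open>r\<close>.\<close>

lemma half_space_inverse:
  assumes u: "u \<in> J" and v: "v \<in> posdef"
  shows "\<exists>u' v'. u' \<in> J \<and> v' \<in> posdef \<and> cmult (u, v) (u', - v') = (1, 0) \<and> cmult (u', - v') (u, v) = (1, 0)"
proof -
  define w s where "w = psqrt v" and "s = ainv w"
  have w: "w \<in> posdef" "w * w = v" using psqrt[OF v] by (simp_all add: w_def)
  have ws: "w * s = 1" "s * w = 1" using ainv[OF posdef_unit[OF w(1)]] by (simp_all add: s_def)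
  have s: "s \<in> posdef" by (rule inverse_posdef[OF w(1) ws])
  define r where "r = s * u * s"
  have rJ: "r \<in> J" unfolding r_def by (rule quadratic_J[OF posdef_J[OF s] u])
  define t where "t = 1 + r * r"
  have "r * r \<in> psd" unfolding psd_eq_squares using rJ by blast
  then have t: "t \<in> posdef" unfolding t_def by (rule posdef_add[OF one_posdef])
  define k where "k = ainv t"
  have tk: "t * k = 1" "k * t = 1" using ainv[OF posdef_unit[OF t]] by (simp_all add: k_def)
  have k: "k \<in> posdef" by (rule inverse_posdef[OF t tk])
  have rt: "r * t = t * r" by (simp add: t_def distrib_left distrib_right mult.assoc)
  have "k * (r * t) * k = k * (t * r) * k" by (simp only: rt)
  then have rk: "k * r = r * k"
    by (simp add: mult.assoc tk) (simp add: mult.assoc[symmetric] tk)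
  define u' v' where "u' = s * (r * k) * s" and "v' = s * k * s"
  have u'J: "u' \<in> J"
    unfolding u'_def by (intro quadratic_J posdef_J[OF s] commuting_mult_J rJ posdef_J[OF k]) (simp only: rk)
  have v'P: "v' \<in> posdef" unfolding v'_def by (rule posdef_sandwich[OF s k])
  have ur: "u = w * r * w"
  proof -
    have "w * r * w = (w * s) * u * (s * w)" by (simp only: r_def mult.assoc)
    then show ?thesis by (simp add: ws)
  qed
  have c: "w * (s * x) = x" "s * (w * x) = x" for x by (simp_all only: mult.assoc[symmetric] ws mult_1_left)
  have kr: "k + r * (r * k) = 1" using tk(1) by (simp add: t_def distrib_right mult.assoc)
  have kr': "r * (k * x) = k * (r * x)" for x by (simp only: mult.assoc[symmetric] rk)
  have kr2: "k * x + k * (r * (r * x)) = x" for x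
  proof -
    have "k * x + k * (r * (r * x)) = (k * t) * x" by (simp add: t_def distrib_left distrib_right mult.assoc)
    then show ?thesis by (simp add: tk)
  qed
  have "u * u' + v * v' = w * (k * s + k * (r * (r * s)))" "u' * u + v' * v = s * (k * w + k * (r * (r * w)))"
    by (simp_all add: ur w(2)[symmetric] u'_def v'_def mult.assoc c kr' distrib_left add.commute)
  then have 1: "u * u' + v * v' = 1" "u' * u + v' * v = 1" by (simp_all add: kr2 ws)
  have 2: "v * u' = u * v'" "v' * u = u' * v"
    by (simp_all add: ur w(2)[symmetric] u'_def v'_def mult.assoc c kr')
  show ?thesis
    using u'J v'P 1 2 by (intro exI[of _ u'] exI[of _ v']) (simp add: cmult_pair)
qed

lemma half_space_unit: "z \<in> half_space \<Longrightarrow> z \<in> Units complexification"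
  and neg_cinv_half_space: "z \<in> half_space \<Longrightarrow> - cinv z \<in> half_space"
proof -
  assume "z \<in> half_space"
  then obtain u v where z: "z = (u, v)" "u \<in> J" "v \<in> posdef" by (auto simp: half_space_def)
  obtain u' v' where *: "u' \<in> J" "v' \<in> posdef" "cmult (u, v) (u', - v') = (1, 0)" "cmult (u', - v') (u, v) = (1, 0)"
    using half_space_inverse[OF z(2,3)] by blast
  show "z \<in> Units complexification" unfolding z(1) by (rule cunitI[OF *(4,3)])
  have "cinv z = (u', - v')" unfolding z(1) by (rule cinv_eqI[OF *(4,3)])
  then show "- cinv z \<in> half_space" using *(1,2) by (simp add: half_space_def neg_J)
qed

lemma half_space_neg_inverse:
  assumes "- w \<in> half_space"
  shows "w \<in> Units complexification" "cinv w \<in> half_space"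
proof -
  have u: "- w \<in> Units complexification" by (rule half_space_unit[OF assms])
  have i: "cmult (- cinv (- w)) w = (1, 0)" "cmult w (- cinv (- w)) = (1, 0)"
    using cinv[OF u] cmult_neg[of "cinv (- w)" "- w"] cmult_neg[of "- w" "cinv (- w)"] by simp_all
  show "w \<in> Units complexification" by (rule cunitI[OF i])
  have "cinv w = - cinv (- w)" by (rule cinv_eqI[OF i])
  then show "cinv w \<in> half_space" using neg_cinv_half_space[OF assms] by simp
qed

text \<open>Invariance of the half-space is combined with the existence of the transformation on it, since only
together do they pass to products.\<close>

definition acts :: "'a^2^2 \<Rightarrow> bool" where
  "acts M \<longleftrightarrow> (\<forall>z\<in>half_space. moebius_denom M z \<in> Units complexification \<and> moebius_action M z \<in> half_space)"

lemma actsD: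
  assumes "acts M" "z \<in> half_space"
  shows "moebius_denom M z \<in> Units complexification" "moebius_action M z \<in> half_space"
  using assms unfolding acts_def by blast+

lemma acts_mult: "acts M \<Longrightarrow> acts N \<Longrightarrow> acts (M ** N)"
proof -
  assume M: "acts M" and N: "acts N"
  have "moebius_denom (M ** N) z \<in> Units complexification \<and> moebius_action (M ** N) z \<in> half_space"
    if z: "z \<in> half_space" for z
    using moebius_compose[OF actsD(1)[OF N z] actsD(1)[OF M actsD(2)[OF N z]]]
      actsD(2)[OF M actsD(2)[OF N z]] by (simp only: simp_thms)
  then show ?thesis unfolding acts_def by blast
qed

lemma one_cunit: "(1, 0) \<in> Units complexification"
  by (rule cunitI[of "(1, 0)"]) (simp_all only: cmult_one)

lemma acts_upper: assumes "b \<in> J" shows "acts (mat2 1 b 0 1)"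
  unfolding acts_def
proof
  fix z assume "z \<in> half_space"
  then obtain u v where z: "z = (u, v)" "u \<in> J" "v \<in> posdef" by (auto simp: half_space_def)
  have den: "moebius_denom (mat2 1 b 0 1) z = (1, 0)" by (simp add: moebius_denom_def z cmult_pair)
  have u: "moebius_denom (mat2 1 b 0 1) z \<in> Units complexification" unfolding den by (rule one_cunit)
  have "moebius_action (mat2 1 b 0 1) z = (u + b, v)"
    by (rule moebius_eqI[OF u]) (simp only: den cmult_one, simp add: moebius_num_def z cmult_pair)
  then show "moebius_denom (mat2 1 b 0 1) z \<in> Units complexification \<and> moebius_action (mat2 1 b 0 1) z \<in> half_space"
    using u z(2,3) assms by (simp add: half_space_def add_J)
qed

lemma acts_diagonal: assumes x: "x \<in> G" shows "acts (mat2 x 0 0 (ainv (\<sigma> x)))" (is "acts ?M")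
  unfolding acts_def
proof
  fix z assume "z \<in> half_space"
  then obtain u v where z: "z = (u, v)" "u \<in> J" "v \<in> posdef" by (auto simp: half_space_def)
  note i = ainv[OF \<sigma>_unit[OF GD(1)[OF x]]]
  have den: "moebius_denom ?M z = (ainv (\<sigma> x), 0)" by (simp add: moebius_denom_def z cmult_pair)
  have u: "moebius_denom ?M z \<in> Units complexification"
    unfolding den by (rule cunitI[of "(\<sigma> x, 0)"]) (simp_all add: cmult_pair i)
  have "moebius_action ?M z = (x * u * \<sigma> x, x * v * \<sigma> x)"
    by (rule moebius_eqI[OF u], unfold den) (simp add: moebius_num_def z cmult_pair mult.assoc i)
  then show "moebius_denom ?M z \<in> Units complexification \<and> moebius_action ?M z \<in> half_space"
    using u z(2,3) G_act_J[OF x] G_act_posdef[OF x] by (simp add: half_space_def)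
qed

text \<open>The denominator \<open>y z + 1\<close> equals \<open>w z\<close> with \<open>w = cinv z + y\<close>, so the Moebius transformation is
\<open>z \<mapsto> cinv w\<close>: an inversion to the lower half-space, a translation, and an inversion back.\<close>

lemma acts_lower: assumes y: "y \<in> J" shows "acts (mat2 1 0 y 1)" (is "acts ?M")
  unfolding acts_def
proof
  fix z assume z: "z \<in> half_space"
  define w where "w = cinv z + (y, 0)"
  have "- w \<in> half_space"
    using neg_cinv_half_space[OF z] y by (cases "cinv z") (simp add: w_def half_space_def diff_J)
  note w = half_space_neg_inverse[OF this]
  have den: "moebius_denom ?M z = cmult w z"
    by (simp add: moebius_denom_def w_def cmult_add cinv(1)[OF half_space_unit[OF z]] add.commute)
  have u: "moebius_denom ?M z \<in> Units complexification"
    unfolding den by (rule cunit_mult[OF w(1) half_space_unit[OF z]])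
  have num: "moebius_num ?M z = z"
    by (cases z) (simp add: moebius_num_def cmult_pair)
  have "moebius_action ?M z = cinv w"
    by (rule moebius_eqI[OF u]) (simp only: num den cmult_assoc[symmetric] cinv(1)[OF w(1)] cmult_one)
  then show "moebius_denom ?M z \<in> Units complexification \<and> moebius_action ?M z \<in> half_space"
    using u w(2) by simp
qed

lemma acts_SpG: assumes "M \<in> SpG" shows "acts M"
proof -
  have big_cell: "acts N" if "N \<in> big_cell" for N
  proof -
    obtain x y z where N: "N = cell x y z" "x \<in> G" "y \<in> J" "z \<in> J" by (rule big_cell_cases[OF \<open>N \<in> big_cell\<close>])
    show ?thesis
      unfolding N(1) cell_factors[symmetric]
      by (intro acts_mult acts_lower acts_diagonal acts_upper N)
  qed
  obtain P Q where "P \<in> big_cell" "Q \<in> big_cell" "M = P ** Q" by (rule SpG_factor[OF assms])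
  then show ?thesis by (simp add: acts_mult big_cell)
qed

lemma action_mult:
  assumes "M \<in> SpG" "N \<in> SpG" "z \<in> half_space"
  shows "moebius_action (M ** N) z = moebius_action M (moebius_action N z)"
  by (rule moebius_compose(2)[OF actsD(1)[OF acts_SpG[OF assms(2)] assms(3)]
        actsD(1)[OF acts_SpG[OF assms(1)] actsD(2)[OF acts_SpG[OF assms(2)] assms(3)]]])

lemma action_one: "moebius_action (mat 1) z = z"
proof (rule moebius_eqI)
  have den: "moebius_denom (mat 1) z = (1, 0)" by (cases z) (simp add: moebius_denom_def mat_1_eq cmult_pair)
  show "moebius_denom (mat 1) z \<in> Units complexification" unfolding den by (rule one_cunit)
  show "moebius_num (mat 1) z = cmult z (moebius_denom (mat 1) z)"
    unfolding den cmult_one by (cases z) (simp add: moebius_num_def mat_1_eq cmult_pair)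
qed

lemma continuous_on_action: "continuous_on (SpG \<times> half_space) (\<lambda>(M, z). moebius_action M z)"
proof -
  have c: "continuous_on (SpG \<times> half_space) (\<lambda>p. cmult (fst p $ i $ 1, 0) (snd p) + (fst p $ i $ 2, 0))" for i
    by (intro continuous_intros bounded_bilinear.continuous_on[OF bounded_bilinear_cmult])
  have "continuous_on (SpG \<times> half_space) (\<lambda>p. cmult (moebius_num (fst p) (snd p)) (cinv (moebius_denom (fst p) (snd p))))"
  proof (intro bounded_bilinear.continuous_on[OF bounded_bilinear_cmult] continuous_on_cinv)
    show "continuous_on (SpG \<times> half_space) (\<lambda>p. moebius_num (fst p) (snd p))"
      unfolding moebius_num_def by (rule c)
    show "continuous_on (SpG \<times> half_space) (\<lambda>p. moebius_denom (fst p) (snd p))"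
      unfolding moebius_denom_def by (rule c)
    show "moebius_denom (fst p) (snd p) \<in> Units complexification" if "p \<in> SpG \<times> half_space" for p
      using that actsD(1)[OF acts_SpG] by auto
  qed
  then show ?thesis by (simp add: moebius_action_def case_prod_beta)
qed

text \<open>The lower triangular matrix with a positive definite diagonal that maps the base point to \<open>z\<close>: the matrix
with parameters \<open>y\<close> and \<open>x\<close> maps \<open>i\<close> to the inverse of \<open>y - i (ainv x)\<^sup>2\<close>, so \<open>y\<close> and \<open>x\<close> are read off
from the inverse of \<open>z\<close>.\<close>

definition lift :: "'a \<times> 'a \<Rightarrow> 'a^2^2" where
  "lift z = cell (ainv (psqrt (- snd (cinv z)))) (fst (cinv z)) 0"

lemma lift_parts:
  assumes z: "z \<in> half_space"
  shows "fst (cinv z) \<in> J" "- snd (cinv z) \<in> posdef"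
    "psqrt (- snd (cinv z)) \<in> posdef" "ainv (psqrt (- snd (cinv z))) \<in> posdef"
proof -
  have "- cinv z \<in> half_space" by (rule neg_cinv_half_space[OF z])
  then have "- fst (cinv z) \<in> J" and p: "- snd (cinv z) \<in> posdef"
    by (cases "cinv z", simp add: half_space_def)+
  then show "fst (cinv z) \<in> J" using neg_J by fastforce
  show "- snd (cinv z) \<in> posdef" by (rule p)
  show s: "psqrt (- snd (cinv z)) \<in> posdef" by (rule psqrt(1)[OF p])
  show "ainv (psqrt (- snd (cinv z))) \<in> posdef"
    by (rule inverse_posdef[OF s ainv(1,2)[OF posdef_unit[OF s]]])
qed

lemma lift_eq:
  assumes z: "z \<in> half_space"
  shows "lift z = mat2 (ainv (psqrt (- snd (cinv z)))) 0
    (fst (cinv z) * ainv (psqrt (- snd (cinv z)))) (psqrt (- snd (cinv z)))"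
  using lift_parts[OF z]
  by (simp add: lift_def cell_def J_sym posdef_J ainv_ainv posdef_unit)

lemma lift_big_cell: "z \<in> half_space \<Longrightarrow> lift z \<in> big_cell"
  unfolding lift_def by (intro big_cell_I posdef_G lift_parts zero_J)

lemma lift_S: "z \<in> half_space \<Longrightarrow> lift z \<in> SpG"
  by (rule big_cell_SpG[OF lift_big_cell])

lemma lift_base:
  assumes z: "z \<in> half_space"
  shows "moebius_action (lift z) base = z"
proof (rule moebius_eqI)
  show "moebius_denom (lift z) base \<in> Units complexification"
    by (rule actsD(1)[OF acts_SpG[OF lift_S[OF z]] base_half_space])
  define s x y where "s = psqrt (- snd (cinv z))" and "x = ainv s" and "y = fst (cinv z)"
  note p = lift_parts[OF z, folded s_def]
  note i = ainv[OF posdef_unit[OF p(3)], folded x_def]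
  have sec: "lift z = mat2 x 0 (y * x) s" using lift_eq[OF z] by (simp only: s_def x_def y_def)
  have iz: "cinv z = (y, - (s * s))"
    using psqrt(2)[OF p(2), folded s_def] by (simp add: prod_eq_iff y_def)
  have den: "moebius_denom (lift z) base = (s, y * x)"
    by (simp add: sec moebius_denom_def base_def cmult_pair)
  have num: "moebius_num (lift z) base = (0, x)"
    by (simp add: sec moebius_num_def base_def cmult_pair)
  have "moebius_denom (lift z) base = cmult (cinv z) (0, x)"
    unfolding den iz cmult_pair by (simp add: mult.assoc i)
  then have "cmult z (moebius_denom (lift z) base) = cmult (cmult z (cinv z)) (0, x)"
    by (simp only: cmult_assoc)
  then show "moebius_num (lift z) base = cmult z (moebius_denom (lift z) base)"
    unfolding num by (simp only: cinv(2)[OF half_space_unit[OF z]] cmult_one)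
qed

lemma continuous_on_section: "continuous_on half_space lift"
proof -
  have c: "continuous_on half_space cinv" using continuous_on_cinv[OF continuous_on_id half_space_unit] by simp
  have s: "continuous_on half_space (\<lambda>z. psqrt (- snd (cinv z)))"
    by (rule continuous_on_compose2[OF continuous_on_psqrt])
       (use lift_parts(2) in \<open>auto intro!: continuous_intros c\<close>)
  have x: "continuous_on half_space (\<lambda>z. ainv (psqrt (- snd (cinv z))))"
    by (rule continuous_on_ainv[OF s posdef_unit[OF lift_parts(3)]])
  have "continuous_on half_space (\<lambda>z. mat2 (ainv (psqrt (- snd (cinv z)))) 0
    (fst (cinv z) * ainv (psqrt (- snd (cinv z)))) (psqrt (- snd (cinv z))))"
    by (intro continuous_on_mat2 s x continuous_on_mult continuous_on_fst c continuous_on_const)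
  then show ?thesis by (rule continuous_on_eq) (simp only: lift_eq)
qed

subsection \<open>The stabilizer of the base point\<close>

lemma stabilizer_iff:
  assumes M: "M \<in> SpG"
  shows "moebius_action M base = base \<longleftrightarrow> M$2$2 = M$1$1 \<and> M$2$1 = - M$1$2"
proof -
  have u: "moebius_denom M base \<in> Units complexification" by (rule actsD(1)[OF acts_SpG[OF M] base_half_space])
  have num: "moebius_num M base = (M$1$2, M$1$1)" and den: "moebius_denom M base = (M$2$2, M$2$1)"
    by (simp_all add: moebius_num_def moebius_denom_def base_def cmult_pair)
  have "moebius_action M base = base \<longleftrightarrow> moebius_num M base = cmult base (moebius_denom M base)"
    using moebius_num_eq[OF u] moebius_eqI[OF u] by metis
  also have "\<dots> \<longleftrightarrow> M$2$2 = M$1$1 \<and> M$2$1 = - M$1$2"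
    by (simp only: num den) (auto simp: base_def cmult_pair)
  finally show ?thesis .
qed

definition Stab :: "('a^2^2) set" where "Stab = {M \<in> SpG. moebius_action M base = base}"

lemma Stab_eq: "Stab = SpG \<inter> {M. M$2$2 = M$1$1} \<inter> {M. M$2$1 = - M$1$2}"
  by (intro equalityI subsetI) (simp_all add: Stab_def stabilizer_iff cong: conj_cong)

lemma closed_Stab: "closed Stab"
  unfolding Stab_eq SpG_eq
  by (intro closed_Int closed_closure closed_Collect_eq continuous_intros)

text \<open>The symplectic relation gives \<open>x (1 + z\<^sup>2) \<sigma>(x) = 1\<close>. With \<open>t\<close> the square root of \<open>1 + z\<^sup>2\<close> this
means \<open>x t \<in> K\<close>, and the entries of the first row are \<open>x t\<close> times \<open>ainv t\<close> and \<open>x t\<close> times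
\<open>ainv t * z\<close>, whose second factors have their spectrum in \<open>[-1, 1]\<close>.\<close>

lemma Stab_big_cell_bounded: "\<exists>R. \<forall>M\<in>Stab \<inter> big_cell. norm (M$1$1) \<le> R \<and> norm (M$1$2) \<le> R"
proof -
  obtain R1 where R1: "\<And>k. k \<in> K \<Longrightarrow> norm k \<le> R1"
    using compact_imp_bounded[OF compact_K] unfolding bounded_iff by blast
  obtain R2 where R2: "\<And>C l. frame C \<Longrightarrow> (\<forall>c\<in>C. \<bar>l c\<bar> \<le> 1) \<Longrightarrow> norm (fc C l) \<le> R2"
    using bounded_spectrum by blast
  have "norm (M$1$1) \<le> R1 * R2 \<and> norm (M$1$2) \<le> R1 * R2" if M: "M \<in> Stab" "M \<in> big_cell" for M
  proof -
    obtain x y z where *: "M = cell x y z" "x \<in> G" "y \<in> J" "z \<in> J" by (rule big_cell_cases[OF M(2)])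
    have MS: "M \<in> SpG" and st: "M$2$2 = M$1$1" "M$2$1 = - M$1$2" using M(1) unfolding Stab_eq by auto
    have ab: "M$1$1 = x" "M$1$2 = x * z" by (simp_all add: * cell_def)
    have "M ** spinv M = mat 1" using S_Sp2[OF MS] unfolding Sp2_iff by (rule conjunct2)
    then have "(M ** spinv M)$1$1 = 1" by (simp add: mat_def)
    then have "x * \<sigma> x + x * z * (z * \<sigma> x) = 1"
      by (simp add: matrix_mult_nth sp_inverse_def st ab \<sigma>_neg \<sigma>_mult J_sym[OF *(4)])
    then have unitary: "x * (1 + z * z) * \<sigma> x = 1" by (simp add: distrib_left distrib_right mult.assoc)
    obtain C l where C: "frame C" "z = fc C l" by (rule spectral_theorem[OF *(4)])
    define t k where "t = fc C (\<lambda>c. sqrt (1 + (l c)\<^sup>2))" and "k = fc C (\<lambda>c. 1 / sqrt (1 + (l c)\<^sup>2))"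
    have pos: "1 + (l c)\<^sup>2 > 0" for c by (simp add: add_pos_nonneg)
    have tP: "t \<in> posdef" unfolding t_def fc_posdef_iff[OF C(1)] using pos by simp
    have tt: "t * t = 1 + z * z"
    proof -
      have "t * t = fc C (\<lambda>c. 1 + l c * l c)"
        unfolding t_def fc_mult[OF C(1)] using pos by (intro fc_cong) (simp add: power2_eq_square less_imp_le)
      then show ?thesis by (simp add: C(2) fc_mult[OF C(1)] fc_add[symmetric] fc_one[OF C(1)])
    qed
    have "t * k = fc C (\<lambda>_. 1)"
      unfolding t_def k_def fc_mult[OF C(1)] using pos by (intro fc_cong) (simp add: less_imp_neq[THEN not_sym])
    then have tk: "t * k = 1" by (simp add: fc_one[OF C(1)])
    have "x * t \<in> K"
    proof -
      have "x * t * \<sigma> (x * t) = x * (t * t) * \<sigma> x" by (simp only: \<sigma>_mult J_sym[OF posdef_J[OF tP]] mult.assoc)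
      then have "x * t * \<sigma> (x * t) = 1" by (simp only: tt unitary)
      then show ?thesis using GD(3)[OF *(2) posdef_G[OF tP]] by (simp add: K_def)
    qed
    then have xt: "norm (x * t) \<le> R1" by (rule R1)
    have R1': "R1 \<ge> 0" using xt norm_ge_zero order_trans by blast
    have n1: "norm k \<le> R2" unfolding k_def by (rule R2[OF C(1)]) (simp add: pos less_imp_le)
    have kz: "k * z = fc C (\<lambda>c. 1 / sqrt (1 + (l c)\<^sup>2) * l c)" unfolding k_def C(2) fc_mult[OF C(1)] ..
    have n2: "norm (k * z) \<le> R2"
      unfolding kz
    proof (rule R2[OF C(1)], rule ballI)
      fix c
      have "\<bar>l c\<bar> \<le> sqrt (1 + (l c)\<^sup>2)" by (rule real_le_rsqrt) simp
      then show "\<bar>1 / sqrt (1 + (l c)\<^sup>2) * l c\<bar> \<le> 1" using pos[of c] by (simp add: abs_mult)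
    qed
    have "x * t * k = x" "x * t * (k * z) = x * z"
      by (simp_all only: mult.assoc tk mult_1_right) (simp only: mult.assoc[symmetric] tk mult_1_left)
    then have "norm x \<le> norm (x * t) * norm k" "norm (x * z) \<le> norm (x * t) * norm (k * z)"
      by (metis norm_mult_ineq)+
    moreover have "norm (x * t) * norm k \<le> R1 * R2" "norm (x * t) * norm (k * z) \<le> R1 * R2"
      by (intro mult_mono xt n1 n2 R1' norm_ge_zero)+
    ultimately show ?thesis unfolding ab by linarith
  qed
  then show ?thesis by blast
qed

lemma lift_at_base: "lift base = mat 1"
proof -
  have i: "cinv base = (0, - 1)" by (rule cinv_eqI) (simp_all add: base_def cmult_pair)
  have "psqrt 1 = 1" by (rule psqrt_unique[OF one_posdef _ one_posdef]) simp
  moreover have "ainv 1 = (1::'a)" by (rule ainv_unique) simp_all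
  ultimately show ?thesis unfolding lift_eq[OF base_half_space] by (simp add: i mat_1_eq)
qed

text \<open>Approximate \<open>M\<close> by \<open>g n\<close> in the cell and correct \<open>g n\<close> by the inverse of the lift of the image of the
base point. The corrections tend to 1. They are lower triangular, so the upper left entry stays
invertible and the corrected matrices remain in the cell.\<close>

lemma Stab_big_cell_dense:
  assumes M: "M \<in> Stab"
  obtains f where "\<And>n. f n \<in> Stab \<inter> big_cell" "f \<longlonglongrightarrow> M"
proof -
  have MS: "M \<in> SpG" and Mb: "moebius_action M base = base" using M by (auto simp: Stab_def)
  obtain g where g: "\<And>n. g n \<in> big_cell" "g \<longlonglongrightarrow> M" by (rule SpG_seq[OF MS]) blast
  have gS: "g n \<in> SpG" for n by (rule big_cell_SpG[OF g(1)])
  define z where "z n = moebius_action (g n) base" for n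
  have zU: "z n \<in> half_space" for n unfolding z_def by (rule actsD(2)[OF acts_SpG[OF gS] base_half_space])
  have z: "z \<longlonglongrightarrow> base"
  proof -
    have "(\<lambda>n. (\<lambda>(M, z). moebius_action M z) (g n, base)) \<longlonglongrightarrow> (\<lambda>(M, z). moebius_action M z) (M, base)"
      by (rule continuous_on_tendsto_compose[OF continuous_on_action])
         (use MS base_half_space gS g(2) in \<open>auto intro!: tendsto_intros\<close>)
    then show ?thesis by (simp add: z_def[abs_def] Mb)
  qed
  have "(\<lambda>n. lift (z n)) \<longlonglongrightarrow> lift base"
    by (rule continuous_on_tendsto_compose[OF continuous_on_section z base_half_space]) (simp add: zU)
  then have lim: "(\<lambda>n. spinv (lift (z n)) ** g n) \<longlonglongrightarrow> spinv (mat 1) ** M"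
    unfolding lift_at_base by (intro tendsto_matrix_mult tendsto_spinv g(2))
  have s1: "spinv (mat 1) = mat 1" by (simp add: sp_inverse_def mat_1_eq mat2_inject \<sigma>_0 \<sigma>_1)
  have "spinv (lift (z n)) ** g n \<in> Stab \<inter> big_cell" for n
  proof
    have sS: "lift (z n) \<in> SpG" and iS: "spinv (lift (z n)) \<in> SpG"
      using lift_S[OF zU] SpG_spinv by blast+
    have h: "spinv (lift (z n)) ** g n \<in> SpG" by (rule SpG_mult[OF iS gS])
    have "moebius_action (spinv (lift (z n)) ** g n) base
        = moebius_action (spinv (lift (z n))) (moebius_action (lift (z n)) base)"
      using action_mult[OF iS gS base_half_space] lift_base[OF zU] by (simp add: z_def)
    also have "\<dots> = moebius_action (spinv (lift (z n)) ** lift (z n)) base"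
      by (rule action_mult[OF iS sS base_half_space, symmetric])
    also have "spinv (lift (z n)) ** lift (z n) = mat 1"
      using S_Sp2[OF sS] unfolding Sp2_iff by (rule conjunct1)
    finally have "moebius_action (spinv (lift (z n)) ** g n) base = base" by (simp only: action_one)
    then show "spinv (lift (z n)) ** g n \<in> Stab" using h by (simp add: Stab_def)
    obtain x y w where *: "g n = cell x y w" "x \<in> G" "y \<in> J" "w \<in> J" by (rule big_cell_cases[OF g(1)])
    have p: "psqrt (- snd (cinv (z n))) \<in> posdef" by (rule lift_parts(3)[OF zU])
    have "(spinv (lift (z n)) ** g n)$1$1 = psqrt (- snd (cinv (z n))) * x"
      by (simp add: matrix_mult_nth sp_inverse_def lift_eq[OF zU] * cell_def \<sigma>_0 J_sym[OF posdef_J[OF p]])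
    then have "(spinv (lift (z n)) ** g n)$1$1 \<in> carrier alg_units"
      using unit_mult[OF posdef_unit[OF p] GD(1)[OF *(2)]] by simp
    then show "spinv (lift (z n)) ** g n \<in> big_cell" by (rule SpG_unit_big_cell[OF h])
  qed
  moreover have "(\<lambda>n. spinv (lift (z n)) ** g n) \<longlonglongrightarrow> M" using lim by (simp add: s1)
  ultimately show thesis by (rule that)
qed

lemma compact_Stab: "compact Stab"
proof -
  obtain R where R: "\<And>M. M \<in> Stab \<inter> big_cell \<Longrightarrow> norm (M$1$1) \<le> R \<and> norm (M$1$2) \<le> R"
    using Stab_big_cell_bounded by blast
  let ?D = "cball (0::'a) R" and ?h = "\<lambda>p::'a \<times> 'a. mat2 (fst p) (snd p) (- snd p) (fst p)"
  have "M \<in> ?h ` (?D \<times> ?D)" if M: "M \<in> Stab" for M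
  proof -
    obtain f where f: "\<And>n. f n \<in> Stab \<inter> big_cell" "f \<longlonglongrightarrow> M" by (rule Stab_big_cell_dense[OF M]) blast
    have "norm (M$1$j) \<le> R" if "j = 1 \<or> j = 2" for j
    proof (rule LIMSEQ_le_const2)
      show "(\<lambda>n. norm (f n $ 1 $ j)) \<longlonglongrightarrow> norm (M $ 1 $ j)" by (intro tendsto_intros f(2))
      show "\<exists>N. \<forall>n\<ge>N. norm (f n $ 1 $ j) \<le> R" using R[OF f(1)] that by auto
    qed
    then have "(M$1$1, M$1$2) \<in> ?D \<times> ?D" by simp
    moreover have "M = ?h (M$1$1, M$1$2)" using M unfolding Stab_eq by (auto simp: mat2_eq_iff)
    ultimately show ?thesis by (rule rev_image_eqI)
  qed
  moreover have "compact (?h ` (?D \<times> ?D))"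
    by (intro compact_continuous_image compact_Times closed_bounded_imp_compact closed_cball bounded_cball
        continuous_on_mat2 continuous_intros)
  ultimately have "compact (?h ` (?D \<times> ?D) \<inter> Stab)" "?h ` (?D \<times> ?D) \<inter> Stab = Stab"
    using closed_Stab by (blast intro: compact_Int_closed)+
  then show ?thesis by (simp only:)
qed

text \<open>The powers of a lower triangular matrix contain the powers of its diagonal entries. Boundedness makes
the diagonal trivial, and then the lower left entry of the n-th power is n times that of the matrix.\<close>

lemma lift_in_compact_subgroup:
  assumes K': "subgroup K' GL2" "compact K'" and z: "z \<in> half_space" and q: "lift z \<in> K'"
  shows "z = base"
proof -
  define s x y where "s = psqrt (- snd (cinv z))" and "x = ainv s" and "y = fst (cinv z)"
  note p = lift_parts[OF z, folded s_def, folded x_def y_def]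
  note i = ainv[OF posdef_unit[OF p(3)], folded x_def]
  have sec: "lift z = mat2 x 0 (y * x) s" using lift_eq[OF z] by (simp only: s_def x_def y_def)
  obtain R where R: "\<And>M. M \<in> K' \<Longrightarrow> norm M \<le> R"
    using compact_imp_bounded[OF K'(2)] unfolding bounded_iff by blast
  have entry: "norm (M $ i $ j) \<le> R" if "M \<in> K'" for M i j
    using R[OF that] Finite_Cartesian_Product.norm_nth_le[of M i] Finite_Cartesian_Product.norm_nth_le[of "M $ i" j] by linarith
  have mult: "M ** N \<in> K'" if "M \<in> K'" "N \<in> K'" for M N
    using subgroup.m_closed[OF K'(1) that] by (simp add: GL2_simps)
  have one: "mat 1 \<in> K'" using subgroup.one_closed[OF K'(1)] by (simp add: GL2_simps)
  have pow: "norm (a ^ n) \<le> R" if a: "mat2 a 0 c d \<in> K'" for a c d n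
  proof -
    have "\<exists>M\<in>K'. M$1$1 = a ^ n \<and> M$1$2 = 0"
    proof (induction n)
      case 0
      then show ?case using one by (intro bexI[of _ "mat 1"]) (simp_all add: mat_1_eq)
    next
      case (Suc n)
      then obtain M where M: "M \<in> K'" "M$1$1 = a ^ n" "M$1$2 = 0" by blast
      then show ?case
        by (intro bexI[OF _ mult[OF M(1) a]]) (simp_all add: matrix_mult_nth power_commutes)
    qed
    then show ?thesis using entry by metis
  qed
  have qK: "mat2 x 0 (y * x) s \<in> K'" using q by (simp only: sec)
  have sp: "lift z \<in> Sp2 \<sigma>" by (rule S_Sp2[OF lift_S[OF z]])
  then have "inv\<^bsub>GL2\<^esub> lift z = spinv (lift z)" unfolding Sp2_iff by (intro inv_GL2) simp_all
  then have "spinv (lift z) \<in> K'" using subgroup.m_inv_closed[OF K'(1) q] by simp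
  then have iK: "mat2 s 0 (- (x * y)) x \<in> K'"
    by (simp add: sec sp_inverse_def \<sigma>_0 \<sigma>_mult J_sym p posdef_J)
  have x1: "s = 1" by (rule power_bounded_posdef[OF p(3) i(1,2) pow[OF iK] pow[OF qK]])
  then have "x = 1" using i(2) by simp
  then have q1: "mat2 1 0 y 1 \<in> K'" using qK by (simp add: x1)
  have "\<exists>M\<in>K'. M = mat2 1 0 (real n *\<^sub>R y) 1" for n
  proof (induction n)
    case 0
    then show ?case using one by (simp add: mat_1_eq)
  next
    case (Suc n)
    then have "mat2 1 0 (real n *\<^sub>R y) 1 ** mat2 1 0 y 1 \<in> K'" using mult q1 by blast
    then show ?case by (simp add: mat2_mult scaleR_add_left add.commute)
  qed
  then have "norm (real n *\<^sub>R y) \<le> R" for n using entry[of _ 2 1] by (metis mat2_nth(3))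
  then have bd: "real n * norm y \<le> R" for n by simp
  have "y = 0"
  proof (rule ccontr)
    assume "y \<noteq> 0"
    then obtain n where "R < real n * norm y" using reals_Archimedean3[of "norm y"] by auto
    then show False using bd[of n] by simp
  qed
  have "cinv z = (y, - (s * s))"
    using psqrt(2)[OF p(2), folded s_def] by (simp add: prod_eq_iff y_def)
  then have "cinv z = (0, - 1)" by (simp add: \<open>y = 0\<close> x1)
  then have "cmult z (0, - 1) = (1, 0)" using cinv(2)[OF half_space_unit[OF z]] by simp
  then have "cmult (cmult z (0, - 1)) (0, 1) = cmult (1, 0) (0, 1)" by simp
  then show ?thesis by (simp only: cmult_assoc) (cases z, simp add: cmult_pair base_def)
qed

theorem half_space_model:
  "symmetric_space_model GL2 SpG half_space (\<lambda>M. \<lambda>z\<in>half_space. moebius_action M z)"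
proof (rule symmetric_space_modelI[where q = lift and ?x0.0 = base])
  show "group (GL2 :: ('a^2^2) monoid)" by (rule group_GL2)
  show "lie_subgroup SpG GL2" by (rule lie_SpG)
  show "moebius_action M z \<in> half_space" if "M \<in> SpG" "z \<in> half_space" for M z by (rule actsD(2)[OF acts_SpG[OF that(1)] that(2)])
  show "moebius_action (M \<otimes>\<^bsub>GL2\<^esub> N) z = moebius_action M (moebius_action N z)"
    if "M \<in> SpG" "N \<in> SpG" "z \<in> half_space" for M N z unfolding GL2_simps by (rule action_mult[OF that])
  show "moebius_action \<one>\<^bsub>GL2\<^esub> z = z" for z :: "'a \<times> 'a" unfolding GL2_simps by (rule action_one)
  show "continuous_on (SpG \<times> half_space) (\<lambda>(M, z). moebius_action M z)" by (rule continuous_on_action)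
  show "base \<in> half_space" by (rule base_half_space)
  show "continuous_on half_space lift" by (rule continuous_on_section)
  show "lift z \<in> SpG" "moebius_action (lift z) base = z" if "z \<in> half_space" for z
    using lift_S[OF that] lift_base[OF that] by blast+
  show "compact {M \<in> SpG. moebius_action M base = base}" using compact_Stab by (simp only: Stab_def)
  fix K' z assume K': "subgroup K' (GL2\<lparr>carrier := SpG\<rparr>)" "compact K'" and z: "z \<in> half_space" "lift z \<in> K'"
  have "subgroup SpG GL2" using lie_SpG by (simp add: lie_subgroup_def)
  then have "subgroup K' GL2" by (rule group.incl_subgroup[OF group_GL2 _ K'(1)])
  then show "z = base" by (rule lift_in_compact_subgroup[OF _ K'(2) z])
qed

end

section \<open>From the definitions to the Jordan algebra\<close>

context formally_real_jordan
begin

text \<open>Taking the commutator of \<open>d\<close> with \<open>d e + e d\<close> shows that \<open>d\<close> and \<open>e\<close> commute.\<close>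

lemma idempotents_anticommute:
  assumes "d * d = d" "e * e = e" "d * e + e * d = 0"
  shows "d * e = 0" "e * d = (0::'a)"
proof -
  have "d * (d * e + e * d) - (d * e + e * d) * d = (d * d) * e - e * (d * d)"
    by (simp add: algebra_simps)
  then have "d * e = e * d" using assms(1,3) by simp
  then have "d * e + d * e = 0" using assms(3) by simp
  then have "d * e = 0" by (metis mult_2 mult_eq_0_iff scaleR_2 scaleR_eq_0_iff zero_neq_numeral)
  then show "d * e = 0" "e * d = 0" using \<open>d * e = e * d\<close> by simp_all
qed

lemma prim_imp_primitive_idempotent:
  assumes J: "J = sym_part \<sigma> B" and c: "prim c"
  shows "primitive_idempotent \<sigma> B c"
proof -
  have idem: "d \<in> idempotents \<sigma> B \<longleftrightarrow> idem d" for d by (simp add: idempotents_def idem_def J[symmetric])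
  have "\<not> (\<exists>d\<in>idempotents \<sigma> B. \<exists>e\<in>idempotents \<sigma> B. d \<noteq> 0 \<and> e \<noteq> 0 \<and> jordan_prod d e = 0 \<and> c = d + e)"
  proof clarify
    fix d e
    assume de: "d \<in> idempotents \<sigma> B" "e \<in> idempotents \<sigma> B" "d \<noteq> 0" "e \<noteq> 0" "jordan_prod d e = 0" "c = d + e"
    then have "d * d = d" "e * e = e" "d * e + e * d = 0"
      by (auto simp: idem idem_def jordan_prod_def)
    note 0 = idempotents_anticommute[OF this]
    have "idem d" "idem e" using de idem by simp_all
    then show False using c de(3,4,6) 0 unfolding prim_def by blast
  qed
  then show ?thesis using c by (simp add: primitive_idempotent_def idem prim_def)
qed

lemma frame_imp_jordan_frame:
  assumes J: "J = sym_part \<sigma> B" and C: "frame C" and cs: "distinct cs" "set cs = C"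
  shows "jordan_frame \<sigma> B cs"
  unfolding jordan_frame_def
proof (intro conjI ballI allI impI)
  show "primitive_idempotent \<sigma> B c" if "c \<in> set cs" for c
    using prim_imp_primitive_idempotent[OF J] frame_ofD(2)[OF C] that cs(2) by simp
  show "jordan_prod (cs ! i) (cs ! j) = 0" if "i < length cs" "j < length cs" "i \<noteq> j" for i j
  proof -
    have "cs ! i \<in> C" "cs ! j \<in> C" "cs ! i \<noteq> cs ! j"
      using that cs by (auto simp: nth_eq_iff_index_eq)
    then have "cs ! i * cs ! j = 0" "cs ! j * cs ! i = 0" using frame_ofD(6)[OF C] by metis+
    then show ?thesis by (simp add: jordan_prod_def)
  qed
  show "sum_list cs = 1"
    using frame_ofD(7)[OF C] cs by (simp add: sum_list_distinct_conv_sum_set[of cs "\<lambda>x. x", simplified])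
qed

end

text \<open>If \<open>a\<^sup>2 = - b\<^sup>2\<close>, the cone contains both rays spanned by \<open>a\<^sup>2\<close>. Hence a cone without lines makes the
Jordan algebra formally real.\<close>

lemma line_in_cone_of_squares:
  fixes a b :: "'a::real_normed_algebra_1"
  assumes "a \<in> sym_part \<sigma> B" "b \<in> sym_part \<sigma> B" "a * a + b * b = 0" "a * a \<noteq> 0"
  shows "contains_line (nonneg_cone \<sigma> B)"
proof -
  have "0 + t *\<^sub>R (a * a) \<in> nonneg_cone \<sigma> B" for t
    unfolding nonneg_cone_def hull_def
  proof (intro InterI)
    fix C assume "C \<in> {t. (closed t \<and> convex_cone t) \<and> {b * b |b. b \<in> sym_part \<sigma> B} \<subseteq> t}"
    then have C: "convex_cone C" "a * a \<in> C" "b * b \<in> C" using assms(1,2) by auto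
    have neg: "b * b = - (a * a)" using assms(3) by (simp add: eq_neg_iff_add_eq_0 add.commute)
    show "0 + t *\<^sub>R (a * a) \<in> C"
    proof (cases "t \<ge> 0")
      case True
      then show ?thesis using C(1,2) by (simp add: convex_cone_def conic_def)
    next
      case False
      moreover have "conic C" using C(1) by (simp add: convex_cone_def)
      ultimately have "(- t) *\<^sub>R (b * b) \<in> C" using C(3) by (intro conicD) simp_all
      moreover have "(- t) *\<^sub>R (b * b) = t *\<^sub>R (a * a)" by (simp add: neg)
      ultimately show ?thesis by (simp only: add_0)
    qed
  qed
  then show ?thesis unfolding contains_line_def using assms(4) by blast
qed

lemma hermitian_imp_hermitian_group:
  fixes \<sigma> :: "'a::{real_normed_algebra_1,banach} \<Rightarrow> 'a"
  assumes inv: "real_involutive_algebra \<sigma>" and G0: "connected_lie_subgroup G\<^sub>0" "\<sigma> ` G\<^sub>0 \<subseteq> G\<^sub>0"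
    and B: "B = lie_algebra G\<^sub>0" and herm: "hermitian \<sigma> G\<^sub>0 B"
  shows "\<exists>E. hermitian_group E (sym_part \<sigma> B) \<sigma> G\<^sub>0 B"
proof -
  define J where "J = sym_part \<sigma> B"
  have lin: "linear \<sigma>" and mult: "\<And>a b. \<sigma> (a * b) = \<sigma> b * \<sigma> a" and invol: "\<And>a. \<sigma> (\<sigma> a) = a"
    using inv by (auto simp: real_involutive_algebra_def)
  obtain T :: "'a set" where T: "finite T" "span T = UNIV" using inv by (auto simp: real_involutive_algebra_def)
  obtain E :: "'a set" where E: "independent E" "UNIV \<subseteq> span E"
    by (rule real_vector.maximal_independent_subset[of UNIV])
  have "finite E" using real_vector.independent_span_bound[OF T(1) E(1)] T(2) by simp
  then interpret finite_dim_algebra E by unfold_locales (use E in auto)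
  have wh: "weakly_hermitian \<sigma> B" and compact: "compact (orthogonal_group G\<^sub>0 \<sigma>)"
    and trans: "\<And>cs ds. jordan_frame \<sigma> B cs \<Longrightarrow> jordan_frame \<sigma> B ds \<Longrightarrow>
        \<exists>u\<in>orthogonal_group G\<^sub>0 \<sigma>. map (\<lambda>c. u * c * ainv u) cs = ds"
    using herm by (auto simp: hermitian_def)
  have jt: "jordan_type \<sigma> B" and oneB: "1 \<in> B" and noline: "\<not> contains_line (nonneg_cone \<sigma> B)"
    and nil: "\<And>b. b \<in> J \<Longrightarrow> b * b = 0 \<Longrightarrow> b = 0"
    using wh by (auto simp: weakly_hermitian_def J_def)
  have subB: "subspace B" and brB: "\<And>x y. x \<in> B \<Longrightarrow> y \<in> B \<Longrightarrow> x * y - y * x \<in> B"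
    and \<sigma>B: "\<sigma> ` B = B" and JB: "\<And>x y. x \<in> J \<Longrightarrow> y \<in> J \<Longrightarrow> x * y \<in> B"
    using jt by (auto simp: jordan_type_def lie_subalgebra_def J_def)
  have J: "x \<in> J \<longleftrightarrow> x \<in> B \<and> \<sigma> x = x" for x by (simp add: J_def sym_part_def)
  have "\<sigma> 1 = 1" using mult[of 1 "\<sigma> 1"] invol[of 1] by simp
  interpret formally_real_jordan E J
  proof
    show "subspace J"
      using subB by (auto simp: subspace_def J linear_0[OF lin] linear_add[OF lin] linear_scale[OF lin])
    show "1 \<in> J" using oneB \<open>\<sigma> 1 = 1\<close> by (simp add: J)
    show "x * x \<in> J" if "x \<in> J" for x using that JB[OF that that] by (simp add: J mult)
    show "x = 0" if "x \<in> J" "y \<in> J" "x * x + y * y = 0" for x y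
      using line_in_cone_of_squares[of x \<sigma> B y] noline nil that by (auto simp: J_def)
  qed
  have "hermitian_group E J \<sigma> G\<^sub>0 B"
  proof (intro hermitian_group.intro hermitian_group_axioms.intro)
    show "formally_real_jordan E J" by (rule formally_real_jordan_axioms)
    show "linear \<sigma>" by (rule lin)
    show "\<sigma> (a * b) = \<sigma> b * \<sigma> a" "\<sigma> (\<sigma> a) = a" for a b by (rule mult, rule invol)
    show "lie_subgroup G\<^sub>0 alg_units" "connected G\<^sub>0" using G0(1) by (simp_all add: connected_lie_subgroup_def)
    show "\<sigma> g \<in> G\<^sub>0" if "g \<in> G\<^sub>0" for g using G0(2) that by blast
    show "B = lie_algebra G\<^sub>0" by (rule B)
    show "subspace B" by (rule subB)
    show "x * y - y * x \<in> B" if "x \<in> B" "y \<in> B" for x y by (rule brB[OF that])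
    show "\<sigma> b \<in> B" if "b \<in> B" for b using \<sigma>B that by blast
    show "J = sym_part \<sigma> B" by (rule J_def)
    show "x * y \<in> B" if "x \<in> J" "y \<in> J" for x y by (rule JB[OF that])
    show "compact (orthogonal_group G\<^sub>0 \<sigma>)" by (rule compact)
    fix C D assume CD: "frame C" "frame D"
    obtain cs where cs: "set cs = C" "distinct cs" using finite_distinct_list[OF frame_ofD(1)[OF CD(1)]] by blast
    obtain ds where ds: "set ds = D" "distinct ds" using finite_distinct_list[OF frame_ofD(1)[OF CD(2)]] by blast
    obtain u where u: "u \<in> orthogonal_group G\<^sub>0 \<sigma>" "map (\<lambda>c. u * c * ainv u) cs = ds"
      using trans[OF frame_imp_jordan_frame[OF J_def CD(1) cs(2,1)] frame_imp_jordan_frame[OF J_def CD(2) ds(2,1)]]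
      by blast
    have "(\<lambda>c. u * c * ainv u) ` C = D" using arg_cong[OF u(2), of set] by (simp add: cs ds)
    then show "\<exists>u\<in>orthogonal_group G\<^sub>0 \<sigma>. (\<lambda>c. u * c * ainv u) ` C = D" using u(1) by blast
  qed
  then show ?thesis unfolding J_def by blast
qed

theorem theorem1p2:
  fixes \<sigma> :: "'a::{real_normed_algebra_1,banach} \<Rightarrow> 'a"
    and G\<^sub>0 B G :: "'a set"
  assumes "real_involutive_algebra \<sigma>"
    and "connected_lie_subgroup G\<^sub>0"
    and "\<sigma> ` G\<^sub>0 \<subseteq> G\<^sub>0"
    and "B = lie_algebra G\<^sub>0"
    and "G = minimal_extension \<sigma> G\<^sub>0 B"
    and "hermitian \<sigma> G\<^sub>0 B"
  shows "symmetric_space_model alg_units G (pos_cone \<sigma> B)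
           (\<lambda>g. \<lambda>b\<in>pos_cone \<sigma> B. g * b * \<sigma> g)
       \<and> (\<forall>M\<in>Sp2_group G B \<sigma>. \<forall>z\<in>upper_half_space \<sigma> B.
            moebius_denom M z \<in> Units complexification)
       \<and> symmetric_space_model GL2 (Sp2_group G B \<sigma>) (upper_half_space \<sigma> B)
           (\<lambda>M. \<lambda>z\<in>upper_half_space \<sigma> B. moebius_action M z)"
proof -
  obtain E where "hermitian_group E (sym_part \<sigma> B) \<sigma> G\<^sub>0 B"
    using hermitian_imp_hermitian_group[OF assms(1-4,6)] by blast
  then interpret H: hermitian_group E "sym_part \<sigma> B" \<sigma> G\<^sub>0 B .
  have G: "H.G = G" by (simp only: H.G_def assms(5))
  have SpG: "H.SpG = Sp2_group G B \<sigma>" by (simp only: H.SpG_def G)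
  have P: "pos_cone \<sigma> B = H.posdef"
    unfolding pos_cone_def nonneg_cone_def H.squares_hull using H.posdef_iff_unit by blast
  have half_space: "upper_half_space \<sigma> B = H.half_space"
    unfolding upper_half_space_def H.half_space_def P using H.posdef_J by auto
  show ?thesis
    unfolding P half_space SpG[symmetric] unfolding G[symmetric]
    using H.positive_cone_model H.half_space_model H.actsD(1)[OF H.acts_SpG] by blast
qed

end
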